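(* For $\mu=1/2$, the regularized components $\mathcal M^e_{\mu,E}$ and $\mathcal M^m_{\mu,E}$ of the circular planar restricted three-body problem are strictly convex for all energies $E\le L_1(1/2)=-2$.
   Context: For $\mu=1/2$ the Hamiltonian is $H(p,q)=\frac12|p+iq|^2-\frac{1/2}{|q-1/2|}-\frac{1/2}{|q+1/2|}-\frac12|q|^2$, $p\in\mathbb C$, $q\in\mathbb C\setminus\{\pm\frac12\}$. Its first Lagrange point $l_1$ is the critical point projecting to $q=0$, with value $L_1(1/2)=-2$, the smallest critical value. For $E\le-2$, $H^{-1}(E)$ has components projecting to bounded punctured disk-like neighborhoods of the earth $q=-\frac12$ and the moon $q=\frac12$ (their closures meet at $l_1$ when $E=-2$). Regularization in elliptic-hyperbolic coordinates $(y,x)\in\mathbb R^2\times(\mathbb R\times\mathbb R/2\pi\mathbb Z)$, with $q_1=\frac12\cosh x_1\cos x_2$, $q_2=\frac12\sinh x_1\sin x_2$ and $y$ the induced momenta: $\frac14(\cosh^2x_1-\cos^2x_2)(H-E)$ extends to $$\hat H_E(y,x)=\tfrac12\Big(y_1+\tfrac{\sin2x_2}{8}\Big)^2+\tfrac12\Big(y_2+\tfrac{\sinh2x_1}{8}\Big)^2+V_E(x),$$ $$V_E(x)=-\tfrac E4\cosh^2x_1-\tfrac12\cosh x_1-\tfrac1{128}\sinh^2(2x_1)+\tfrac E4\cos^2x_2-\tfrac1{128}\sin^2(2x_2).$$ The regularized dynamics is that of $\hat H_E^{-1}(0)$ modulo $(y,x)\sim-(y,x)$. $\mathcal M^e_{1/2,E}$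 and $\mathcal M^m_{1/2,E}$ are the quotients of the parts $\widetilde{\mathcal M}^e_{1/2,E}$, $\widetilde{\mathcal M}^m_{1/2,E}$ of $\hat H_E^{-1}(0)$ that project to the bounded region $\{V_E\le0\}$ around $x=(0,\pi)$ (earth) and around $x=(0,0)$ (moon), respectively. Lifting $x_2$ to $\mathbb R$ (with values in $[\pi/2,3\pi/2]$, resp. $[-\pi/2,\pi/2]$), $\widetilde{\mathcal M}^{e}_{1/2,E}$ and $\widetilde{\mathcal M}^m_{1/2,E}$ are topologically embedded three-spheres in $\mathbb R^4$, double covering $\mathcal M^e_{1/2,E}$, $\mathcal M^m_{1/2,E}$; they are smooth hypersurfaces for $E<-2$, and smooth except at two singular points $S_\pm$ (corresponding to $l_1$) for $E=-2$. Strictly convex: $\mathcal M^e_{1/2,E}$ is strictly convex if $\widetilde{\mathcal M}^e_{1/2,E}$ bounds a convex subset of $\mathbb R^4$ and all sectional curvatures of $\widetilde{\mathcal M}^e_{1/2,E}$ (of $\widetilde{\mathcal M}^e_{1/2,E}\setminus\{S_\pm\}$ if $E=-2$), with the metric induced from $\mathbb R^4$, are positive; similarly for $\mathcal M^m_{1/2,E}$. *)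

theory Defs
  imports "HOL-Analysis.Analysis"
begin

section \<open>Smooth maps and sectional curvature\<close>

text \<open>\<open>Ck_on k f S\<close> is meant for open \<open>S\<close> and finite-dimensional spaces: all iterated
  directional derivatives of \<open>f\<close> up to order \<open>k\<close> exist (as values of Frechet derivatives) and
  are continuous on \<open>S\<close>.\<close>

primrec Ck_on :: "nat \<Rightarrow> ('a::euclidean_space \<Rightarrow> 'b::real_normed_vector) \<Rightarrow> 'a set \<Rightarrow> bool" where
  "Ck_on 0 f S \<longleftrightarrow> continuous_on S f"
| "Ck_on (Suc k) f S \<longleftrightarrow> f differentiable_on S \<and>
     (\<forall>v. Ck_on k (\<lambda>x. frechet_derivative f (at x) v) S)"

definition smooth_on :: "('a::euclidean_space \<Rightarrow> 'b::real_normed_vector) \<Rightarrow> 'a set \<Rightarrow> bool" where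
  "smooth_on f S \<longleftrightarrow> (\<forall>k. Ck_on k f S)"

definition partial :: "'n \<Rightarrow> (real^'n \<Rightarrow> 'b::real_normed_vector) \<Rightarrow> real^'n \<Rightarrow> 'b" where
  "partial i f u = frechet_derivative f (at u) (axis i 1)"

definition local_parametrization ::
    "'a::euclidean_space set \<Rightarrow> (real^'n) set \<Rightarrow> (real^'n \<Rightarrow> 'a) \<Rightarrow> bool" where
  "local_parametrization M U \<phi> \<longleftrightarrow>
     open U \<and> smooth_on \<phi> U \<and>
     (\<forall>u\<in>U. inj (frechet_derivative \<phi> (at u))) \<and>
     (\<exists>W. open W \<and> \<phi> ` U = M \<inter> W) \<and>
     (\<exists>\<psi>. homeomorphism U (\<phi> ` U) \<phi> \<psi>)"

definition induced_metric :: "(real^'n \<Rightarrow> 'a::euclidean_space) \<Rightarrow> real^'n \<Rightarrow> real^'n^'n" where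
  "induced_metric \<phi> u = (\<chi> i j. partial i \<phi> u \<bullet> partial j \<phi> u)"

text \<open>For a Riemannian metric \<open>g\<close> in coordinates, \<open>christoffel g k i j\<close> is the symbol of the
  Levi-Civita connection with upper index \<open>k\<close> and lower indices \<open>i\<close>, \<open>j\<close>, and
  \<open>riemann g l i j k\<close> is the coefficient of the \<open>l\<close>-th coordinate field in
  \<open>R(\<partial>i,\<partial>j)\<partial>k = \<nabla>i \<nabla>j \<partial>k - \<nabla>j \<nabla>i \<partial>k\<close>.\<close>

definition christoffel :: "(real^'n \<Rightarrow> real^'n^'n) \<Rightarrow> 'n \<Rightarrow> 'n \<Rightarrow> 'n \<Rightarrow> real^'n \<Rightarrow> real" where
  "christoffel g k i j u =
     (\<Sum>l\<in>UNIV. matrix_inv (g u) $ k $ l *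
        (partial i (\<lambda>v. g v $ j $ l) u + partial j (\<lambda>v. g v $ i $ l) u
          - partial l (\<lambda>v. g v $ i $ j) u)) / 2"

definition riemann :: "(real^'n \<Rightarrow> real^'n^'n) \<Rightarrow> 'n \<Rightarrow> 'n \<Rightarrow> 'n \<Rightarrow> 'n \<Rightarrow> real^'n \<Rightarrow> real" where
  "riemann g l i j k u =
     partial i (christoffel g l j k) u - partial j (christoffel g l i k) u
     + (\<Sum>m\<in>UNIV. christoffel g l i m u * christoffel g m j k u
                  - christoffel g l j m u * christoffel g m i k u)"

text \<open>Sectional curvature at \<open>u\<close> of the plane spanned by \<open>v\<close> and \<open>w\<close>:
  \<open>g(R(v,w)w, v) / (g(v,v) g(w,w) - g(v,w)^2)\<close>.\<close>

definition sectional_curvature ::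
    "(real^'n \<Rightarrow> real^'n^'n) \<Rightarrow> real^'n \<Rightarrow> real^'n \<Rightarrow> real^'n \<Rightarrow> real" where
  "sectional_curvature g u v w =
     (\<Sum>h\<in>UNIV. \<Sum>l\<in>UNIV. \<Sum>i\<in>UNIV. \<Sum>j\<in>UNIV. \<Sum>k\<in>UNIV.
        g u $ h $ l * riemann g l i j k u * v $ i * w $ j * w $ k * v $ h)
     / ((v \<bullet> (g u *v v)) * (w \<bullet> (g u *v w)) - (v \<bullet> (g u *v w))\<^sup>2)"

text \<open>The space \<open>R^4\<close> of points \<open>(y, x)\<close>; its inner product as an iterated product of copies of
  \<open>real\<close> is the Euclidean one.\<close>

type_synonym phase_space = "(real \<times> real) \<times> (real \<times> real)"

text \<open>The first conjunct makes \<open>M\<close> a smooth hypersurface, so that the second one is not vacuous.\<close>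

definition positive_sectional_curvatures :: "phase_space set \<Rightarrow> bool" where
  "positive_sectional_curvatures M \<longleftrightarrow>
     (\<forall>z\<in>M. \<exists>(U::(real^3) set) \<phi>. local_parametrization M U \<phi> \<and> z \<in> \<phi> ` U) \<and>
     (\<forall>(U::(real^3) set) \<phi>. local_parametrization M U \<phi> \<longrightarrow>
        (\<forall>u\<in>U. \<forall>v w. v \<noteq> w \<and> independent {v, w} \<longrightarrow>
           sectional_curvature (induced_metric \<phi>) u v w > 0))"

definition bounds_convex_set :: "phase_space set \<Rightarrow> bool" where
  "bounds_convex_set M \<longleftrightarrow>
     (\<exists>C. compact C \<and> convex C \<and> interior C \<noteq> {} \<and> frontier C = M)"


section \<open>The restricted three-body problem for equal masses\<close>

definition rtbp_H :: "complex \<times> complex \<Rightarrow> real" where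
  "rtbp_H = (\<lambda>(p, q). (cmod (p + \<i> * q))\<^sup>2 / 2
      - (1/2) / cmod (q - 1/2) - (1/2) / cmod (q + 1/2) - (cmod q)\<^sup>2 / 2)"

definition l1 :: "complex \<times> complex" where
  "l1 = (0, 0)"

definition L1 :: real where
  "L1 = rtbp_H l1"

definition V :: "real \<Rightarrow> real \<times> real \<Rightarrow> real" where
  "V E = (\<lambda>(x1, x2). - E / 4 * (cosh x1)\<^sup>2 - cosh x1 / 2 - (sinh (2 * x1))\<^sup>2 / 128
      + E / 4 * (cos x2)\<^sup>2 - (sin (2 * x2))\<^sup>2 / 128)"

definition regularized_H :: "real \<Rightarrow> phase_space \<Rightarrow> real" where
  "regularized_H E = (\<lambda>((y1, y2), (x1, x2)).
      (y1 + sin (2 * x2) / 8)\<^sup>2 / 2 + (y2 + sinh (2 * x1) / 8)\<^sup>2 / 2 + V E (x1, x2))"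

text \<open>The double cover in \<open>R^4\<close> of the component around the primary at \<open>x = (0, c)\<close>, with \<open>x2\<close>
  lifted to \<open>R\<close>.  The restriction on \<open>x2\<close> matters only for \<open>E = L1\<close>, where the regions of
  different primaries touch at the lifts \<open>x = (0, c \<plusminus> pi/2)\<close> of \<open>q = 0\<close>.  The connected
  component discards the unbounded part of \<open>{V \<le> 0}\<close>.\<close>

definition component_cover :: "real \<Rightarrow> real \<Rightarrow> phase_space set" where
  "component_cover c E = {(y, x). regularized_H E (y, x) = 0 \<and>
     x \<in> connected_component_set
           {x. V E x \<le> 0 \<and> c - pi / 2 \<le> snd x \<and> snd x \<le> c + pi / 2} (0, c)}"

definition singular_points :: "real \<Rightarrow> real \<Rightarrow> phase_space set" where
  "singular_points c E =
     (if E = L1 then {((0, 0), (0, c - pi / 2)), ((0, 0), (0, c + pi / 2))} else {})"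

definition strictly_convex :: "real \<Rightarrow> real \<Rightarrow> bool" where
  "strictly_convex c E \<longleftrightarrow>
     bounds_convex_set (component_cover c E) \<and>
     positive_sectional_curvatures (component_cover c E - singular_points c E)"

definition earth_component_strictly_convex :: "real \<Rightarrow> bool" where
  "earth_component_strictly_convex E \<longleftrightarrow> strictly_convex pi E"

definition moon_component_strictly_convex :: "real \<Rightarrow> bool" where
  "moon_component_strictly_convex E \<longleftrightarrow> strictly_convex 0 E"


section \<open>Consistency with the unregularized problem\<close>

lemma L1_eq: "L1 = -2"
  by (simp add: L1_def rtbp_H_def l1_def norm_divide)

lemma l1_critical: "(rtbp_H has_derivative (\<lambda>_. 0)) (at l1)"
proof -
  have H: "rtbp_H = (\<lambda>z. (Re (fst z) - Im (snd z))\<^sup>2 / 2 + (Im (fst z) + Re (snd z))\<^sup>2 / 2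
      - (1/2) / sqrt ((Re (snd z) - 1/2)\<^sup>2 + (Im (snd z))\<^sup>2)
      - (1/2) / sqrt ((Re (snd z) + 1/2)\<^sup>2 + (Im (snd z))\<^sup>2)
      - ((Re (snd z))\<^sup>2 + (Im (snd z))\<^sup>2) / 2)"
    by (auto simp: rtbp_H_def fun_eq_iff cmod_def field_simps)
  show ?thesis
    unfolding H l1_def
    by (rule derivative_eq_intros | simp add: power2_eq_square real_sqrt_divide)+
qed

text \<open>Here \<open>(y1, y2)\<close> are the momenta induced by the coordinate change:
  \<open>y_i\<close> is the sum over \<open>j\<close> of \<open>p_j\<close> times \<open>\<partial>q_j/\<partial>x_i\<close>.\<close>

lemma regularized_H_eq:
  fixes p1 p2 x1 x2 E :: real
  defines "q1 \<equiv> cosh x1 * cos x2 / 2" and "q2 \<equiv> sinh x1 * sin x2 / 2"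
  defines "y1 \<equiv> p1 * (sinh x1 * cos x2 / 2) + p2 * (cosh x1 * sin x2 / 2)"
    and "y2 \<equiv> p1 * (- cosh x1 * sin x2 / 2) + p2 * (sinh x1 * cos x2 / 2)"
  assumes "Complex q1 q2 \<noteq> 1/2" "Complex q1 q2 \<noteq> - 1/2"
  shows "((cosh x1)\<^sup>2 - (cos x2)\<^sup>2) / 4 * (rtbp_H (Complex p1 p2, Complex q1 q2) - E)
    = regularized_H E ((y1, y2), (x1, x2))"
proof -
  define c s k t where "c = cosh x1" and "s = sinh x1" and "k = cos x2" and "t = sin x2"
  have cs: "s\<^sup>2 = c\<^sup>2 - 1" by (simp add: c_def s_def cosh_square_eq)
  have kt: "t\<^sup>2 = 1 - k\<^sup>2" by (simp add: k_def t_def sin_squared_eq)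
  have c1: "c \<ge> 1" by (simp add: c_def cosh_real_ge_1)
  have k1: "k \<le> 1" "k \<ge> -1" by (simp_all add: k_def)
  have nn: "c - k \<ge> 0" "c + k \<ge> 0" using c1 k1 by linarith+
  have st: "(s * t)\<^sup>2 = (c\<^sup>2 - 1) * (1 - k\<^sup>2)" by (simp add: power_mult_distrib cs kt)
  have "(c * k / 2 - 1/2)\<^sup>2 + (s * t / 2)\<^sup>2 = ((c - k) / 2)\<^sup>2"
    using st by (simp add: power2_eq_square field_simps)
  then have d1: "cmod (Complex q1 q2 - 1/2) = (c - k) / 2"
    using nn by (simp add: cmod_def q1_def q2_def c_def s_def k_def t_def)
  have "(c * k / 2 + 1/2)\<^sup>2 + (s * t / 2)\<^sup>2 = ((c + k) / 2)\<^sup>2"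
    using st by (simp add: power2_eq_square field_simps)
  then have d2: "cmod (Complex q1 q2 + 1/2) = (c + k) / 2"
    using nn by (simp add: cmod_def q1_def q2_def c_def s_def k_def t_def)
  have "Complex q1 q2 + 1/2 \<noteq> 0"
    using assms(6) eq_neg_iff_add_eq_0[of "Complex q1 q2" "1/2"] by simp
  then have "c + k \<noteq> 0" using d2 by (metis div_0 norm_eq_zero)
  moreover have "c - k \<noteq> 0" using assms(5) d1 by (metis div_0 norm_eq_zero right_minus_eq)
  ultimately have ne: "c - k \<noteq> 0" "c + k \<noteq> 0" by simp_all
  have pot: "(c\<^sup>2 - k\<^sup>2) / 4 * ((1/2) / ((c - k) / 2) + (1/2) / ((c + k) / 2)) = c / 2"
  proof -
    have "(1/2) / ((c - k) / 2) + (1/2) / ((c + k) / 2) = 2 * c / ((c - k) * (c + k))"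
      using ne by (simp add: add_frac_eq)
    moreover have "c\<^sup>2 - k\<^sup>2 = (c - k) * (c + k)"
      by (simp add: power2_eq_square algebra_simps)
    ultimately show ?thesis using ne by simp
  qed
  have H: "rtbp_H (Complex p1 p2, Complex q1 q2)
      = (p1\<^sup>2 + p2\<^sup>2) / 2 + p2 * (c * k / 2) - p1 * (s * t / 2)
        - ((1/2) / ((c - k) / 2) + (1/2) / ((c + k) / 2))"
    unfolding rtbp_H_def split d1 d2 cmod_power2
    by (simp add: q1_def q2_def c_def s_def k_def t_def power2_eq_square field_simps)
  have ss: "sinh (2 * x1) = 2 * s * c" "sin (2 * x2) = 2 * t * k"
    by (simp_all add: sinh_double sin_double c_def s_def k_def t_def)
  have yy: "y1\<^sup>2 + y2\<^sup>2 = (c\<^sup>2 - k\<^sup>2) / 4 * (p1\<^sup>2 + p2\<^sup>2)"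
  proof -
    have "y1\<^sup>2 + y2\<^sup>2 = (s\<^sup>2 * k\<^sup>2 + c\<^sup>2 * t\<^sup>2) / 4 * (p1\<^sup>2 + p2\<^sup>2)"
      by (simp add: y1_def y2_def c_def s_def k_def t_def power2_eq_square field_simps)
    then show ?thesis by (simp add: cs kt algebra_simps)
  qed
  have ys: "y1 * (t * k) + y2 * (s * c) = (c\<^sup>2 - k\<^sup>2) * (p2 * (c * k / 2) - p1 * (s * t / 2))"
  proof -
    have "y1 * (t * k) + y2 * (s * c)
        = (s\<^sup>2 + t\<^sup>2) * (p2 * (c * k / 2)) - (c\<^sup>2 - k\<^sup>2) * (p1 * (s * t / 2))"
      by (simp add: y1_def y2_def c_def s_def k_def t_def power2_eq_square field_simps)
    then show ?thesis by (simp add: cs kt algebra_simps)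
  qed
  have "regularized_H E ((y1, y2), (x1, x2))
      = (y1\<^sup>2 + y2\<^sup>2) / 2 + (y1 * (t * k) + y2 * (s * c)) / 4 - E / 4 * (c\<^sup>2 - k\<^sup>2) - c / 2"
    unfolding regularized_H_def V_def split ss c_def[symmetric] k_def[symmetric]
    by (simp add: power2_eq_square field_simps)
  also have "\<dots> = (c\<^sup>2 - k\<^sup>2) / 4 * (rtbp_H (Complex p1 p2, Complex q1 q2) - E)"
    unfolding yy ys H pot[symmetric] by (simp add: algebra_simps add_divide_distrib diff_divide_distrib)
  finally show ?thesis by (simp add: c_def k_def)
qed

end

(* Write E = -2 e and Y for the momenta sheared by the magnetic term.  Then the Hamiltonian separates,
   2 H = Y1^2 + Y2^2 + radial e x1 - angular e x2.  Everything rests on one inequality: at a regular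
   point of the zero level in the strip, the Hessian of H (in the original coordinates) is positive on
   nonzero tangent vectors.  On the zero level Y2^2 + radial = h = angular - Y1^2, and the Hessian is a
   sum of a form on each factor; for a suitable constant M, positivity on the constraint plane
   splits into one inequality for the radial and one for the angular factor.
   By the Gauss equation the inequality makes all sectional curvatures positive.  It also makes the
   sublevel set U = {H < 0} in the strip convex: those q in U for which the segment from a fixed p
   stays in U form an open and closed set, since H restricted to a segment cannot touch 0 from below.
   U is connected, being star-shaped in the sheared coordinates, and its closure is the convex body. *)
theory Submission
  imports Defs
begin

text \<open>The obstacle is that the shear is nonlinear: convexity is claimed in
  \<open>(y, x)\<close>, where the second derivatives of the shear add terms in
  \<open>Y1 * sin (2 * x2)\<close> and \<open>Y2 * sinh x1 * cosh x1\<close>, of either sign. For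
  \<open>e = 1\<close> the level set is asymptotic at the Lagrange points to a quadratic cone, and
  on a cone the Hessian degenerates along the rulings. So both factor inequalities become equalities
  there to leading order, which forces \<open>M\<close> to agree with h to leading order. The choice
  \<open>M = h\<close> fails: with \<open>v = cosh x1 - 1\<close>, and \<open>Y2\<close> and
  \<open>x1\<close> of opposite signs, the shear term has order \<open>v * sqrt v * Y2\<close> and
  beats the margin of order \<open>v^2\<close> in the radial inequality. The correction
  \<open>3/4 * Q^2\<close> repairs this and still leaves the angular inequality room.
  \<open>Q\<close> is the value h would have for \<open>e = 1\<close> at the same \<open>x1\<close>
  and \<open>Y2\<close>; what \<open>e > 1\<close> adds to the radial side is positive semidefinite,
  so only \<open>e = 1\<close> needs an explicit estimate. The threshold \<open>51/100\<close> is a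
  compromise: above it the angular form is definite, and the correction is needed only
  below.\<close>

section \<open>Positivity of the tangential Hessian\<close>

text \<open>The form is a sum of two forms linked by one linear constraint \<open>l1 + l2 = 0\<close>. The first one
  may be indefinite, but is at least \<open>- l1\<^sup>2 / M\<close>, while the second one is at least \<open>l2\<^sup>2 / M\<close>.\<close>

lemma tangential_form_pos_algebraic:
  fixes M Y1 Y2 V1 V2 a b f1 f2 \<alpha> \<beta> :: real
  assumes \<alpha>: "\<alpha> > 0" and M: "M > 0"
    and 1: "f2\<^sup>2 \<le> 2 * (M - Y2\<^sup>2) * \<alpha>"
    and 2: "f1\<^sup>2 > 2 * (M + Y1\<^sup>2) * \<beta>"
    and t: "Y1 * V1 - f1 * a / 2 + Y2 * V2 + f2 * b / 2 = 0"
    and nz: "V1 \<noteq> 0 \<or> V2 \<noteq> 0 \<or> a \<noteq> 0 \<or> b \<noteq> 0"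
  shows "V1\<^sup>2 - \<beta> * a\<^sup>2 / 2 + V2\<^sup>2 + \<alpha> * b\<^sup>2 / 2 > 0"
proof -
  define \<tau> where "\<tau> = Y2 * V2 + f2 * b / 2"
  have \<tau>: "Y1 * V1 - f1 * a / 2 = - \<tau>" using t by (simp add: \<tau>_def)
  have "f2\<^sup>2 / (2 * \<alpha>) \<le> M - Y2\<^sup>2"
    using 1 \<alpha> by (subst pos_divide_le_eq) (auto simp: algebra_simps)
  then have D2: "Y2\<^sup>2 + f2\<^sup>2 / (2 * \<alpha>) \<le> M" by simp
  \<comment> \<open>Lagrange's identity. The first factor on the right is the squared norm of the
    functional \<open>l2\<close> dual to the second form, which hypothesis \<open>1\<close> bounds
    by \<open>M\<close>.\<close>
  have cs: "\<tau>\<^sup>2 + (\<alpha> * Y2 * b - f2 * V2)\<^sup>2 / (2 * \<alpha>)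
      = (Y2\<^sup>2 + f2\<^sup>2 / (2 * \<alpha>)) * (V2\<^sup>2 + \<alpha> * b\<^sup>2 / 2)"
    using \<alpha> unfolding \<tau>_def by (simp add: power2_eq_square field_simps)
  have B2: "V2\<^sup>2 + \<alpha> * b\<^sup>2 / 2 \<ge> 0" using \<alpha> by simp
  have "0 \<le> (\<alpha> * Y2 * b - f2 * V2)\<^sup>2 / (2 * \<alpha>)" using \<alpha> by simp
  with cs have "\<tau>\<^sup>2 \<le> (Y2\<^sup>2 + f2\<^sup>2 / (2 * \<alpha>)) * (V2\<^sup>2 + \<alpha> * b\<^sup>2 / 2)" by linarith
  also have "\<dots> \<le> M * (V2\<^sup>2 + \<alpha> * b\<^sup>2 / 2)" by (rule mult_right_mono[OF D2 B2])
  finally have I2: "\<tau>\<^sup>2 \<le> M * (V2\<^sup>2 + \<alpha> * b\<^sup>2 / 2)" .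
  define A where "A = M + Y1\<^sup>2"
  have A: "A > 0" using M by (simp add: A_def add_pos_nonneg)
  \<comment> \<open>Completing the square in \<open>V1\<close>. Up to a positive factor,
    \<open>f1\<^sup>2 - 2 * A * \<beta>\<close> is the determinant of \<open>M\<close> times the
    first form plus \<open>l1\<^sup>2\<close>, so hypothesis \<open>2\<close> makes that sum
    positive definite.\<close>
  have key: "4 * A * (M * (V1\<^sup>2 - \<beta> * a\<^sup>2 / 2) + \<tau>\<^sup>2)
      = (2 * A * V1 - Y1 * f1 * a)\<^sup>2 + M * (f1\<^sup>2 - 2 * A * \<beta>) * a\<^sup>2"
  proof -
    have \<tau>': "\<tau> = f1 * a / 2 - Y1 * V1" using \<tau> by simp
    show ?thesis unfolding A_def \<tau>' by (simp add: power2_eq_square field_simps)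
  qed
  show ?thesis
  proof (cases "V1 = 0 \<and> a = 0")
    case True
    then have "V2 \<noteq> 0 \<or> b \<noteq> 0" using nz by simp
    then have "V2\<^sup>2 + \<alpha> * b\<^sup>2 / 2 > 0"
      using \<alpha> by (auto simp: add_pos_nonneg add_nonneg_pos)
    then show ?thesis using True by simp
  next
    case False
    have G: "M * (f1\<^sup>2 - 2 * A * \<beta>) > 0" using M 2 by (simp add: A_def)
    have "(2 * A * V1 - Y1 * f1 * a)\<^sup>2 + M * (f1\<^sup>2 - 2 * A * \<beta>) * a\<^sup>2 > 0"
    proof (cases "a = 0")
      case True
      then show ?thesis using False A by simp
    next
      case False
      then have "M * (f1\<^sup>2 - 2 * A * \<beta>) * a\<^sup>2 > 0" using G by simp
      then show ?thesis by (simp add: add_nonneg_pos)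
    qed
    then have "4 * A * (M * (V1\<^sup>2 - \<beta> * a\<^sup>2 / 2) + \<tau>\<^sup>2) > 0" using key by simp
    then have "M * (V1\<^sup>2 - \<beta> * a\<^sup>2 / 2) + \<tau>\<^sup>2 > 0" using A by (simp add: zero_less_mult_iff)
    then have "M * (V1\<^sup>2 - \<beta> * a\<^sup>2 / 2) + M * (V2\<^sup>2 + \<alpha> * b\<^sup>2 / 2) > 0" using I2 by linarith
    then have "M * (V1\<^sup>2 - \<beta> * a\<^sup>2 / 2 + V2\<^sup>2 + \<alpha> * b\<^sup>2 / 2) > 0" by (simp add: algebra_simps)
    then show ?thesis using M by (simp add: zero_less_mult_iff)
  qed
qed

section \<open>The angular factor\<close>

text \<open>Here \<open>K = cos\<^sup>2 x2\<close>, \<open>\<delta> = 1 / (16 e)\<close> and \<open>w = Y1\<^sup>2 / (e K)\<close>. Both sides have the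
  same limit as \<open>K\<close> tends to 0, so the bounds on the factors have to be exact to that order.\<close>

lemma angular_bound_scaled:
  fixes \<delta> K w :: real
  defines "\<gamma> \<equiv> 1 + \<delta> * (1 - K)"
  defines "B \<equiv> 1 - 2 * K + \<delta> * (1 - 8 * K + 8 * K\<^sup>2) + K * (2/3 * w + 6 * \<delta> * (1 - K))"
  assumes \<delta>: "0 \<le> \<delta>" "\<delta> \<le> 1/16" and K: "0 < K" "K < 1" and w: "0 \<le> w" "w \<le> \<gamma>"
  shows "(\<gamma> + 3/4 * K * (\<gamma> - w)\<^sup>2) * B < (1 - K) * (\<gamma> - \<delta> * K)\<^sup>2"
proof -
  have \<gamma>1: "\<gamma> \<ge> 1" "\<gamma> \<le> 1 + \<delta>"
    using \<delta> K by (auto simp: \<gamma>_def mult_left_le)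
  have dK: "0 \<le> \<delta> * K" "\<delta> * K \<le> \<delta>" "\<delta> * K \<le> 1/16 * K" using \<delta> K by (auto simp: mult_left_le intro: mult_right_mono)
  have L: "(1 - K) * (\<gamma> - \<delta> * K)\<^sup>2 > 0"
  proof -
    have "\<gamma> - \<delta> * K > 0" using \<gamma>1 dK \<delta> by linarith
    then show ?thesis using K by simp
  qed
  show ?thesis
  proof (cases "B \<le> 0")
    case True
    have "\<gamma> + 3/4 * K * (\<gamma> - w)\<^sup>2 \<ge> 0" using \<gamma>1 K by simp
    with True have "(\<gamma> + 3/4 * K * (\<gamma> - w)\<^sup>2) * B \<le> 0" by (simp add: mult_nonneg_nonpos)
    then show ?thesis using L by linarith
  next
    case False
    define r where "r = \<gamma> - w"
    have r: "0 \<le> r" "r \<le> \<gamma>" using w by (auto simp: r_def)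
    \<comment> \<open>\<open>b\<close> is free of \<open>w\<close>: since
      \<open>w = \<gamma> - r\<close>, the term \<open>2/3 * K * w\<close> of \<open>B\<close> is
      the only source of \<open>r\<close>.\<close>
    define b where "b = B + 2/3 * K * r"
    have b: "b = 1 - 4/3 * K + \<delta> * (1 - 4/3 * K + 4/3 * K\<^sup>2)"
      unfolding b_def B_def r_def \<gamma>_def by (simp add: power2_eq_square field_simps)
    have b1: "b \<le> 1 + \<delta>"
    proof -
      have "\<delta> * (4/3 * K * (1 - K)) \<ge> 0" using \<delta> K by simp
      moreover have "b = 1 + \<delta> - 4/3 * K - \<delta> * (4/3 * K * (1 - K))"
        unfolding b by (simp add: power2_eq_square field_simps)
      ultimately show ?thesis using K by linarith
    qed
    have "r\<^sup>2 \<le> \<gamma> * r" using r by (simp add: power2_eq_square mult_right_mono)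
    then have "3/4 * K * r\<^sup>2 \<le> 3/4 * K * (\<gamma> * r)" using K by (intro mult_left_mono) auto
    then have "(\<gamma> + 3/4 * K * r\<^sup>2) * B \<le> \<gamma> * (1 + 3/4 * K * r) * B"
      using False by (intro mult_right_mono) (auto simp: algebra_simps)
    also have "\<dots> = \<gamma> * (b + K * r * (3/4 * b - 2/3) - 1/2 * (K * r)\<^sup>2)"
      unfolding b_def by (simp add: power2_eq_square field_simps)
    also have "\<dots> \<le> \<gamma> * (b + K * r * (3/4 * b - 2/3))"
      using \<gamma>1 by (intro mult_left_mono) auto
    \<comment> \<open>After division by \<open>K / 3\<close> the margin is at least
      \<open>1/2\<close>, because \<open>\<delta> \<le> 1/16\<close>, while the term in
      \<open>r\<close> is at most \<open>425/1024\<close>, because \<open>r\<close> and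
      \<open>b\<close> are at most \<open>17/16\<close>.\<close>
    also have "\<dots> < \<gamma> * ((1 - K) * (\<gamma> - 2 * \<delta> * K))"
    proof (rule mult_strict_left_mono)
      have e: "(1 - K) * (\<gamma> - 2 * \<delta> * K) - b = K / 3 * (1 - 8 * \<delta> + 5 * (\<delta> * K))"
        unfolding b \<gamma>_def by (simp add: power2_eq_square field_simps)
      have "r * (9/4 * b - 2) \<le> 425/1024"
      proof (cases "9/4 * b - 2 \<le> 0")
        case True
        then have "r * (9/4 * b - 2) \<le> 0" using r by (simp add: mult_nonneg_nonpos)
        then show ?thesis by linarith
      next
        case False
        have "r * (9/4 * b - 2) \<le> (17/16) * (25/64)"
          using False r \<gamma>1 b1 \<delta> by (intro mult_mono) auto
        then show ?thesis by simp
      qed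
      then have "r * (9/4 * b - 2) < 1 - 8 * \<delta> + 5 * (\<delta> * K)" using \<delta> dK by linarith
      then have "K / 3 * (r * (9/4 * b - 2)) < K / 3 * (1 - 8 * \<delta> + 5 * (\<delta> * K))"
        using K by simp
      moreover have "K / 3 * (r * (9/4 * b - 2)) = K * r * (3/4 * b - 2/3)" by (simp add: field_simps)
      ultimately show "b + K * r * (3/4 * b - 2/3) < (1 - K) * (\<gamma> - 2 * \<delta> * K)" using e by linarith
    qed (use \<gamma>1 in simp)
    also have "\<dots> \<le> (1 - K) * (\<gamma> - \<delta> * K)\<^sup>2"
    proof -
      have "(1 - K) * (\<delta> * K)\<^sup>2 \<ge> 0" using K by simp
      then show ?thesis by (simp add: power2_eq_square algebra_simps)
    qed
    finally show ?thesis by (simp add: r_def)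
  qed
qed

text \<open>Provides hypothesis \<open>2\<close> of \<open>tangential_form_pos_algebraic\<close> for
  the angular factor. Only \<open>\<beta> > 0\<close> needs work; scaling by \<open>e\<close> and
  \<open>K\<close> then leaves \<open>e\<close> only inside \<open>\<delta>\<close>.\<close>

lemma angular_bound:
  fixes e K \<sigma> Y M :: real
  defines "g \<equiv> e * K + K * (1 - K) / 16"
  assumes e: "e \<ge> 1" and K: "0 < K" "K < 1" and \<sigma>: "\<sigma>\<^sup>2 = 4 * K * (1 - K)"
    and Y: "Y\<^sup>2 \<le> g" and M: "M + Y\<^sup>2 \<le> g + 3/4 * ((g - Y\<^sup>2)\<^sup>2 / e)" and M0: "M + Y\<^sup>2 \<ge> 0"
  shows "2 * (M + Y\<^sup>2) * (- 2 * e * (2 * K - 1) + (2 * (2 * K - 1)\<^sup>2 - 1) / 8 + Y * \<sigma>)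
    < (\<sigma> * (e - (2 * K - 1) / 16))\<^sup>2"
proof -
  define \<delta> where "\<delta> = 1 / (16 * e)"
  define \<gamma> where "\<gamma> = 1 + \<delta> * (1 - K)"
  define w where "w = Y\<^sup>2 / (e * K)"
  define B where "B = 1 - 2 * K + \<delta> * (1 - 8 * K + 8 * K\<^sup>2) + K * (2/3 * w + 6 * \<delta> * (1 - K))"
  define \<beta> where "\<beta> = - 2 * e * (2 * K - 1) + (2 * (2 * K - 1)\<^sup>2 - 1) / 8 + Y * \<sigma>"
  have \<delta>: "0 \<le> \<delta>" "\<delta> \<le> 1/16" "e * \<delta> = 1/16" using e by (auto simp: \<delta>_def field_simps)
  have eK: "e * K > 0" using e K by simp
  have g: "g = e * K * \<gamma>"
    unfolding g_def \<gamma>_def \<delta>_def using e by (simp add: field_simps)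
  have Yw: "Y\<^sup>2 = e * K * w" using e K by (simp add: w_def)
  have "w \<le> \<gamma>"
    unfolding w_def using Y eK g by (subst pos_divide_le_eq) (auto simp: mult.commute)
  moreover have "0 \<le> w" using eK by (simp add: w_def)
  ultimately have w: "0 \<le> w" "w \<le> \<gamma>" by simp_all
  have main: "(\<gamma> + 3/4 * K * (\<gamma> - w)\<^sup>2) * B < (1 - K) * (\<gamma> - \<delta> * K)\<^sup>2"
    unfolding \<gamma>_def B_def by (rule angular_bound_scaled) (use \<delta> K w in \<open>auto simp: \<gamma>_def\<close>)
  have rhs: "(\<sigma> * (e - (2 * K - 1) / 16))\<^sup>2 = 4 * e\<^sup>2 * K * ((1 - K) * (\<gamma> - \<delta> * K)\<^sup>2)"
  proof -
    have "e - (2 * K - 1) / 16 = e * (\<gamma> - \<delta> * K)" unfolding \<gamma>_def \<delta>_def using e by (simp add: field_simps)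
    then show ?thesis by (simp add: power_mult_distrib \<sigma>)
  qed
  have pos: "(\<sigma> * (e - (2 * K - 1) / 16))\<^sup>2 > 0"
  proof -
    have "\<sigma>\<^sup>2 > 0" using \<sigma> K by simp
    moreover have "e - (2 * K - 1) / 16 > 0" using e K by simp
    ultimately show ?thesis by simp
  qed
  have "2 * (M + Y\<^sup>2) * \<beta> < (\<sigma> * (e - (2 * K - 1) / 16))\<^sup>2"
  proof (cases "\<beta> \<le> 0")
    case True
    then have "2 * (M + Y\<^sup>2) * \<beta> \<le> 0" using M0 by (intro mult_nonneg_nonpos) auto
    then show ?thesis using pos by linarith
  next
    case False
    \<comment> \<open>Young's inequality; the weights \<open>4/3\<close> and \<open>3/16\<close>
      become the terms \<open>2/3 * w\<close> and \<open>6 * \<delta> * (1 - K)\<close> of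
      \<open>B\<close>.\<close>
    have "Y * \<sigma> \<le> 4/3 * Y\<^sup>2 + 3/16 * \<sigma>\<^sup>2"
    proof -
      have "0 \<le> (4 * Y - 3/2 * \<sigma>)\<^sup>2" by simp
      then show ?thesis by (simp add: power2_eq_square algebra_simps)
    qed
    moreover have "2 * e * B = - 2 * e * (2 * K - 1) + (2 * (2 * K - 1)\<^sup>2 - 1) / 8
        + (4/3 * Y\<^sup>2 + 3/16 * \<sigma>\<^sup>2)"
      unfolding B_def \<sigma> Yw \<delta>_def using e by (simp add: power2_eq_square field_simps)
    ultimately have \<beta>B: "\<beta> \<le> 2 * e * B" unfolding \<beta>_def by linarith
    have "(g - Y\<^sup>2)\<^sup>2 / e = e * K * (K * (\<gamma> - w)\<^sup>2)"
      unfolding g Yw using e by (simp add: power2_eq_square field_simps)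
    with M have MY: "M + Y\<^sup>2 \<le> e * K * (\<gamma> + 3/4 * K * (\<gamma> - w)\<^sup>2)"
      by (simp add: g algebra_simps)
    have "(M + Y\<^sup>2) * \<beta> \<le> (e * K * (\<gamma> + 3/4 * K * (\<gamma> - w)\<^sup>2)) * (2 * e * B)"
      using MY \<beta>B M0 False by (intro mult_mono) auto
    also have "\<dots> = 2 * e\<^sup>2 * K * ((\<gamma> + 3/4 * K * (\<gamma> - w)\<^sup>2) * B)"
      by (simp add: power2_eq_square)
    also have "\<dots> < 2 * e\<^sup>2 * K * ((1 - K) * (\<gamma> - \<delta> * K)\<^sup>2)"
      using main e K by (intro mult_strict_left_mono) auto
    finally show ?thesis unfolding rhs by (simp add: algebra_simps)
  qed
  then show ?thesis by (simp add: \<beta>_def)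
qed

text \<open>The symmetric 2 by 2 matrices with diagonals \<open>a, b\<close> and \<open>c, d\<close>
  and off-diagonal entries \<open>p\<close> and \<open>q\<close> are positive semidefinite, hence so
  is their sum. The radial quantities are affine in \<open>e\<close>, so this passes from
  \<open>e = 1\<close> to \<open>e \<ge> 1\<close>.\<close>

lemma psd_cauchy_schwarz:
  fixes a b c d p q :: real
  assumes "a \<ge> 0" "b \<ge> 0" "c \<ge> 0" "d \<ge> 0" and p: "p\<^sup>2 \<le> a * b" and q: "q\<^sup>2 \<le> c * d"
  shows "(p + q)\<^sup>2 \<le> (a + c) * (b + d)"
proof -
  have "(2 * p * q)\<^sup>2 = 4 * (p\<^sup>2 * q\<^sup>2)" by (simp add: power2_eq_square)
  also have "\<dots> \<le> 4 * ((a * b) * (c * d))"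
    using mult_mono[OF p q] assms by simp
  also have "\<dots> \<le> (a * d + c * b)\<^sup>2"
    using zero_le_power2[of "a * d - c * b"] by (simp add: power2_eq_square algebra_simps)
  finally have "2 * p * q \<le> a * d + c * b"
    by (rule power2_le_imp_le) (use assms in simp)
  moreover have "(p + q)\<^sup>2 = p\<^sup>2 + 2 * p * q + q\<^sup>2" by (simp add: power2_sum)
  moreover have "(a + c) * (b + d) = a * b + (a * d + c * b) + c * d" by (simp add: algebra_simps)
  ultimately show ?thesis using p q by linarith
qed

section \<open>The radial factor, and the angular factor at high levels\<close>

lemma power_Suc_le_mult:
  fixes v b :: real
  assumes "0 \<le> v" "v \<le> b"
  shows "v^(Suc k) \<le> b * v^k"
  using assms by (simp add: mult_right_mono)

text \<open>Hypothesis \<open>N\<close> leaves at most \<open>1 - n\<close> for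
  \<open>Y\<^sup>2\<close>, which bounds the shear term \<open>2 * Y * s * u\<close>; what remains
  is a polynomial inequality in \<open>v\<close> alone.\<close>

lemma radial_curvature_pos:
  fixes v u W s Y :: real
  assumes u: "u = 1 + v" and v: "0 \<le> v" "v \<le> 1" and W: "Y\<^sup>2 = W" and s: "s\<^sup>2 = u\<^sup>2 - 1"
    and N: "u\<^sup>2 - u - u\<^sup>2 * (u\<^sup>2 - 1) / 16 + W \<le> 1"
  shows "5 * u\<^sup>2 - u^4 - u - 17/8 + 2 * Y * s * u > 0"
proof -
  define A where "A = 5 * u\<^sup>2 - u^4 - u - 17/8"
  define n where "n = u\<^sup>2 - u - u\<^sup>2 * (u\<^sup>2 - 1) / 16"
  have n: "n = ((1 + v) * v) * (16 - (1 + v) * (2 + v)) / 16"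
    unfolding n_def u by (simp add: power2_eq_square field_simps)
  have W0: "W \<ge> 0" using W by (metis zero_le_power2)
  \<comment> \<open>For larger \<open>v\<close> the term \<open>n\<close> alone would exceed
    1.\<close>
  have v78: "v \<le> 7/8"
  proof (rule ccontr)
    assume "\<not> v \<le> 7/8"
    then have *: "7/8 \<le> v" by simp
    have "(15/8) * (7/8) \<le> (1 + v) * v" using * by (intro mult_mono) auto
    moreover have "(1 + v) * (2 + v) \<le> 2 * 3" using v by (intro mult_mono) auto
    ultimately have "((15/8) * (7/8)) * 10 \<le> ((1 + v) * v) * (16 - (1 + v) * (2 + v))"
      using * by (intro mult_mono[of "(15/8) * (7/8)" "(1 + v) * v"]) auto
    then have "n > 1" unfolding n by simp
    then show False using N W0 by (simp add: n_def)
  qed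
  note pf = power_Suc_le_mult[OF v(1) v78, of 1] power_Suc_le_mult[OF v(1) v78, of 2]
    power_Suc_le_mult[OF v(1) v78, of 3]
  have pf: "v^2 \<le> 7/8 * v" "v^3 \<le> 7/8 * v^2" "v^4 \<le> 7/8 * v^3"
    using pf by (simp_all add: eval_nat_numeral)
  have p0: "0 \<le> v^2" "0 \<le> v^5" "0 \<le> v^7" "0 \<le> v^8" using v by auto
  have "A = 7/8 + 5 * v - v^2 - 4 * v^3 - v^4"
    unfolding A_def u by (simp add: eval_nat_numeral field_simps)
  then have A: "A > 0" using pf v by linarith
  have "A\<^sup>2 - 4 * (1 - n) * (u\<^sup>2 - 1) * u\<^sup>2
      = 49/64 + 3/4 * v + v^2 * (41/4 - 10 * v - 19 * v^2 + 7 * v^3 + 31/2 * v^4)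
        + 6 * v^7 + 3/4 * v^8"
    unfolding A_def u n_def by (simp add: eval_nat_numeral field_simps)
  moreover have "v^2 * (41/4 - 10 * v - 19 * v^2 + 7 * v^3 + 31/2 * v^4) \<ge> - 1/5"
  proof -
    \<comment> \<open>The quartic dips slightly below 0 near \<open>v = 3/4\<close>. Squares centred
      near that point absorb its terms of degree 4, 3 and 2; the loss \<open>1/5\<close> is later
      covered by the constant \<open>49/64\<close>.\<close>
    have "0 \<le> (v\<^sup>2 - 11/20)\<^sup>2" "0 \<le> v * (v - 37/50)\<^sup>2" "0 \<le> (v - 41/50)\<^sup>2" using v by auto
    then have "41/4 - 10 * v - 19 * v^2 + 7 * v^3 + 31/2 * v^4 \<ge> - 1/5"
      using v by (simp add: eval_nat_numeral field_simps)
    then have "v^2 * (41/4 - 10 * v - 19 * v^2 + 7 * v^3 + 31/2 * v^4) \<ge> v^2 * (- 1/5)"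
      by (intro mult_left_mono) auto
    moreover have "v^2 \<le> 1" using v by (simp add: power_le_one)
    ultimately show ?thesis by linarith
  qed
  ultimately have A2: "4 * (1 - n) * (u\<^sup>2 - 1) * u\<^sup>2 < A\<^sup>2" using v p0 by linarith
  have "(2 * Y * s * u)\<^sup>2 = 4 * W * ((u\<^sup>2 - 1) * u\<^sup>2)" by (simp add: power_mult_distrib W s)
  also have "\<dots> \<le> 4 * (1 - n) * ((u\<^sup>2 - 1) * u\<^sup>2)"
  proof (rule mult_right_mono)
    show "4 * W \<le> 4 * (1 - n)" using N by (simp add: n_def)
    have "u\<^sup>2 \<ge> 1" using v by (simp add: u)
    then show "0 \<le> (u\<^sup>2 - 1) * u\<^sup>2" by simp
  qed
  also have "\<dots> < A\<^sup>2" using A2 by (simp add: mult.assoc)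
  finally have "\<bar>2 * Y * s * u\<bar>\<^sup>2 < A\<^sup>2" by (simp only: power2_abs)
  then have "\<bar>2 * Y * s * u\<bar> < A" by (rule power2_less_imp_less) (use A in simp)
  then have "- (2 * Y * s * u) < A" by (simp only: abs_less_iff)
  then show ?thesis unfolding A_def by simp
qed

text \<open>In the next two lemmas \<open>u = 1 + v\<close> is \<open>cosh x1\<close>, and \<open>Q\<close> is \<open>Y2\<^sup>2 + radial 1 x1\<close>; both sides
  vanish at \<open>v = Q = 0\<close>, the Lagrange point.\<close>

lemma radial_bound_scaled:
  fixes v Q :: real
  defines "u \<equiv> 1 + v"
  defines "n \<equiv> u * (16 - u - u\<^sup>2) / 16" and "m \<equiv> 17/8 * u - 1 - u^3/4"
  defines "A \<equiv> 5 * u\<^sup>2 - u^4 - u - 17/8 - 2/3 * u * (v * (u + 1)) + 3/2 * u * (v * n)"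
  assumes v: "0 \<le> v" "v \<le> 91/200" and Q: "0 \<le> Q" "Q \<le> 51/100"
  shows "v * (u + 1) * m\<^sup>2 / 2 \<le> (v * n + 3/4 * Q\<^sup>2) * (A - 3/2 * u * Q)"
proof -
  define L where "L = 833/384 + 163/192 * v - 1561/512 * v^2 - 1441/512 * v^3 - 277/768 * v^4
    + 233/768 * v^5 + 43/512 * v^6 + 3/512 * v^7"
  \<comment> \<open>At \<open>v = 0\<close> all of \<open>A\<close>, \<open>n\<close> and
    \<open>m\<close> equal \<open>7/8\<close> and the difference vanishes: this is the leading-order
    equality at the Lagrange point. \<open>L\<close> is the cofactor that is left.\<close>
  have LA: "A * n - (u + 1) * m\<^sup>2 / 2 = v * L"
    unfolding A_def L_def n_def m_def u_def by (simp add: eval_nat_numeral field_simps)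
  note pf = power_Suc_le_mult[OF v, of 1] power_Suc_le_mult[OF v, of 2] power_Suc_le_mult[OF v, of 3]
    power_Suc_le_mult[OF v, of 4]
  have p0: "0 \<le> v^2" "0 \<le> v^3" "0 \<le> v^4" "0 \<le> v^5" "0 \<le> v^6" "0 \<le> v^7" using v by auto
  have pf: "v^2 \<le> 91/200 * v" "v^3 \<le> 91/200 * v^2" "v^4 \<le> 91/200 * v^3" "v^5 \<le> 91/200 * v^4"
    using pf by (simp_all add: eval_nat_numeral)
  have p3: "v^3 \<le> 21/100 * v" "v^4 \<le> 1/10 * v" using pf v by linarith+
  then have L: "L \<ge> 216/100 - 6/5 * v" unfolding L_def using pf(1) p0(4-6) v by linarith
  have Ae: "A = 7/8 + 239/48 * v - 21/32 * v^2 - 385/96 * v^3 - 47/32 * v^4 - 3/32 * v^5"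
    unfolding A_def n_def u_def by (simp add: eval_nat_numeral field_simps)
  have "v^4 \<le> 21/100 * v^2" "v^5 \<le> 1/10 * v^2" using pf p0(1) by linarith+
  then have A: "A \<ge> 7/8 + 49/10 * v - 14/5 * v^2" unfolding Ae using pf(2) p0(1) v by linarith
  have ne: "n = 7/8 + 11/16 * v - 1/4 * v^2 - 1/16 * v^3"
    unfolding n_def u_def by (simp add: eval_nat_numeral field_simps)
  have n: "7/8 \<le> n" "n \<le> 7/8 + 11/16 * v" unfolding ne using pf(1) p3(1) p0(1,2) v by linarith+
  have u: "u \<ge> 1" using v by (simp add: u_def)
  \<comment> \<open>Replacing \<open>Q\<close> by \<open>\<theta>\<close> in one factor costs only a
    nonnegative cubic term and leaves a quadratic form in \<open>v\<close> and \<open>Q\<close>. The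
    condition \<open>key\<close>, with \<open>A\<close>, \<open>L\<close> and \<open>n\<close>
    replaced by simpler bounds, makes its discriminant nonpositive.\<close>
  have quad: ?thesis if th: "Q \<le> \<theta>"
    and key: "3/4 * (u * (7/8 + 11/16 * v))\<^sup>2
      \<le> (216/100 - 6/5 * v) * (7/8 + 49/10 * v - 14/5 * v^2 - 3/2 * u * \<theta>)" (is "_ \<le> ?l * ?d")
    for \<theta>
  proof -
    define D where "D = A - 3/2 * u * \<theta>"
    have l: "?l > 0" using v by simp
    have d: "?d > 0"
    proof -
      have "0 < 3/4 * (u * (7/8 + 11/16 * v))\<^sup>2" using u v by (intro mult_pos_pos zero_less_power) auto
      then have "0 < ?l * ?d" using key by linarith
      then show ?thesis using l by (simp add: zero_less_mult_iff)
    qed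
    have D: "D \<ge> ?d" unfolding D_def using A by simp
    have "3/4 * (u * n)\<^sup>2 \<le> 3/4 * (u * (7/8 + 11/16 * v))\<^sup>2"
      using u n v by (intro mult_left_mono power_mono) auto
    also have "\<dots> \<le> L * D" using key mult_mono[OF L D] l d L by linarith
    finally have LD: "3/4 * (u * n)\<^sup>2 \<le> L * D" .
    have "3/4 * D * (v\<^sup>2 * L - 3/2 * u * v * n * Q + 3/4 * D * Q\<^sup>2)
        = (3/4 * D * Q - 3/4 * u * v * n)\<^sup>2 + 3/4 * v\<^sup>2 * (L * D - 3/4 * (u * n)\<^sup>2)"
      by (simp add: power2_eq_square field_simps)
    moreover have "0 \<le> 3/4 * v\<^sup>2 * (L * D - 3/4 * (u * n)\<^sup>2)" using LD by simp
    ultimately have "0 \<le> 3/4 * D * (v\<^sup>2 * L - 3/2 * u * v * n * Q + 3/4 * D * Q\<^sup>2)"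
      by (simp only: add_nonneg_nonneg zero_le_power2)
    then have 1: "0 \<le> v\<^sup>2 * L - 3/2 * u * v * n * Q + 3/4 * D * Q\<^sup>2"
      using D d by (simp add: zero_le_mult_iff)
    have 2: "0 \<le> 9/8 * u * Q\<^sup>2 * (\<theta> - Q)" using u th by simp
    have 3: "v\<^sup>2 * L = v * (A * n - (u + 1) * m\<^sup>2 / 2)" unfolding LA by (simp add: power2_eq_square)
    have "(v * n + 3/4 * Q\<^sup>2) * (A - 3/2 * u * Q) - v * (u + 1) * m\<^sup>2 / 2
      = (v * (A * n - (u + 1) * m\<^sup>2 / 2) - 3/2 * u * v * n * Q + 3/4 * D * Q\<^sup>2) + 9/8 * u * Q\<^sup>2 * (\<theta> - Q)"
      unfolding D_def by (simp add: power2_eq_square field_simps)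
    then show ?thesis using 1 2 3 by linarith
  qed
  \<comment> \<open>With \<open>\<theta> = 51/100\<close> the discriminant criterion fails near
    \<open>v = 0\<close>; there \<open>\<theta> = 7/20\<close> serves for small \<open>Q\<close>. In
    the remaining corner the term in \<open>Q\<^sup>2\<close> is bounded away from 0 and a direct
    estimate suffices.\<close>
  consider "1/16 \<le> v" | "v \<le> 1/16" "Q \<le> 7/20" | "v \<le> 1/16" "7/20 \<le> Q" by linarith
  then show ?thesis
  proof cases
    case 1
    have e: "(216/100 - 6/5 * v) * (7/8 + 49/10 * v - 14/5 * v^2 - 3/2 * u * (51/100))
        - 3/4 * (u * (7/8 + 11/16 * v))\<^sup>2
      = - 53859/160000 + 1079811/160000 * v - 351831/25600 * v^2 + 22383/12800 * v^3 - 363/1024 * v^4"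
      unfolding u_def by (simp add: eval_nat_numeral field_simps)
    have "v^3 \<ge> 4/5 * v^2 - 4/25 * v"
    proof -
      have "0 \<le> v * (v - 2/5)\<^sup>2" using v by simp
      then show ?thesis by (simp add: eval_nat_numeral field_simps)
    qed
    moreover have "v^2 \<le> 207/400 * v - 91/3200"
    proof -
      have "0 \<le> (v - 1/16) * (91/200 - v)" using 1 v by simp
      then show ?thesis by (simp add: eval_nat_numeral field_simps)
    qed
    moreover note pf(3) p0
    ultimately have "0 \<le> - 53859/160000 + 1079811/160000 * v - 351831/25600 * v^2 + 22383/12800 * v^3 - 363/1024 * v^4"
      using v by linarith
    then show ?thesis
      unfolding e[symmetric] diff_ge_0_iff_ge by (intro quad[of "51/100"]) (use Q in simp_all)
  next
    case 2
    have e: "(216/100 - 6/5 * v) * (7/8 + 49/10 * v - 14/5 * v^2 - 3/2 * u * (7/20))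
        - 3/4 * (u * (7/8 + 11/16 * v))\<^sup>2
      = 5817/32000 + 44667/6400 * v - 1796019/128000 * v^2 + 22383/12800 * v^3 - 363/1024 * v^4"
      unfolding u_def by (simp add: eval_nat_numeral field_simps)
    have "v^2 \<le> 1/16 * v" using power_Suc_le_mult[OF v(1) 2(1), of 1] by (simp add: numeral_2_eq_2)
    moreover note pf(3) p0
    ultimately have "0 \<le> 5817/32000 + 44667/6400 * v - 1796019/128000 * v^2 + 22383/12800 * v^3 - 363/1024 * v^4"
      using v by linarith
    then show ?thesis
      unfolding e[symmetric] diff_ge_0_iff_ge by (intro quad[of "7/20"]) (use 2 in simp_all)
  next
    case 3
    have vv: "v\<^sup>2 \<le> 1/16 * v" using power_Suc_le_mult[OF v(1) 3(1), of 1] by (simp add: numeral_2_eq_2)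
    have A': "A \<ge> 7/8 + 9/2 * v" using A vv v by linarith
    have me: "m = 7/8 + 11/8 * v - 3/4 * v^2 - 1/4 * v^3"
      unfolding m_def u_def by (simp add: eval_nat_numeral field_simps)
    have m: "0 \<le> m" "m \<le> 31/32" unfolding me using pf(1) p3(1) p0(1,2) v 3 by linarith+
    have "v * (u + 1) * m\<^sup>2 / 2 \<le> v * (33/16) * (31/32)\<^sup>2 / 2"
      using v u 3 m by (intro divide_right_mono mult_mono power_mono) (auto simp: u_def)
    also have "\<dots> \<le> 39/40 * v" using v by (simp add: power2_eq_square)
    finally have R: "v * (u + 1) * m\<^sup>2 / 2 \<le> 39/40 * v" .
    have f2: "7/8 - 3/2 * Q + v * (9/2 - 3/2 * Q) \<le> A - 3/2 * u * Q"
      using A' unfolding u_def by (simp add: field_simps)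
    have f2p: "0 \<le> 7/8 - 3/2 * Q + v * (9/2 - 3/2 * Q)" using v Q by (intro add_nonneg_nonneg) auto
    have n': "7/8 * v \<le> v * n" using mult_left_mono[OF n(1) v(1)] by simp
    have lower: "(7/8 * v + 3/4 * Q\<^sup>2) * (7/8 - 3/2 * Q + v * (9/2 - 3/2 * Q))
        \<le> (v * n + 3/4 * Q\<^sup>2) * (A - 3/2 * u * Q)"
    proof (rule mult_mono[OF _ f2 _ f2p])
      show "7/8 * v + 3/4 * Q\<^sup>2 \<le> v * n + 3/4 * Q\<^sup>2" using n' by simp
      show "0 \<le> v * n + 3/4 * Q\<^sup>2" using v n by simp
    qed
    have expand: "(7/8 * v + 3/4 * Q\<^sup>2) * (7/8 - 3/2 * Q + v * (9/2 - 3/2 * Q))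
      = 7/8 * (v\<^sup>2 * (9/2 - 3/2 * Q)) + 3/4 * Q\<^sup>2 * (7/8 - 3/2 * Q)
        + v * (49/64 - 21/16 * Q + 3/4 * Q\<^sup>2 * (9/2 - 3/2 * Q))"
      by (simp add: power2_eq_square field_simps)
    have "0 \<le> 7/8 * (v\<^sup>2 * (9/2 - 3/2 * Q))" using Q by simp
    \<comment> \<open>\<open>21/1000\<close> is chosen to cover the loss \<open>33/100 * v\<close>
      of the next estimate, which is at most \<open>33/1600\<close>. The cubic is bounded by a
      product that is nonnegative between \<open>7/20\<close> and \<open>51/100\<close>.\<close>
    moreover have "3/4 * Q\<^sup>2 * (7/8 - 3/2 * Q) \<ge> 21/1000"
    proof -
      have "0 \<le> (Q - 7/20) * (51/100 - Q) * (3/10 + 9/8 * Q)" using 3 Q by simp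
      also have "(Q - 7/20) * (51/100 - Q) * (3/10 + 9/8 * Q)
          = - 9/8 * Q^3 + (387/400 - 3/10) * Q^2 + (129/500 - 16065/80000) * Q - 1071/20000"
        by (simp add: eval_nat_numeral field_simps)
      finally have "0 \<le> - 9/8 * Q^3 + 267/400 * Q^2 + 183/3200 * Q - 1071/20000" by simp
      moreover have e: "3/4 * Q\<^sup>2 * (7/8 - 3/2 * Q) = 21/32 * Q^2 - 9/8 * Q^3"
        by (simp add: eval_nat_numeral field_simps)
      moreover have "0 \<le> (Q - 7/20) * (51/100 - Q)" using 3 Q by simp
      then have "Q^2 \<le> 86/100 * Q - 357/2000" by (simp add: power2_eq_square field_simps)
      ultimately show ?thesis using 3 Q by simp
    qed
    moreover have "v * (49/64 - 21/16 * Q + 3/4 * Q\<^sup>2 * (9/2 - 3/2 * Q)) \<ge> 39/40 * v - 21/1000"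
    proof -
      have "Q^3 \<le> 51/100 * Q^2" using power_Suc_le_mult[OF Q, of 2] by (simp add: eval_nat_numeral)
      moreover have "Q^2 \<ge> 7/10 * Q - 49/400"
        using zero_le_power2[of "Q - 7/20"] by (simp add: power2_eq_square algebra_simps)
      moreover have e: "3/4 * Q\<^sup>2 * (9/2 - 3/2 * Q) = 27/8 * Q^2 - 9/8 * Q^3"
        by (simp add: eval_nat_numeral field_simps)
      ultimately have "49/64 - 21/16 * Q + 3/4 * Q\<^sup>2 * (9/2 - 3/2 * Q) - 39/40 \<ge> - 33/100"
        unfolding e using 3 by linarith
      then have "v * (49/64 - 21/16 * Q + 3/4 * Q\<^sup>2 * (9/2 - 3/2 * Q) - 39/40) \<ge> v * (- 33/100)"
        using v by (intro mult_left_mono)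
      moreover have "v * (- 33/100) \<ge> - 21/1000" using 3 by simp
      ultimately show ?thesis by (simp add: algebra_simps)
    qed
    ultimately have "0 + 21/1000 + (39/40 * v - 21/1000)
        \<le> (7/8 * v + 3/4 * Q\<^sup>2) * (7/8 - 3/2 * Q + v * (9/2 - 3/2 * Q))"
      unfolding expand by (intro add_mono)
    then have "39/40 * v \<le> (7/8 * v + 3/4 * Q\<^sup>2) * (7/8 - 3/2 * Q + v * (9/2 - 3/2 * Q))" by simp
    then show ?thesis using R lower by (meson order_trans)
  qed
qed

text \<open>Provides hypothesis \<open>1\<close> of \<open>tangential_form_pos_algebraic\<close> for
  the radial factor at \<open>e = 1\<close>, where \<open>M - Y2\<^sup>2\<close> is
  \<open>n + 3/4 * Q\<^sup>2\<close>.\<close>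

lemma radial_bound:
  fixes u s Y :: real
  defines "n \<equiv> u\<^sup>2 - u - u\<^sup>2 * (u\<^sup>2 - 1) / 16"
  assumes u: "1 \<le> u" "u \<le> 2" and s: "s\<^sup>2 = u\<^sup>2 - 1" and nY: "n + Y\<^sup>2 \<le> 51/100"
  shows "(s * (2 * u - 1 - (2 * u^3 - u) / 8))\<^sup>2
    \<le> 2 * (n + 3/4 * (n + Y\<^sup>2)\<^sup>2) * (5 * u\<^sup>2 - u^4 - u - 17/8 + 2 * Y * s * u)"
proof -
  define v where "v = u - 1"
  have uv: "u = 1 + v" by (simp add: v_def)
  have v: "0 \<le> v" "v \<le> 1" using u by (auto simp: v_def)
  define n' where "n' = u * (16 - u - u\<^sup>2) / 16"
  have n: "n = v * n'" unfolding n_def n'_def v_def by (simp add: power2_eq_square field_simps)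
  have "n \<le> 51/100" using nY zero_le_power2[of Y] by linarith
  \<comment> \<open>\<open>91/200\<close> lies just above the point where \<open>n\<close> reaches
    \<open>51/100\<close>.\<close>
  have v': "v \<le> 91/200"
  proof (rule ccontr)
    assume *: "\<not> v \<le> 91/200"
    have "n = v^2 + v - v^4/16 - v^3/4 - 5/16 * v^2 - v/8"
      unfolding n_def uv by (simp add: eval_nat_numeral field_simps)
    moreover have "v^2 \<ge> 91/100 * v - (91/200)^2"
      using zero_le_power2[of "v - 91/200"] by (simp add: power2_eq_square algebra_simps)
    moreover have "v^3 \<le> 291/200 * v^2 - 91/200 * v"
    proof -
      have "0 \<le> v * ((v - 91/200) * (1 - v))" using * v by simp
      then show ?thesis by (simp add: eval_nat_numeral field_simps)
    qed
    moreover have "v^4 \<le> v^3" using v by (intro power_decreasing) auto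
    ultimately have "n > 51/100" using * v by (simp add: power2_eq_square)
    then show False using \<open>n \<le> 51/100\<close> by simp
  qed
  have n0: "n \<ge> 0"
  proof -
    have "u\<^sup>2 \<le> 2\<^sup>2" using u by (intro power_mono) auto
    then show ?thesis unfolding n n'_def using u v by simp
  qed
  define Q where "Q = n + Y\<^sup>2"
  have Q: "0 \<le> Q" "Q \<le> 51/100" using n0 nY by (auto simp: Q_def)
  let ?m = "17/8 * u - 1 - u^3/4"
  let ?A = "5 * u\<^sup>2 - u^4 - u - 17/8 - 2/3 * u * (v * (u + 1)) + 3/2 * u * (v * n')"
  have main: "v * (u + 1) * ?m\<^sup>2 / 2 \<le> (v * n' + 3/4 * Q\<^sup>2) * (?A - 3/2 * u * Q)"
    unfolding n'_def uv by (rule radial_bound_scaled) (use v v' Q in auto)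
  have s': "s\<^sup>2 = v * (u + 1)" using s by (simp add: v_def power2_eq_square algebra_simps)
  \<comment> \<open>Young's inequality for the shear term. Since \<open>Y\<^sup>2 = Q - n\<close>,
    it is the origin of the last two summands of \<open>?A\<close> and of the term
    \<open>3/2 * u * Q\<close>.\<close>
  have "- 2 * Y * s \<le> 2/3 * s\<^sup>2 + 3/2 * Y\<^sup>2"
    using zero_le_power2[of "2 * s + 3 * Y"] by (simp add: power2_eq_square algebra_simps)
  then have "u * (- 2 * Y * s) \<le> u * (2/3 * s\<^sup>2 + 3/2 * Y\<^sup>2)" using u by (intro mult_left_mono) auto
  then have "?A - 3/2 * u * Q \<le> 5 * u\<^sup>2 - u^4 - u - 17/8 + 2 * Y * s * u"
    unfolding Q_def s' n by (simp add: field_simps)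
  then have "(n + 3/4 * Q\<^sup>2) * (?A - 3/2 * u * Q)
      \<le> (n + 3/4 * Q\<^sup>2) * (5 * u\<^sup>2 - u^4 - u - 17/8 + 2 * Y * s * u)"
    using n0 by (intro mult_left_mono) auto
  moreover have "(s * (2 * u - 1 - (2 * u^3 - u) / 8))\<^sup>2 = v * (u + 1) * ?m\<^sup>2"
  proof -
    have "2 * u - 1 - (2 * u^3 - u) / 8 = ?m" by (simp add: field_simps)
    then show ?thesis by (simp only: power_mult_distrib s')
  qed
  ultimately show ?thesis using main unfolding Q_def[symmetric] n[symmetric] by linarith
qed

text \<open>A level \<open>g - Y\<^sup>2\<close> above \<open>51/100 * e\<close> forces
  \<open>k = 2 * K - 1\<close> to be at least \<open>- 1/32\<close> and bounds
  \<open>Y\<^sup>2\<close> by \<open>e * k / 2\<close> up to a small constant. By Young's inequality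
  \<open>- 2 * e * k\<close> then outweighs the shear term.\<close>

lemma angular_curvature_neg:
  fixes e K \<sigma> Y :: real
  assumes e: "e \<ge> 1" and K: "0 \<le> K" "K \<le> 1" and \<sigma>: "\<sigma>\<^sup>2 = 4 * K * (1 - K)"
    and Y: "51/100 * e < e * K + K * (1 - K) / 16 - Y\<^sup>2"
  shows "- 2 * e * (2 * K - 1) + (2 * (2 * K - 1)\<^sup>2 - 1) / 8 + Y * \<sigma> < 0"
proof -
  define k where "k = 2 * K - 1"
  have Kk: "K = (1 + k) / 2" by (simp add: k_def)
  have kk: "4 * K * (1 - K) = 1 - k\<^sup>2" "K * (1 - K) / 16 = (1 - k\<^sup>2) / 64"
    unfolding Kk by (simp_all add: power2_eq_square field_simps)
  have k: "-1 \<le> k" "k \<le> 1" using K by (auto simp: k_def)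
  have k2: "0 \<le> k\<^sup>2" "k\<^sup>2 \<le> 1" using k by (auto simp: abs_square_le_1)
  define E where "E = e * k"
  have eK: "e * K = e / 2 + E / 2" unfolding Kk E_def by (simp add: field_simps)
  have Y': "Y\<^sup>2 < E / 2 - e / 100 + (1 - k\<^sup>2) / 64" using Y unfolding eK kk by linarith
  have "Y * \<sigma> \<le> 3/32 * \<sigma>\<^sup>2 + 8/3 * Y\<^sup>2"
    using zero_le_power2[of "3 * \<sigma> - 16 * Y"] by (simp add: power2_eq_square algebra_simps)
  then have "Y * \<sigma> \<le> 3/32 * (1 - k\<^sup>2) + 8/3 * Y\<^sup>2" unfolding \<sigma> kk .
  moreover have "2/3 * E + 2/75 * e > k\<^sup>2 / 8 + 1 / 90"
  proof (cases "k \<ge> 0")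
    case True
    have "E \<ge> k" using e True by (simp add: E_def mult_right_mono[of 1 e k, simplified])
    moreover have "k\<^sup>2 \<le> k" using True k by (simp add: power2_eq_square mult_left_le)
    ultimately show ?thesis using e True by linarith
  next
    case False
    have "0 \<le> E / 2 - e / 100 + (1 - k\<^sup>2) / 64" using Y' zero_le_power2[of Y] by linarith
    moreover have "(1 - k\<^sup>2) / 64 \<le> 1 / 64" using k2 by simp
    ultimately have E1: "E \<ge> e / 50 - 1/32" by linarith
    have "E \<le> k" using False e by (simp add: E_def mult_le_cancel_right1)
    then have "- k \<le> 1/32" using E1 e by linarith
    then have "(- k)\<^sup>2 \<le> (1/32)\<^sup>2" using False by (intro power_mono) auto
    then have "k\<^sup>2 \<le> 1/1024" by (simp add: power2_eq_square)
    then show ?thesis using E1 e by linarith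
  qed
  moreover have "- 2 * e * (2 * K - 1) = - 2 * E" by (simp add: E_def k_def)
  ultimately have "- 2 * e * (2 * K - 1) + (2 * k\<^sup>2 - 1) / 8 + Y * \<sigma> < 0"
    using Y' k2 by argo
  then show ?thesis by (simp only: k_def)
qed

section \<open>Combination of the two factors\<close>

text \<open>\<open>K\<close>, \<open>\<sigma>\<close>, \<open>u\<close>, \<open>s\<close> stand for \<open>cos\<^sup>2 x2\<close>, \<open>sin (2 x2)\<close>, \<open>cosh x1\<close>, \<open>sinh x1\<close>. The two factors are compared
  through \<open>M = H + 3/4 Q\<^sup>2\<close>, where \<open>H\<close> is the common value of both sides of \<open>F\<close>; when \<open>H\<close> is
  large the angular form is itself positive.\<close>

lemma tangential_form_pos:
  fixes e K \<sigma> u s Y1 Y2 V1 V2 a b :: real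
  defines "g \<equiv> e * K + K * (1 - K) / 16"
    and "g1 \<equiv> - (\<sigma> * (e - (2 * K - 1) / 16))"
    and "g2 \<equiv> - 2 * e * (2 * K - 1) + (2 * (2 * K - 1)\<^sup>2 - 1) / 8"
    and "n \<equiv> e * u\<^sup>2 - u - u\<^sup>2 * (u\<^sup>2 - 1) / 16"
    and "n1 \<equiv> s * (2 * e * u - 1 - (2 * u^3 - u) / 8)"
    and "n2 \<equiv> 5 * u\<^sup>2 - u^4 - u - 17/8 + (e - 1) * (4 * u\<^sup>2 - 2)"
  assumes e: "e \<ge> 1" and K: "0 < K" "K \<le> 1" and \<sigma>: "\<sigma>\<^sup>2 = 4 * K * (1 - K)"
    and u: "1 \<le> u" "u \<le> 2" and s: "s\<^sup>2 = u\<^sup>2 - 1"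
    and F: "n + Y2\<^sup>2 = g - Y1\<^sup>2"
    and t: "Y1 * V1 - g1 * a / 2 + Y2 * V2 + n1 * b / 2 = 0"
    and nz: "V1 \<noteq> 0 \<or> V2 \<noteq> 0 \<or> a \<noteq> 0 \<or> b \<noteq> 0"
  shows "V1\<^sup>2 - (g2 + Y1 * \<sigma>) * a\<^sup>2 / 2 + V2\<^sup>2 + (n2 + 2 * Y2 * s * u) * b\<^sup>2 / 2 > 0"
proof -
  define H where "H = n + Y2\<^sup>2"
  define m where "m = u\<^sup>2 - u - u\<^sup>2 * (u\<^sup>2 - 1) / 16"
  define Q where "Q = m + Y2\<^sup>2"
  define \<alpha>1 where "\<alpha>1 = 5 * u\<^sup>2 - u^4 - u - 17/8 + 2 * Y2 * s * u"
  define \<alpha> where "\<alpha> = n2 + 2 * Y2 * s * u"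
  define \<beta> where "\<beta> = g2 + Y1 * \<sigma>"
  have nm: "n = m + (e - 1) * u\<^sup>2" unfolding n_def m_def by (simp add: algebra_simps)
  have u2: "1 \<le> u\<^sup>2" "u\<^sup>2 \<le> 4" using u power_mono[of u 2 2] by auto
  have m: "m = (u - 1) * (u * (16 - u - u\<^sup>2)) / 16"
    unfolding m_def by (simp add: power2_eq_square field_simps)
  have m0: "m \<ge> 0" unfolding m using u u2 by simp
  have Q0: "Q \<ge> 0" using m0 by (simp add: Q_def)
  have "(e - 1) * 1 \<le> (e - 1) * u\<^sup>2" using e u2 by (intro mult_left_mono) auto
  \<comment> \<open>\<open>Q\<close> is the value of \<open>H\<close> with \<open>e\<close> replaced
    by 1 at the same \<open>u\<close> and \<open>Y2\<close>, so the excess is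
    \<open>(e - 1) * u\<^sup>2\<close>, at least \<open>e - 1\<close>.\<close>
  then have QH: "Q \<le> H - (e - 1)" unfolding Q_def H_def nm by simp
  have ge: "g \<le> e"
  proof -
    have "(1 - K) * (K / 16) \<le> (1 - K) * e" using e K by (intro mult_left_mono) auto
    then show ?thesis unfolding g_def by (simp add: algebra_simps)
  qed
  have HY: "H = g - Y1\<^sup>2" using F by (simp add: H_def)
  have He: "H \<le> e" using ge zero_le_power2[of Y1] unfolding HY by linarith
  have Q1: "Q \<le> 1" using QH He by simp
  have \<alpha>1: "\<alpha>1 > 0" unfolding \<alpha>1_def
    by (rule radial_curvature_pos[of u "u - 1" Y2 "Y2\<^sup>2"]) (use u s Q1 in \<open>auto simp: Q_def m_def\<close>)
  have d2: "(e - 1) * (4 * u\<^sup>2 - 2) \<ge> 0" using e u2 by simp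
  have \<alpha>e: "\<alpha> = \<alpha>1 + (e - 1) * (4 * u\<^sup>2 - 2)" by (simp add: \<alpha>_def \<alpha>1_def n2_def)
  have \<alpha>: "\<alpha> > 0" using \<alpha>1 d2 \<alpha>e by simp
  show ?thesis
  \<comment> \<open>\<open>K = 1\<close> joins the case of large \<open>H\<close> because
    \<open>angular_bound\<close> asks for \<open>K < 1\<close>; there \<open>\<sigma> = 0\<close>
    and \<open>\<beta> = - 2 * e + 1/8\<close>.\<close>
  proof (cases "K = 1 \<or> H > 51/100 * e")
    case True
    have "\<beta> < 0"
    proof (cases "K = 1")
      case True
      then have "\<sigma> = 0" using \<sigma> by simp
      then show ?thesis using True e by (simp add: \<beta>_def g2_def)
    next
      case False
      then have "H > 51/100 * e" using True by simp
      then show ?thesis unfolding \<beta>_def g2_def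
        by (intro angular_curvature_neg e \<sigma>) (use K in \<open>auto simp: HY g_def\<close>)
    qed
    then have "0 \<le> - \<beta> * a\<^sup>2" "a \<noteq> 0 \<Longrightarrow> 0 < - \<beta> * a\<^sup>2" by (auto simp: mult_nonpos_nonneg mult_neg_pos)
    moreover have "0 \<le> \<alpha> * b\<^sup>2" "b \<noteq> 0 \<Longrightarrow> 0 < \<alpha> * b\<^sup>2" using \<alpha> by auto
    moreover have "0 \<le> V1\<^sup>2" "V1 \<noteq> 0 \<Longrightarrow> 0 < V1\<^sup>2" "0 \<le> V2\<^sup>2" "V2 \<noteq> 0 \<Longrightarrow> 0 < V2\<^sup>2" by auto
    ultimately show ?thesis using nz unfolding \<alpha>_def[symmetric] \<beta>_def[symmetric] by argo
  next
    case False
    then have K1: "K < 1" and H51: "H \<le> 51/100 * e" using K by auto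
    have Q51: "Q \<le> 51/100" using QH H51 e by linarith
    define M where "M = H + 3/4 * Q\<^sup>2"
    have H0: "H \<ge> 0" using Q0 QH e by linarith
    have M0: "M \<ge> 0" using H0 by (simp add: M_def)
    have I: "n1\<^sup>2 \<le> 2 * (M - Y2\<^sup>2) * \<alpha>"
    proof -
      \<comment> \<open>\<open>q\<close> collects the part of \<open>n1\<close> proportional to
        \<open>e - 1\<close>. It obeys a semidefinite bound of its own, and the two bounds add up by
        \<open>psd_cauchy_schwarz\<close>.\<close>
      define p where "p = s * (2 * u - 1 - (2 * u^3 - u) / 8)"
      define q where "q = (e - 1) * (2 * u * s)"
      have n1: "n1 = p + q" unfolding n1_def p_def q_def by (simp add: algebra_simps)
      have p: "p\<^sup>2 \<le> (2 * (m + 3/4 * Q\<^sup>2)) * \<alpha>1"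
        unfolding p_def Q_def m_def \<alpha>1_def by (rule radial_bound) (use u s Q51 in \<open>auto simp: Q_def m_def\<close>)
      have "q\<^sup>2 = (e - 1)\<^sup>2 * (4 * u\<^sup>2 * (u\<^sup>2 - 1))" by (simp add: q_def power_mult_distrib s)
      also have "\<dots> \<le> (e - 1)\<^sup>2 * (2 * u\<^sup>2 * (4 * u\<^sup>2 - 2))"
        using u2 by (intro mult_left_mono) (auto simp: algebra_simps)
      finally have q: "q\<^sup>2 \<le> (2 * ((e - 1) * u\<^sup>2)) * ((e - 1) * (4 * u\<^sup>2 - 2))"
        by (simp add: power2_eq_square algebra_simps)
      have "(p + q)\<^sup>2 \<le> (2 * (m + 3/4 * Q\<^sup>2) + 2 * ((e - 1) * u\<^sup>2)) * (\<alpha>1 + (e - 1) * (4 * u\<^sup>2 - 2))"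
        by (rule psd_cauchy_schwarz) (use m0 \<alpha>1 d2 e p q in auto)
      moreover have "2 * (m + 3/4 * Q\<^sup>2) + 2 * ((e - 1) * u\<^sup>2) = 2 * (M - Y2\<^sup>2)"
        unfolding M_def H_def nm by simp
      ultimately show ?thesis by (simp add: n1 \<alpha>e)
    qed
    have II: "2 * (M + Y1\<^sup>2) * \<beta> < g1\<^sup>2"
    proof -
      \<comment> \<open>Turns the correction in \<open>Q\<close> into one in the level
        \<open>g - Y1\<^sup>2\<close>, the form that \<open>angular_bound\<close> expects.\<close>
      have "e * Q\<^sup>2 \<le> H\<^sup>2"
      proof -
        have "H \<ge> Q + (e - 1)" using QH by simp
        then have "(Q + (e - 1))\<^sup>2 \<le> H\<^sup>2" using Q0 e by (intro power_mono) auto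
        moreover have "(Q + (e - 1))\<^sup>2 - e * Q\<^sup>2 = (e - 1) * (Q * (1 - Q) + Q + (e - 1))"
          by (simp add: power2_eq_square algebra_simps)
        moreover have "(e - 1) * (Q * (1 - Q) + Q + (e - 1)) \<ge> 0" using e Q0 Q1 by simp
        ultimately show ?thesis by linarith
      qed
      then have "Q\<^sup>2 \<le> H\<^sup>2 / e" using e by (simp add: field_simps)
      then have "M + Y1\<^sup>2 \<le> g + 3/4 * ((g - Y1\<^sup>2)\<^sup>2 / e)" unfolding M_def HY by simp
      then have "2 * (M + Y1\<^sup>2) * \<beta> < (\<sigma> * (e - (2 * K - 1) / 16))\<^sup>2"
        unfolding \<beta>_def g2_def g_def
        by (intro angular_bound) (use e K K1 \<sigma> M0 H0 in \<open>auto simp: HY g_def\<close>)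
      then show ?thesis by (simp add: g1_def)
    qed
    \<comment> \<open>Only \<open>M \<ge> 0\<close> is known, and \<open>M\<close> vanishes where
      \<open>H = Q = 0\<close>, while the algebraic lemma asks for \<open>M > 0\<close>. The strict
      angular inequality leaves room to raise \<open>M\<close> by a small
      \<open>\<epsilon>\<close>.\<close>
    define \<epsilon> where "\<epsilon> = (g1\<^sup>2 - 2 * (M + Y1\<^sup>2) * \<beta>) / (2 * (2 * \<bar>\<beta>\<bar> + 1))"
    have \<epsilon>: "\<epsilon> > 0" using II by (simp add: \<epsilon>_def divide_pos_pos)
    have "2 * \<epsilon> * (2 * \<bar>\<beta>\<bar> + 1) = g1\<^sup>2 - 2 * (M + Y1\<^sup>2) * \<beta>"
      unfolding \<epsilon>_def by (simp add: field_simps)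
    moreover have "2 * \<epsilon> * \<beta> < 2 * \<epsilon> * (2 * \<bar>\<beta>\<bar> + 1)" using \<epsilon> by simp
    ultimately have II': "2 * ((M + \<epsilon>) + Y1\<^sup>2) * \<beta> < g1\<^sup>2" by (simp add: algebra_simps)
    have "n1\<^sup>2 \<le> 2 * ((M + \<epsilon>) - Y2\<^sup>2) * \<alpha>"
    proof -
      have "0 \<le> 2 * \<epsilon> * \<alpha>" using \<epsilon> \<alpha> by simp
      then show ?thesis using I by (simp add: algebra_simps)
    qed
    from tangential_form_pos_algebraic[OF \<alpha> _ this II' t nz] M0 \<epsilon>
    show ?thesis by (simp add: \<alpha>_def \<beta>_def)
  qed
qed

section \<open>Partial derivatives\<close>

lemma smooth_on_differentiable:
  "smooth_on f S \<Longrightarrow> open S \<Longrightarrow> x \<in> S \<Longrightarrow> f differentiable (at x)"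
  unfolding smooth_on_def
  by (drule spec[of _ "Suc 0"]) (simp add: differentiable_on_eq_differentiable_at)

lemma smooth_on_imp_continuous_on: "smooth_on f S \<Longrightarrow> continuous_on S f"
  unfolding smooth_on_def by (drule spec[of _ 0]) simp

lemma smooth_on_frechet_derivative:
  "smooth_on f S \<Longrightarrow> smooth_on (\<lambda>x. frechet_derivative f (at x) v) S"
  unfolding smooth_on_def
proof
  fix k
  assume "\<forall>k. Ck_on k f S"
  then have "Ck_on (Suc k) f S" by blast
  then show "Ck_on k (\<lambda>x. frechet_derivative f (at x) v) S" by simp
qed

lemma smooth_on_partial: "smooth_on f S \<Longrightarrow> smooth_on (partial i f) S"
  unfolding partial_def[abs_def] by (rule smooth_on_frechet_derivative)

lemma has_derivative_along_line:
  assumes "(f has_derivative f') (at (p + s *\<^sub>R v))"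
  shows "((\<lambda>s. f (p + s *\<^sub>R v)) has_derivative (\<lambda>r. f' (r *\<^sub>R v))) (at s within X)"
  by (rule has_derivative_compose[where f = "\<lambda>s. p + s *\<^sub>R v" and g = f and g' = f'])
    (use assms in \<open>auto intro!: derivative_eq_intros\<close>)

text \<open>The mean value theorem is used twice: along \<open>v\<close> for the difference of
  \<open>f\<close> and its translate by \<open>h *\<^sub>R w\<close>, then along \<open>w\<close>
  for \<open>\<lambda>x. f' x v\<close>.\<close>

lemma mixed_difference_mvt:
  fixes f :: "'a::real_normed_vector \<Rightarrow> real"
  assumes h: "h > 0"
    and S: "\<And>s t. 0 \<le> s \<Longrightarrow> s \<le> h \<Longrightarrow> 0 \<le> t \<Longrightarrow> t \<le> h \<Longrightarrow> u + s *\<^sub>R v + t *\<^sub>R w \<in> S"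
    and f: "\<And>x. x \<in> S \<Longrightarrow> (f has_derivative f' x) (at x)"
    and g: "\<And>x. x \<in> S \<Longrightarrow> ((\<lambda>x. f' x v) has_derivative f'' x) (at x)"
  obtains \<xi> \<eta> where "0 \<le> \<xi>" "\<xi> \<le> h" "0 \<le> \<eta>" "\<eta> \<le> h"
    "f (u + h *\<^sub>R v + h *\<^sub>R w) - f (u + h *\<^sub>R v) - f (u + h *\<^sub>R w) + f u
      = h * h * f'' (u + \<xi> *\<^sub>R v + \<eta> *\<^sub>R w) w"
proof -
  have lin: "f' x (r *\<^sub>R v) = r * f' x v" "f'' x (r *\<^sub>R w) = r * f'' x w" if "x \<in> S" for x r
    using linear_scale[OF has_derivative_linear[OF f[OF that]]]
      linear_scale[OF has_derivative_linear[OF g[OF that]]] by auto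
  have "\<exists>\<xi>\<in>{0<..<h}. (f ((u + h *\<^sub>R w) + h *\<^sub>R v) - f (u + h *\<^sub>R v))
      - (f ((u + h *\<^sub>R w) + 0 *\<^sub>R v) - f (u + 0 *\<^sub>R v))
      = f' ((u + h *\<^sub>R w) + \<xi> *\<^sub>R v) ((h - 0) *\<^sub>R v) - f' (u + \<xi> *\<^sub>R v) ((h - 0) *\<^sub>R v)"
  proof (rule mvt_simple[OF h])
    fix s :: real assume s: "0 \<le> s" "s \<le> h"
    have 1: "u + h *\<^sub>R w + s *\<^sub>R v \<in> S" using S[OF s, of h] h by (simp add: algebra_simps)
    have 2: "u + s *\<^sub>R v \<in> S" using S[OF s, of 0] h by simp
    show "((\<lambda>s. f (u + h *\<^sub>R w + s *\<^sub>R v) - f (u + s *\<^sub>R v)) has_derivative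
      (\<lambda>r. f' (u + h *\<^sub>R w + s *\<^sub>R v) (r *\<^sub>R v) - f' (u + s *\<^sub>R v) (r *\<^sub>R v))) (at s within {0..h})"
      by (intro has_derivative_diff has_derivative_along_line f 1 2)
  qed
  then obtain \<xi> where \<xi>: "0 < \<xi>" "\<xi> < h" and e1:
    "f (u + h *\<^sub>R w + h *\<^sub>R v) - f (u + h *\<^sub>R v) - (f (u + h *\<^sub>R w) - f u)
      = f' (u + h *\<^sub>R w + \<xi> *\<^sub>R v) (h *\<^sub>R v) - f' (u + \<xi> *\<^sub>R v) (h *\<^sub>R v)" by auto
  have in\<xi>: "u + \<xi> *\<^sub>R v + t *\<^sub>R w \<in> S" if "0 \<le> t" "t \<le> h" for t using S[of \<xi> t] \<xi> that by simp
  have "\<exists>\<eta>\<in>{0<..<h}. f' ((u + \<xi> *\<^sub>R v) + h *\<^sub>R w) v - f' ((u + \<xi> *\<^sub>R v) + 0 *\<^sub>R w) v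
      = f'' ((u + \<xi> *\<^sub>R v) + \<eta> *\<^sub>R w) ((h - 0) *\<^sub>R w)"
    by (rule mvt_simple[OF h], rule has_derivative_along_line[where f = "\<lambda>x. f' x v"], rule g, rule in\<xi>)
  then obtain \<eta> where \<eta>: "0 < \<eta>" "\<eta> < h" and e2:
    "f' (u + \<xi> *\<^sub>R v + h *\<^sub>R w) v - f' (u + \<xi> *\<^sub>R v) v = f'' (u + \<xi> *\<^sub>R v + \<eta> *\<^sub>R w) (h *\<^sub>R w)" by auto
  have c: "u + h *\<^sub>R w + \<xi> *\<^sub>R v = u + \<xi> *\<^sub>R v + h *\<^sub>R w" "u + h *\<^sub>R w + h *\<^sub>R v = u + h *\<^sub>R v + h *\<^sub>R w"
    by (simp_all add: algebra_simps)
  have "f (u + h *\<^sub>R v + h *\<^sub>R w) - f (u + h *\<^sub>R v) - f (u + h *\<^sub>R w) + f u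
      = h * (f' (u + \<xi> *\<^sub>R v + h *\<^sub>R w) v - f' (u + \<xi> *\<^sub>R v) v)"
    using e1 lin(1)[OF in\<xi>[of h], of h] lin(1)[OF in\<xi>[of 0], of h] h unfolding c
    by (simp add: algebra_simps)
  also have "\<dots> = h * h * f'' (u + \<xi> *\<^sub>R v + \<eta> *\<^sub>R w) w"
    unfolding e2 using lin(2)[OF in\<xi>[of \<eta>], of h] \<eta> by simp
  finally show ?thesis using that[of \<xi> \<eta>] \<xi> \<eta> by simp
qed

text \<open>Both mixed derivatives are limits of the same second difference. Derivatives are taken
  in fixed directions because \<open>Ck_on\<close> iterates \<open>frechet_derivative\<close> in
  that way.\<close>

lemma clairaut_real:
  fixes f :: "'a::real_normed_vector \<Rightarrow> real"
  assumes S: "open S" "u \<in> S"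
    and f: "\<And>x. x \<in> S \<Longrightarrow> (f has_derivative f' x) (at x)"
    and A: "\<And>x. x \<in> S \<Longrightarrow> ((\<lambda>x. f' x v) has_derivative A x) (at x)" "continuous_on S (\<lambda>x. A x w)"
    and B: "\<And>x. x \<in> S \<Longrightarrow> ((\<lambda>x. f' x w) has_derivative B x) (at x)" "continuous_on S (\<lambda>x. B x v)"
  shows "A u w = B u v"
proof (rule ccontr)
  assume ne: "A u w \<noteq> B u v"
  define d where "d = \<bar>A u w - B u v\<bar> / 2"
  have d: "d > 0" using ne by (simp add: d_def)
  have "isCont (\<lambda>x. A x w) u" "isCont (\<lambda>x. B x v) u"
    using A(2) B(2) S by (auto simp: continuous_on_eq_continuous_at)
  then have cont: "\<forall>e>0. \<exists>\<delta>>0. \<forall>x. dist x u < \<delta> \<longrightarrow> dist (A x w) (A u w) < e"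
    "\<forall>e>0. \<exists>\<delta>>0. \<forall>x. dist x u < \<delta> \<longrightarrow> dist (B x v) (B u v) < e"
    unfolding continuous_at_eps_delta by auto
  obtain \<delta>1 where \<delta>1: "\<delta>1 > 0" "\<And>x. dist x u < \<delta>1 \<Longrightarrow> dist (A x w) (A u w) < d"
    using cont(1)[rule_format, OF d] by blast
  obtain \<delta>2 where \<delta>2: "\<delta>2 > 0" "\<And>x. dist x u < \<delta>2 \<Longrightarrow> dist (B x v) (B u v) < d"
    using cont(2)[rule_format, OF d] by blast
  obtain \<delta>3 where \<delta>3: "\<delta>3 > 0" "ball u \<delta>3 \<subseteq> S" using S open_contains_ball by blast
  define \<delta> where "\<delta> = min \<delta>1 (min \<delta>2 \<delta>3)"
  have \<delta>: "\<delta> > 0" using \<delta>1 \<delta>2 \<delta>3 by (simp add: \<delta>_def)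
  \<comment> \<open>Small enough to keep the whole parallelogram spanned by
    \<open>h *\<^sub>R v\<close> and \<open>h *\<^sub>R w\<close> within \<open>\<delta>\<close> of
    \<open>u\<close>; the summand 1 avoids a zero denominator.\<close>
  define h where "h = \<delta> / (norm v + norm w + 1)"
  have nn: "norm v + norm w + 1 > 0" by (simp add: add_nonneg_pos)
  have h: "h > 0" unfolding h_def using \<delta> nn by simp
  have near: "dist (u + s *\<^sub>R x + t *\<^sub>R y) u < \<delta>"
    if "0 \<le> s" "s \<le> h" "0 \<le> t" "t \<le> h" "norm x + norm y = norm v + norm w" for s t x y
  proof -
    have "dist (u + s *\<^sub>R x + t *\<^sub>R y) u = norm (s *\<^sub>R x + t *\<^sub>R y)" by (simp add: dist_norm)
    also have "\<dots> \<le> s * norm x + t * norm y"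
      using norm_triangle_ineq[of "s *\<^sub>R x" "t *\<^sub>R y"] that by simp
    also have "\<dots> \<le> h * norm x + h * norm y" using that by (intro add_mono mult_right_mono) auto
    also have "\<dots> = h * (norm v + norm w)" using that(5) by (metis distrib_left)
    also have "\<dots> < h * (norm v + norm w + 1)" using h by simp
    also have "\<dots> = \<delta>" using nn by (simp add: h_def)
    finally show ?thesis .
  qed
  have inS: "x \<in> S" if "dist x u < \<delta>" for x
    using that \<delta>3(2) by (auto simp: \<delta>_def dist_commute)
  have S1: "u + s *\<^sub>R v + t *\<^sub>R w \<in> S" if "0 \<le> s" "s \<le> h" "0 \<le> t" "t \<le> h" for s t
    using near[OF that, of v w] inS by simp
  have S2: "u + s *\<^sub>R w + t *\<^sub>R v \<in> S" if "0 \<le> s" "s \<le> h" "0 \<le> t" "t \<le> h" for s t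
    using near[OF that, of w v] inS by (simp add: add.commute)
  obtain a b where ab: "0 \<le> a" "a \<le> h" "0 \<le> b" "b \<le> h" and e1:
    "f (u + h *\<^sub>R v + h *\<^sub>R w) - f (u + h *\<^sub>R v) - f (u + h *\<^sub>R w) + f u
      = h * h * A (u + a *\<^sub>R v + b *\<^sub>R w) w"
    using mixed_difference_mvt[OF h S1 f A(1)] by blast
  obtain a' b' where ab': "0 \<le> a'" "a' \<le> h" "0 \<le> b'" "b' \<le> h" and e2:
    "f (u + h *\<^sub>R w + h *\<^sub>R v) - f (u + h *\<^sub>R w) - f (u + h *\<^sub>R v) + f u
      = h * h * B (u + a' *\<^sub>R w + b' *\<^sub>R v) v"
    using mixed_difference_mvt[OF h S2 f B(1)] by blast
  have c: "u + h *\<^sub>R w + h *\<^sub>R v = u + h *\<^sub>R v + h *\<^sub>R w" by (simp add: algebra_simps)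
  have "h * h * A (u + a *\<^sub>R v + b *\<^sub>R w) w = h * h * B (u + a' *\<^sub>R w + b' *\<^sub>R v) v"
    using e1 e2[unfolded c] by linarith
  then have eq: "A (u + a *\<^sub>R v + b *\<^sub>R w) w = B (u + a' *\<^sub>R w + b' *\<^sub>R v) v" using h by simp
  have "dist (A (u + a *\<^sub>R v + b *\<^sub>R w) w) (A u w) < d"
    using near[OF ab, of v w] by (intro \<delta>1) (simp add: \<delta>_def)
  moreover have "dist (B (u + a' *\<^sub>R w + b' *\<^sub>R v) v) (B u v) < d"
    using near[OF ab', of w v] by (intro \<delta>2) (simp add: \<delta>_def add.commute)
  ultimately show False unfolding eq d_def dist_real_def by argo
qed

lemma smooth_on_clairaut:
  fixes f :: "'a::euclidean_space \<Rightarrow> 'b::euclidean_space"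
  assumes f: "smooth_on f S" and S: "open S" "u \<in> S"
  shows "frechet_derivative (\<lambda>x. frechet_derivative f (at x) v) (at u) w
    = frechet_derivative (\<lambda>x. frechet_derivative f (at x) w) (at u) v"
proof (rule euclidean_eqI)
  fix b :: 'b assume "b \<in> Basis"
  have D: "(g has_derivative frechet_derivative g (at x)) (at x)"
    if "smooth_on g S" "x \<in> S" for g :: "'a \<Rightarrow> 'b" and x
    using smooth_on_differentiable[OF that(1) S(1) that(2)] frechet_derivative_works by blast
  let ?f' = "\<lambda>x. frechet_derivative f (at x)"
  show "frechet_derivative (\<lambda>x. ?f' x v) (at u) w \<bullet> b = frechet_derivative (\<lambda>x. ?f' x w) (at u) v \<bullet> b"
  proof (rule clairaut_real[OF S, where f = "\<lambda>x. f x \<bullet> b" and f' = "\<lambda>x h. ?f' x h \<bullet> b"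
      and A = "\<lambda>x w. frechet_derivative (\<lambda>x. ?f' x v) (at x) w \<bullet> b"
      and B = "\<lambda>x v. frechet_derivative (\<lambda>x. ?f' x w) (at x) v \<bullet> b"])
    show "((\<lambda>x. f x \<bullet> b) has_derivative (\<lambda>h. ?f' x h \<bullet> b)) (at x)" if "x \<in> S" for x
      using that by (intro has_derivative_inner_left D f)
    show "((\<lambda>x. ?f' x v \<bullet> b) has_derivative (\<lambda>w. frechet_derivative (\<lambda>x. ?f' x v) (at x) w \<bullet> b)) (at x)"
      if "x \<in> S" for x v using that by (intro has_derivative_inner_left D smooth_on_frechet_derivative f)
    then show "((\<lambda>x. ?f' x w \<bullet> b) has_derivative (\<lambda>v. frechet_derivative (\<lambda>x. ?f' x w) (at x) v \<bullet> b)) (at x)"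
      if "x \<in> S" for x using that .
    show "continuous_on S (\<lambda>x. frechet_derivative (\<lambda>x. ?f' x v) (at x) w \<bullet> b)" for v w
      by (intro continuous_on_inner continuous_on_const smooth_on_imp_continuous_on
          smooth_on_frechet_derivative f)
    then show "continuous_on S (\<lambda>x. frechet_derivative (\<lambda>x. ?f' x w) (at x) v \<bullet> b)" .
  qed
qed

lemma partial_commute:
  fixes f :: "real^'n \<Rightarrow> 'b::euclidean_space"
  assumes "smooth_on f S" "open S" "u \<in> S"
  shows "partial i (partial j f) u = partial j (partial i f) u"
  unfolding partial_def[abs_def] by (rule smooth_on_clairaut[OF assms])

lemma partial_unique: "(f has_derivative f') (at u) \<Longrightarrow> partial i f u = f' (axis i 1)"
  unfolding partial_def by (metis frechet_derivative_at)

lemma partial_cong: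
  assumes "f differentiable (at u)" "open S" "u \<in> S" "\<And>x. x \<in> S \<Longrightarrow> f x = g x"
  shows "partial i f u = partial i g u"
  unfolding partial_def using frechet_derivative_transform_within_open[OF assms] by simp

lemma partial_inner:
  fixes f g :: "real^'n \<Rightarrow> 'b::euclidean_space"
  assumes "f differentiable (at u)" "g differentiable (at u)"
  shows "partial i (\<lambda>v. f v \<bullet> g v) u = f u \<bullet> partial i g u + partial i f u \<bullet> g u"
  using partial_unique[OF has_derivative_inner[OF assms[unfolded frechet_derivative_works]], of i]
  by (simp add: partial_def)

lemma partial_mult:
  fixes f g :: "real^'n \<Rightarrow> real"
  assumes "f differentiable (at u)" "g differentiable (at u)"
  shows "partial i (\<lambda>v. f v * g v) u = f u * partial i g u + partial i f u * g u"
  using partial_unique[OF has_derivative_mult[OF assms[unfolded frechet_derivative_works]], of i]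
  by (simp add: partial_def)

lemma partial_diff:
  assumes "f differentiable (at u)" "g differentiable (at u)"
  shows "partial i (\<lambda>v. f v - g v) u = partial i f u - partial i g u"
  using partial_unique[OF has_derivative_diff[OF assms[unfolded frechet_derivative_works]], of i]
  by (simp add: partial_def)

lemma partial_sum:
  assumes "\<And>m. m \<in> I \<Longrightarrow> f m differentiable (at u)"
  shows "partial i (\<lambda>v. \<Sum>m\<in>I. f m v) u = (\<Sum>m\<in>I. partial i (f m) u)"
  using partial_unique[OF has_derivative_sum[of I f "\<lambda>m. frechet_derivative (f m) (at u)" "at u"], of i] assms
  by (simp add: partial_def frechet_derivative_works)

lemma partial_const: "partial i (\<lambda>v. c) u = 0"
  by (simp add: partial_def)

lemma frechet_derivative_eq_sum_partial:
  fixes f :: "real^'n \<Rightarrow> 'b::real_normed_vector"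
  assumes "f differentiable (at u)"
  shows "frechet_derivative f (at u) x = (\<Sum>i\<in>UNIV. x $ i *\<^sub>R partial i f u)"
proof -
  have lin: "linear (frechet_derivative f (at u))" using assms by (rule linear_frechet_derivative)
  have "x = (\<Sum>i\<in>UNIV. x $ i *\<^sub>R axis i 1)"
    using basis_expansion[of x] by (simp add: scalar_mult_eq_scaleR)
  then have "frechet_derivative f (at u) x = frechet_derivative f (at u) (\<Sum>i\<in>UNIV. x $ i *\<^sub>R axis i 1)"
    by simp
  also have "\<dots> = (\<Sum>i\<in>UNIV. x $ i *\<^sub>R partial i f u)"
    by (simp add: linear_sum[OF lin] linear_scale[OF lin] partial_def)
  finally show ?thesis .
qed

section \<open>The Gauss equation\<close>

text \<open>Positivity is tested on \<open>B w w\<close> times the component of \<open>v\<close>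
  that is \<open>B\<close>-orthogonal to \<open>w\<close>, nonzero by independence. It serves for
  the second fundamental form (numerator of the sectional curvature) and for the metric
  (denominator).\<close>

lemma definite_cauchy_schwarz_strict:
  fixes B :: "'a::real_vector \<Rightarrow> 'a \<Rightarrow> real"
  assumes lin: "\<And>x. linear (B x)" and sym: "\<And>x y. B x y = B y x"
    and pos: "\<And>x. x \<noteq> 0 \<Longrightarrow> B x x > 0"
    and ind: "v \<noteq> w" "independent {v, w}"
  shows "(B v w)\<^sup>2 < B v v * B w w"
proof -
  have w: "w \<noteq> 0" using ind(2) dependent_zero by blast
  have vs: "v \<notin> span {w}" using ind by (simp add: independent_insert)
  define x where "x = B w w *\<^sub>R v - B v w *\<^sub>R w"
  have Bw: "B w w > 0" by (rule pos[OF w])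
  have "x \<noteq> 0"
  proof
    assume "x = 0"
    then have eq: "B w w *\<^sub>R v = B v w *\<^sub>R w" by (simp add: x_def)
    have "v = (1 / B w w) *\<^sub>R (B w w *\<^sub>R v)" using Bw by simp
    also have "\<dots> \<in> span {w}" unfolding eq by (intro span_scale span_base) simp
    finally show False using vs by simp
  qed
  then have "B x x > 0" by (rule pos)
  also have "B x x = B w w * (B v v * B w w - (B v w)\<^sup>2)"
  proof -
    have r: "B y x = B w w * B y v - B v w * B y w" for y
      unfolding x_def using linear_diff[OF lin[of y]] linear_scale[OF lin[of y]] by simp
    have "B x x = B w w * B v x - B v w * B w x" using r[of x] sym by metis
    then show ?thesis unfolding r using sym[of w v] by (simp add: power2_eq_square algebra_simps)
  qed
  finally show ?thesis using Bw by (simp add: zero_less_mult_iff)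
qed

lemma sum_rotate:
  "(\<Sum>l\<in>L. \<Sum>i\<in>I. \<Sum>j\<in>J. \<Sum>k\<in>K. T l i j k) = (\<Sum>i\<in>I. \<Sum>j\<in>J. \<Sum>k\<in>K. \<Sum>l\<in>L. T l i j k)"
proof -
  have "(\<Sum>l\<in>L. \<Sum>i\<in>I. \<Sum>j\<in>J. \<Sum>k\<in>K. T l i j k) = (\<Sum>i\<in>I. \<Sum>l\<in>L. \<Sum>j\<in>J. \<Sum>k\<in>K. T l i j k)"
    by (rule sum.swap)
  also have "\<dots> = (\<Sum>i\<in>I. \<Sum>j\<in>J. \<Sum>l\<in>L. \<Sum>k\<in>K. T l i j k)"
    by (rule sum.cong[OF refl], rule sum.swap)
  also have "\<dots> = (\<Sum>i\<in>I. \<Sum>j\<in>J. \<Sum>k\<in>K. \<Sum>l\<in>L. T l i j k)"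
    by (rule sum.cong[OF refl], rule sum.cong[OF refl], rule sum.swap)
  finally show ?thesis .
qed

text \<open>Needed for Cramer's rule, through which the Christoffel symbols are seen to be
  differentiable.\<close>

lemma differentiable_det:
  fixes A :: "'a::real_normed_vector \<Rightarrow> real^'n^'n"
  assumes "\<And>i j. (\<lambda>v. A v $ i $ j) differentiable (at u)"
  shows "(\<lambda>v. det (A v)) differentiable (at u)"
proof -
  have "(\<lambda>v. \<Prod>i\<in>UNIV. A v $ i $ p i) differentiable (at u)" for p
  proof -
    have "((\<lambda>v. A v $ i $ p i) has_derivative frechet_derivative (\<lambda>v. A v $ i $ p i) (at u)) (at u)" for i
      using assms frechet_derivative_works by blast
    then have "((\<lambda>v. \<Prod>i\<in>UNIV. A v $ i $ p i) has_derivative (\<lambda>y. \<Sum>i\<in>UNIV.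
        frechet_derivative (\<lambda>v. A v $ i $ p i) (at u) y * (\<Prod>j\<in>UNIV - {i}. A u $ j $ p j))) (at u)"
      by (intro has_derivative_prod)
    then show ?thesis unfolding differentiable_def by blast
  qed
  then show ?thesis
    unfolding det_def by (intro differentiable_sum differentiable_mult) auto
qed

locale immersed_patch =
  fixes \<phi> :: "real^'n \<Rightarrow> 'a::euclidean_space" and U :: "(real^'n) set"
  assumes open_U: "open U" and smooth: "smooth_on \<phi> U"
    and immersive: "\<And>u. u \<in> U \<Longrightarrow> inj (frechet_derivative \<phi> (at u))"
begin

abbreviation "P i \<equiv> partial i \<phi>"
abbreviation "P2 i j \<equiv> partial i (partial j \<phi>)"
abbreviation "g \<equiv> induced_metric \<phi>"
abbreviation "\<Gamma> \<equiv> christoffel (induced_metric \<phi>)"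

definition tangent :: "real^'n \<Rightarrow> real^'n \<Rightarrow> 'a" where
  "tangent u x = (\<Sum>i\<in>UNIV. x $ i *\<^sub>R P i u)"

lemma differentiable_P: "u \<in> U \<Longrightarrow> P i differentiable (at u)"
  by (rule smooth_on_differentiable[OF smooth_on_partial[OF smooth] open_U])

lemma differentiable_P2: "u \<in> U \<Longrightarrow> P2 i j differentiable (at u)"
  by (rule smooth_on_differentiable[OF smooth_on_partial[OF smooth_on_partial[OF smooth]] open_U])

lemma P2_commute: "u \<in> U \<Longrightarrow> P2 i j u = P2 j i u"
  by (rule partial_commute[OF smooth open_U])

lemma P3_commute: "u \<in> U \<Longrightarrow> partial i (P2 j k) u = partial j (P2 i k) u"
  by (rule partial_commute[OF smooth_on_partial[OF smooth] open_U])

lemma linear_tangent: "linear (tangent u)"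
  by (rule linearI) (simp_all add: tangent_def scaleR_add_left sum.distrib scaleR_sum_right)

lemma tangent_eq_0_iff: "u \<in> U \<Longrightarrow> tangent u x = 0 \<longleftrightarrow> x = 0"
proof -
  assume u: "u \<in> U"
  have d: "\<phi> differentiable (at u)" by (rule smooth_on_differentiable[OF smooth open_U u])
  have "tangent u x = frechet_derivative \<phi> (at u) x"
    by (simp add: frechet_derivative_eq_sum_partial[OF d] tangent_def)
  then show ?thesis
    using linear_injective_0[OF linear_frechet_derivative[OF d]] immersive[OF u]
      linear_0[OF linear_frechet_derivative[OF d]] by auto
qed

lemma metric_nth: "g u $ i $ j = P i u \<bullet> P j u"
  by (simp add: induced_metric_def)

lemma metric_form: "x \<bullet> (g u *v y) = tangent u x \<bullet> tangent u y"
  by (simp add: inner_vec_def matrix_vector_mult_def metric_nth tangent_def inner_sum_left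
      inner_sum_right sum_distrib_left mult_ac) (rule sum.swap)

lemma invertible_metric:
  assumes u: "u \<in> U"
  shows "invertible (g u)"
proof -
  have "x = 0" if "g u *v x = 0" for x
    using metric_form[of x u x] that tangent_eq_0_iff[OF u] by simp
  then show ?thesis unfolding invertible_left_inverse matrix_left_invertible_ker by blast
qed

lemma metric_mult_inv: "u \<in> U \<Longrightarrow> g u *v (matrix_inv (g u) *v c) = c"
proof -
  assume "u \<in> U"
  then have "g u ** matrix_inv (g u) = mat 1"
    using someI_ex[OF invertible_metric[unfolded invertible_def]] unfolding matrix_inv_def by blast
  then show ?thesis by (simp add: matrix_vector_mul_assoc)
qed

lemma partial_metric:
  "u \<in> U \<Longrightarrow> partial k (\<lambda>v. g v $ i $ j) u = P i u \<bullet> P2 k j u + P2 k i u \<bullet> P j u"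
  by (simp add: metric_nth partial_inner differentiable_P)

text \<open>For an induced metric, symmetry of \<open>P2\<close> collapses the three metric
  derivatives to twice \<open>P2 i j u \<bullet> P l u\<close>. The symbols are thus the
  coefficients of the tangential part of \<open>P2 i j u\<close>.\<close>

lemma christoffel_eq:
  assumes u: "u \<in> U"
  shows "\<Gamma> k i j u = (matrix_inv (g u) *v (\<chi> l. P2 i j u \<bullet> P l u)) $ k"
proof -
  have "partial i (\<lambda>v. g v $ j $ l) u + partial j (\<lambda>v. g v $ i $ l) u - partial l (\<lambda>v. g v $ i $ j) u
      = 2 * (P2 i j u \<bullet> P l u)" for l
    unfolding partial_metric[OF u] P2_commute[OF u, of l i] P2_commute[OF u, of l j] P2_commute[OF u, of j i]
    by (simp add: inner_commute)
  then show ?thesis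
    unfolding christoffel_def by (simp add: matrix_vector_mult_def sum_divide_distrib)
qed

lemma metric_christoffel:
  assumes u: "u \<in> U"
  shows "(\<Sum>l\<in>UNIV. g u $ h $ l * \<Gamma> l i j u) = P2 i j u \<bullet> P h u"
proof -
  let ?c = "\<chi> l. P2 i j u \<bullet> P l u"
  have "(g u *v (matrix_inv (g u) *v ?c)) $ h = ?c $ h" by (simp add: metric_mult_inv[OF u])
  then show ?thesis
    unfolding christoffel_eq[OF u] by (simp add: matrix_vector_mult_def[of "g u"])
qed

text \<open>\<open>riemann\<close> differentiates the symbols, and the sum and product rules for
  \<open>partial\<close> require differentiability. Cramer's rule writes each symbol as a quotient
  of determinants in derivatives of \<open>\<phi>\<close>.\<close>

lemma differentiable_christoffel:
  assumes u: "u \<in> U"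
  shows "\<Gamma> k i j differentiable (at u)"
proof -
  define A where "A v = (\<chi> a b. if b = k then P2 i j v \<bullet> P a v else g v $ a $ b)" for v
  have det0: "det (g v) \<noteq> 0" if "v \<in> U" for v
    using invertible_metric[OF that] invertible_det_nz by blast
  have G: "\<Gamma> k i j v = det (A v) / det (g v)" if v: "v \<in> U" for v
  proof -
    let ?c = "\<chi> l. P2 i j v \<bullet> P l v"
    have "matrix_inv (g v) *v ?c = (\<chi> k. det (\<chi> a b. if b = k then ?c $ a else g v $ a $ b) / det (g v))"
      using cramer[OF det0[OF v]] metric_mult_inv[OF v] by blast
    then show ?thesis unfolding christoffel_eq[OF v] A_def by (simp cong: if_cong)
  qed
  have dg: "(\<lambda>v. g v $ a $ b) differentiable (at u)" for a b
    unfolding metric_nth by (intro differentiable_inner differentiable_P u)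
  have "(\<lambda>v. A v $ a $ b) differentiable (at u)" for a b
  proof (cases "b = k")
    case True
    have "(\<lambda>v. P2 i j v \<bullet> P a v) differentiable (at u)"
      by (intro differentiable_inner differentiable_P differentiable_P2 u)
    then show ?thesis using True by (simp add: A_def)
  next
    case False
    then show ?thesis using dg by (simp add: A_def)
  qed
  then have "(\<lambda>v. det (A v) / det (g v)) differentiable (at u)"
    using dg det0[OF u] by (intro differentiable_divide differentiable_det)
  then obtain D where "((\<lambda>v. det (A v) / det (g v)) has_derivative D) (at u)"
    unfolding differentiable_def by blast
  then have "(\<Gamma> k i j has_derivative D) (at u)"
    by (rule has_derivative_transform_within_open[OF _ open_U u]) (simp add: G)
  then show ?thesis unfolding differentiable_def by blast
qed

text \<open>The normal part of \<open>P2 j k u\<close>, kept as a vector of the ambient space so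
  that no unit normal has to be chosen.\<close>

definition second_form :: "'n \<Rightarrow> 'n \<Rightarrow> real^'n \<Rightarrow> 'a" where
  "second_form j k u = P2 j k u - (\<Sum>m\<in>UNIV. \<Gamma> m j k u *\<^sub>R P m u)"

lemma second_form_orthogonal:
  assumes "u \<in> U"
  shows "second_form j k u \<bullet> P h u = 0"
proof -
  have "(\<Sum>l\<in>UNIV. \<Gamma> l j k u * (P l u \<bullet> P h u)) = P2 j k u \<bullet> P h u"
    using metric_christoffel[OF assms, of h j k]
    by (simp add: metric_nth inner_commute[of "P h u" "P _ u"] mult.commute)
  then show ?thesis by (simp add: second_form_def inner_diff_left inner_sum_left)
qed

text \<open>Obtained by differentiating \<open>metric_christoffel\<close>, so derivatives of the
  inverse metric never appear. The left side is \<open>riemann\<close>, with its upper index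
  lowered, before antisymmetrization in \<open>i\<close> and \<open>j\<close>.\<close>

lemma gauss_half:
  assumes u: "u \<in> U"
  shows "(\<Sum>l\<in>UNIV. g u $ h $ l * (partial i (\<Gamma> l j k) u + (\<Sum>m\<in>UNIV. \<Gamma> l i m u * \<Gamma> m j k u)))
    = partial i (P2 j k) u \<bullet> P h u + second_form j k u \<bullet> P2 i h u"
proof -
  let ?F = "\<lambda>v. P2 j k v \<bullet> P h v - (\<Sum>l\<in>UNIV. g v $ h $ l * \<Gamma> l j k v)"
  have dg: "(\<lambda>v. g v $ a $ b) differentiable (at u)" for a b
    unfolding metric_nth by (intro differentiable_inner differentiable_P u)
  have d1: "(\<lambda>v. P2 j k v \<bullet> P h v) differentiable (at u)"
    by (intro differentiable_inner differentiable_P differentiable_P2 u)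
  have d2: "(\<lambda>v. g v $ h $ l * \<Gamma> l j k v) differentiable (at u)" for l
    by (intro differentiable_mult dg differentiable_christoffel u)
  have d3: "(\<lambda>v. \<Sum>l\<in>UNIV. g v $ h $ l * \<Gamma> l j k v) differentiable (at u)"
    using d2 by simp
  have "partial i ?F u = partial i (\<lambda>v. 0::real) u"
    by (rule partial_cong[OF differentiable_diff[OF d1 d3] open_U u]) (simp add: metric_christoffel)
  then have "partial i (\<lambda>v. P2 j k v \<bullet> P h v) u
      = (\<Sum>l\<in>UNIV. partial i (\<lambda>v. g v $ h $ l * \<Gamma> l j k v) u)"
    by (simp add: partial_diff[OF d1 d3] partial_sum[OF d2] partial_const)
  also have "\<dots> = (\<Sum>l\<in>UNIV. g u $ h $ l * partial i (\<Gamma> l j k) u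
      + (P h u \<bullet> P2 i l u + P2 i h u \<bullet> P l u) * \<Gamma> l j k u)"
    by (simp add: partial_mult dg differentiable_christoffel u partial_metric)
  also have "\<dots> = (\<Sum>l\<in>UNIV. g u $ h $ l * partial i (\<Gamma> l j k) u)
      + (\<Sum>m\<in>UNIV. (P2 i m u \<bullet> P h u) * \<Gamma> m j k u) + (\<Sum>m\<in>UNIV. \<Gamma> m j k u * (P m u \<bullet> P2 i h u))"
    by (simp add: sum.distrib algebra_simps inner_commute)
  also have "(\<Sum>m\<in>UNIV. (P2 i m u \<bullet> P h u) * \<Gamma> m j k u)
      = (\<Sum>l\<in>UNIV. g u $ h $ l * (\<Sum>m\<in>UNIV. \<Gamma> l i m u * \<Gamma> m j k u))"
    unfolding metric_christoffel[OF u, symmetric] sum_distrib_left sum_distrib_right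
    by (subst sum.swap) (simp add: mult_ac)
  also have "partial i (\<lambda>v. P2 j k v \<bullet> P h v) u = P2 j k u \<bullet> P2 i h u + partial i (P2 j k) u \<bullet> P h u"
    by (simp add: partial_inner differentiable_P differentiable_P2 u)
  finally show ?thesis
    unfolding distrib_left sum.distrib second_form_def inner_diff_left inner_sum_left inner_scaleR_left
    by linarith
qed

text \<open>Antisymmetrizing \<open>gauss_half\<close> in \<open>i\<close> and \<open>j\<close>
  cancels the third derivatives of \<open>\<phi>\<close>.\<close>

lemma gauss_equation:
  assumes u: "u \<in> U"
  shows "(\<Sum>l\<in>UNIV. g u $ h $ l * riemann g l i j k u)
    = second_form j k u \<bullet> P2 i h u - second_form i k u \<bullet> P2 j h u"
proof -
  have "(\<Sum>l\<in>UNIV. g u $ h $ l * riemann g l i j k u)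
      = (\<Sum>l\<in>UNIV. g u $ h $ l * (partial i (\<Gamma> l j k) u + (\<Sum>m\<in>UNIV. \<Gamma> l i m u * \<Gamma> m j k u)))
      - (\<Sum>l\<in>UNIV. g u $ h $ l * (partial j (\<Gamma> l i k) u + (\<Sum>m\<in>UNIV. \<Gamma> l j m u * \<Gamma> m i k u)))"
    by (simp add: riemann_def sum_subtractf algebra_simps)
  then show ?thesis unfolding gauss_half[OF u] P3_commute[OF u, of i j k] by simp
qed

text \<open>For a hypersurface the second fundamental form is a multiple of a normal vector \<open>\<nu>\<close>, so
  the numerator of the sectional curvature becomes a Gram determinant of a definite form.\<close>

lemma sectional_curvature_pos:
  assumes u: "u \<in> U" and dim: "DIM('a) = CARD('n) + 1"
    and \<nu>: "\<nu> \<noteq> 0" "\<And>i. P i u \<bullet> \<nu> = 0"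
    and neg: "\<And>x. x \<noteq> 0 \<Longrightarrow> (\<Sum>i\<in>UNIV. \<Sum>j\<in>UNIV. x $ i * x $ j * (P2 i j u \<bullet> \<nu>)) < 0"
    and vw: "v \<noteq> w" "independent {v, w}"
  shows "sectional_curvature g u v w > 0"
proof -
  define S where "S = range (tangent u)"
  have inj: "inj (tangent u)"
    using linear_injective_0[OF linear_tangent] tangent_eq_0_iff[OF u] by blast
  have dimS: "dim S = CARD('n)"
    unfolding S_def by (subst dim_image_eq[OF linear_tangent]) (use inj in \<open>auto simp: dim_UNIV\<close>)
  have subS: "subspace S" unfolding S_def by (rule linear_subspace_image[OF linear_tangent]) simp
  have P_S: "P i u \<in> S" for i
  proof -
    have "tangent u (axis i 1) = P i u"
      unfolding tangent_def by (simp add: axis_def if_distrib[of "\<lambda>c. c *\<^sub>R _"] cong: if_cong)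
    then show ?thesis unfolding S_def by (metis rangeI)
  qed
  have \<nu>S: "\<nu> \<bullet> y = 0" if "y \<in> S" for y
    using that \<nu>(2) by (auto simp: S_def tangent_def inner_sum_left inner_commute[of \<nu>])
  \<comment> \<open>A dimension count: the tangent space has codimension 1, so its orthogonal
    complement is the line of \<open>\<nu>\<close>.\<close>
  have normal: "z = (z \<bullet> \<nu> / (\<nu> \<bullet> \<nu>)) *\<^sub>R \<nu>" if z: "\<And>h. z \<bullet> P h u = 0" for z
  proof (rule ccontr)
    define y where "y = z - (z \<bullet> \<nu> / (\<nu> \<bullet> \<nu>)) *\<^sub>R \<nu>"
    assume "z \<noteq> (z \<bullet> \<nu> / (\<nu> \<bullet> \<nu>)) *\<^sub>R \<nu>"
    then have y: "y \<noteq> 0" by (simp add: y_def)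
    have zS: "z \<bullet> x = 0" if "x \<in> S" for x
      using that z by (auto simp: S_def tangent_def inner_sum_right)
    have y\<nu>: "y \<bullet> \<nu> = 0" using \<nu>(1) by (simp add: y_def inner_diff_left)
    have yS: "y \<bullet> x = 0" if "x \<in> S" for x using zS[OF that] \<nu>S[OF that] by (simp add: y_def inner_diff_left)
    have "y \<in> span (insert \<nu> S)"
    proof -
      have "\<nu> \<notin> S" using \<nu>S[of \<nu>] \<nu>(1) by auto
      then have "\<nu> \<notin> span S" using subS by (simp add: span_eq_iff[THEN iffD2])
      then have "dim (insert \<nu> S) = DIM('a)" using dimS dim by (simp add: dim_insert)
      then have "span (insert \<nu> S) = UNIV" by (simp add: dim_eq_full)
      then show ?thesis by simp
    qed
    moreover have "y \<bullet> x = 0" if "x \<in> span (insert \<nu> S)" for x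
    proof -
      have "orthogonal y x"
        by (rule orthogonal_to_span[OF that]) (use y\<nu> yS in \<open>auto simp: orthogonal_def\<close>)
      then show ?thesis by (simp add: orthogonal_def)
    qed
    ultimately have "y \<bullet> y = 0" by blast
    then show False using y by simp
  qed
  define b where "b i j = P2 i j u \<bullet> \<nu>" for i j
  define B where "B x y = - (\<Sum>i\<in>UNIV. \<Sum>j\<in>UNIV. x $ i * y $ j * b i j)" for x y :: "real^'n"
  have sf\<nu>: "second_form i j u \<bullet> \<nu> = b i j" for i j
    by (simp add: second_form_def b_def inner_diff_left inner_sum_left \<nu>)
  have sf: "second_form i j u = (b i j / (\<nu> \<bullet> \<nu>)) *\<^sub>R \<nu>" for i j
    using normal[OF second_form_orthogonal[OF u], of i j] unfolding sf\<nu> .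
  have sfP: "second_form i j u \<bullet> P2 k l u = b i j * b k l / (\<nu> \<bullet> \<nu>)" for i j k l
    unfolding sf by (simp add: b_def inner_commute)
  have bsym: "b i j = b j i" for i j by (simp add: b_def P2_commute[OF u, of i j])
  have R: "(\<Sum>l\<in>UNIV. g u $ h $ l * riemann g l i j k u) = (b j k * b i h - b i k * b j h) / (\<nu> \<bullet> \<nu>)"
    for h i j k unfolding gauss_equation[OF u] sfP by (simp add: diff_divide_distrib)
  \<comment> \<open>Summing over \<open>l\<close> first brings in the Gauss equation; the remaining
    fourfold sum then factors into values of \<open>B\<close>.\<close>
  have "(\<Sum>h\<in>UNIV. \<Sum>l\<in>UNIV. \<Sum>i\<in>UNIV. \<Sum>j\<in>UNIV. \<Sum>k\<in>UNIV.
        g u $ h $ l * riemann g l i j k u * v $ i * w $ j * w $ k * v $ h)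
    = (\<Sum>h\<in>UNIV. \<Sum>i\<in>UNIV. \<Sum>j\<in>UNIV. \<Sum>k\<in>UNIV. \<Sum>l\<in>UNIV.
        g u $ h $ l * riemann g l i j k u * v $ i * w $ j * w $ k * v $ h)"
    by (rule sum.cong[OF refl], rule sum_rotate)
  also have "\<dots> = (\<Sum>h\<in>UNIV. \<Sum>i\<in>UNIV. \<Sum>j\<in>UNIV. \<Sum>k\<in>UNIV.
        (\<Sum>l\<in>UNIV. g u $ h $ l * riemann g l i j k u) * (v $ i * w $ j * w $ k * v $ h))"
    unfolding sum_distrib_right by (simp only: mult.assoc)
  also have "\<dots> = (\<Sum>h\<in>UNIV. \<Sum>i\<in>UNIV. \<Sum>j\<in>UNIV. \<Sum>k\<in>UNIV.
        ((v $ i * v $ h * b i h) * (w $ j * w $ k * b j k)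
          - (v $ i * w $ k * b i k) * (v $ h * w $ j * b h j))) / (\<nu> \<bullet> \<nu>)"
    unfolding R sum_divide_distrib by (simp add: field_simps bsym)
  also have "\<dots> = (B v v * B w w - (B v w)\<^sup>2) / (\<nu> \<bullet> \<nu>)"
  proof -
    have 1: "B v v * B w w = (\<Sum>h\<in>UNIV. \<Sum>i\<in>UNIV. \<Sum>j\<in>UNIV. \<Sum>k\<in>UNIV.
        (v $ i * v $ h * b i h) * (w $ j * w $ k * b j k))"
    proof -
      have "B v v = - (\<Sum>h\<in>UNIV. \<Sum>i\<in>UNIV. v $ i * v $ h * b i h)"
        unfolding B_def by (subst sum.swap) simp
      moreover have "B w w = - (\<Sum>j\<in>UNIV. \<Sum>k\<in>UNIV. w $ j * w $ k * b j k)" by (simp add: B_def)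
      ultimately have "B v v * B w w = (\<Sum>h\<in>UNIV. \<Sum>i\<in>UNIV. v $ i * v $ h * b i h)
          * (\<Sum>j\<in>UNIV. \<Sum>k\<in>UNIV. w $ j * w $ k * b j k)" by simp
      also have "\<dots> = (\<Sum>h\<in>UNIV. \<Sum>i\<in>UNIV. v $ i * v $ h * b i h
          * (\<Sum>j\<in>UNIV. \<Sum>k\<in>UNIV. w $ j * w $ k * b j k))" by (simp only: sum_distrib_right)
      finally show ?thesis by (simp only: sum_distrib_left)
    qed
    have 2: "(B v w)\<^sup>2 = (\<Sum>h\<in>UNIV. \<Sum>i\<in>UNIV. \<Sum>j\<in>UNIV. \<Sum>k\<in>UNIV.
        (v $ i * w $ k * b i k) * (v $ h * w $ j * b h j))"
    proof -
      have "(B v w)\<^sup>2 = (\<Sum>i\<in>UNIV. \<Sum>k\<in>UNIV. v $ i * w $ k * b i k)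
          * (\<Sum>h\<in>UNIV. \<Sum>j\<in>UNIV. v $ h * w $ j * b h j)"
        by (simp add: B_def power2_eq_square)
      also have "\<dots> = (\<Sum>h\<in>UNIV. (\<Sum>i\<in>UNIV. \<Sum>k\<in>UNIV. v $ i * w $ k * b i k)
          * (\<Sum>j\<in>UNIV. v $ h * w $ j * b h j))" by (simp only: sum_distrib_left)
      also have "\<dots> = (\<Sum>h\<in>UNIV. \<Sum>i\<in>UNIV. (\<Sum>k\<in>UNIV. v $ i * w $ k * b i k)
          * (\<Sum>j\<in>UNIV. v $ h * w $ j * b h j))" by (simp only: sum_distrib_right)
      also have "\<dots> = (\<Sum>h\<in>UNIV. \<Sum>i\<in>UNIV. \<Sum>j\<in>UNIV. (\<Sum>k\<in>UNIV. v $ i * w $ k * b i k)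
          * (v $ h * w $ j * b h j))" by (simp only: sum_distrib_left)
      finally show ?thesis by (simp only: sum_distrib_right)
    qed
    show ?thesis unfolding 1 2 by (simp add: sum_subtractf)
  qed
  finally have num: "(\<Sum>h\<in>UNIV. \<Sum>l\<in>UNIV. \<Sum>i\<in>UNIV. \<Sum>j\<in>UNIV. \<Sum>k\<in>UNIV.
        g u $ h $ l * riemann g l i j k u * v $ i * w $ j * w $ k * v $ h)
    = (B v v * B w w - (B v w)\<^sup>2) / (\<nu> \<bullet> \<nu>)" .
  have "(B v w)\<^sup>2 < B v v * B w w"
  proof (rule definite_cauchy_schwarz_strict[OF _ _ _ vw])
    show "linear (B x)" for x
      by (rule linearI)
        (simp_all add: B_def algebra_simps sum.distrib sum_distrib_left)
    show "B x y = B y x" for x y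
      unfolding B_def by (subst sum.swap) (simp add: bsym mult_ac)
    show "B x x > 0" if "x \<noteq> 0" for x using neg[OF that] by (simp add: B_def b_def)
  qed
  then have N: "(B v v * B w w - (B v w)\<^sup>2) / (\<nu> \<bullet> \<nu>) > 0" using \<nu>(1) by simp
  have "(tangent u v \<bullet> tangent u w)\<^sup>2 < (tangent u v \<bullet> tangent u v) * (tangent u w \<bullet> tangent u w)"
  proof (rule definite_cauchy_schwarz_strict[OF _ _ _ vw])
    show "linear (\<lambda>y. tangent u x \<bullet> tangent u y)" for x
      by (rule linearI) (simp_all add: linear_add[OF linear_tangent] linear_scale[OF linear_tangent] inner_add_right)
    show "tangent u x \<bullet> tangent u x > 0" if "x \<noteq> 0" for x using that tangent_eq_0_iff[OF u] by simp
  qed (rule inner_commute)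
  then show ?thesis
    unfolding sectional_curvature_def num metric_form by (intro divide_pos_pos N) simp
qed

end

text \<open>Differentiating \<open>P j v \<bullet> \<nu> (\<phi> v) = 0\<close> along the patch
  shows that the second fundamental form, paired with the gradient, is minus the Hessian on tangent
  vectors. This is the sign that \<open>sectional_curvature_pos\<close> asks for.\<close>

lemma level_set_sectional_curvature_pos:
  fixes \<phi> :: "real^'n \<Rightarrow> 'a::euclidean_space" and f :: "'a \<Rightarrow> real" and \<nu> :: "'a \<Rightarrow> 'a"
  assumes patch: "immersed_patch \<phi> U" and u: "u \<in> U" and dim: "DIM('a) = CARD('n) + 1"
    and level: "\<And>v. v \<in> U \<Longrightarrow> f (\<phi> v) = c"
    and grad: "\<And>z. (f has_derivative (\<lambda>h. \<nu> z \<bullet> h)) (at z)"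
    and hess: "(\<nu> has_derivative D) (at (\<phi> u))"
    and ne: "\<nu> (\<phi> u) \<noteq> 0"
    and pos: "\<And>h. h \<noteq> 0 \<Longrightarrow> \<nu> (\<phi> u) \<bullet> h = 0 \<Longrightarrow> D h \<bullet> h > 0"
    and vw: "v \<noteq> w" "independent {v, w}"
  shows "sectional_curvature (induced_metric \<phi>) u v w > 0"
proof -
  interpret immersed_patch \<phi> U by (rule patch)
  have d\<phi>: "(\<phi> has_derivative frechet_derivative \<phi> (at v)) (at v)" if "v \<in> U" for v
    using smooth_on_differentiable[OF smooth open_U that] frechet_derivative_works by blast
  have orth: "P i v \<bullet> \<nu> (\<phi> v) = 0" if v: "v \<in> U" for i v
  proof -
    have "((\<lambda>v. f (\<phi> v)) has_derivative (\<lambda>h. \<nu> (\<phi> v) \<bullet> frechet_derivative \<phi> (at v) h)) (at v)"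
      by (rule has_derivative_compose[OF d\<phi>[OF v] grad])
    moreover have "((\<lambda>v. f (\<phi> v)) has_derivative (\<lambda>h. 0)) (at v)"
      by (rule has_derivative_transform_within_open[OF has_derivative_const open_U v]) (simp add: level)
    ultimately have "(\<lambda>h. \<nu> (\<phi> v) \<bullet> frechet_derivative \<phi> (at v) h) = (\<lambda>h. 0)"
      by (rule has_derivative_unique)
    then have "\<nu> (\<phi> v) \<bullet> frechet_derivative \<phi> (at v) (axis i 1) = 0" by (rule fun_cong)
    then show ?thesis by (simp add: partial_def inner_commute)
  qed
  have lin: "linear D" using hess by (rule has_derivative_linear)
  have dn: "((\<lambda>v. \<nu> (\<phi> v)) has_derivative (\<lambda>h. D (frechet_derivative \<phi> (at u) h))) (at u)"
    by (rule has_derivative_compose[OF d\<phi>[OF u] hess])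
  then have n_diff: "(\<lambda>v. \<nu> (\<phi> v)) differentiable (at u)" by (rule differentiableI)
  have pn: "partial i (\<lambda>v. \<nu> (\<phi> v)) u = D (P i u)" for i
    using partial_unique[OF dn, of i] by (simp add: partial_def)
  have second: "P2 i j u \<bullet> \<nu> (\<phi> u) = - (P j u \<bullet> D (P i u))" for i j
  proof -
    have "(\<lambda>v. P j v \<bullet> \<nu> (\<phi> v)) differentiable (at u)"
      by (intro differentiable_inner differentiable_P[OF u] n_diff)
    then have "partial i (\<lambda>v. P j v \<bullet> \<nu> (\<phi> v)) u = partial i (\<lambda>v. 0::real) u"
      by (rule partial_cong[OF _ open_U u]) (rule orth)
    then show ?thesis
      by (simp add: partial_inner differentiable_P[OF u] n_diff pn partial_const)
  qed
  show ?thesis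
  proof (rule sectional_curvature_pos[OF u dim ne orth[OF u] _ vw])
    fix x :: "real^'n" assume x: "x \<noteq> 0"
    have "(\<Sum>i\<in>UNIV. \<Sum>j\<in>UNIV. x $ i * x $ j * (P2 i j u \<bullet> \<nu> (\<phi> u)))
        = - ((\<Sum>j\<in>UNIV. x $ j *\<^sub>R P j u) \<bullet> (\<Sum>i\<in>UNIV. x $ i *\<^sub>R D (P i u)))"
      unfolding second inner_sum_left inner_sum_right by (simp add: sum_negf mult.assoc mult.left_commute)
    also have "(\<Sum>i\<in>UNIV. x $ i *\<^sub>R D (P i u)) = D (tangent u x)"
      by (simp add: tangent_def linear_sum[OF lin] linear_scale[OF lin])
    finally have e: "(\<Sum>i\<in>UNIV. \<Sum>j\<in>UNIV. x $ i * x $ j * (P2 i j u \<bullet> \<nu> (\<phi> u)))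
        = - (D (tangent u x) \<bullet> tangent u x)" by (simp add: tangent_def inner_commute)
    have "\<nu> (\<phi> u) \<bullet> tangent u x = 0"
      using orth[OF u] by (simp add: tangent_def inner_sum_right inner_commute[of "\<nu> (\<phi> u)"])
    then show "(\<Sum>i\<in>UNIV. \<Sum>j\<in>UNIV. x $ i * x $ j * (P2 i j u \<bullet> \<nu> (\<phi> u))) < 0"
      unfolding e using pos[of "tangent u x"] x tangent_eq_0_iff[OF u] by simp
  qed
qed

section \<open>Smooth functions\<close>

lemma Ck_on_cong:
  assumes "open S" "\<And>x. x \<in> S \<Longrightarrow> f x = g x" "Ck_on k f S"
  shows "Ck_on k g S"
  using assms(2,3)
proof (induction k arbitrary: f g)
  case 0
  then show ?case using continuous_on_cong[of S S f g] by simp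
next
  case (Suc k)
  have d: "f differentiable (at x)" if "x \<in> S" for x
    using Suc.prems(2) that \<open>open S\<close> by (simp add: differentiable_on_eq_differentiable_at)
  have e: "frechet_derivative f (at x) = frechet_derivative g (at x)" if "x \<in> S" for x
    by (rule frechet_derivative_transform_within_open[OF d[OF that] \<open>open S\<close> that Suc.prems(1)])
  have "g differentiable (at x)" if x: "x \<in> S" for x
  proof -
    obtain D where "(f has_derivative D) (at x)" using d[OF x] unfolding differentiable_def by blast
    then have "(g has_derivative D) (at x)"
      by (rule has_derivative_transform_within_open[OF _ \<open>open S\<close> x Suc.prems(1)])
    then show ?thesis by (rule differentiableI)
  qed
  moreover have "Ck_on k (\<lambda>x. frechet_derivative g (at x) v) S" for v
    by (rule Suc.IH[of "\<lambda>x. frechet_derivative f (at x) v"]) (use e Suc.prems(2) in auto)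
  ultimately show ?case using \<open>open S\<close> by (simp add: differentiable_on_eq_differentiable_at)
qed

text \<open>Lets an explicit derivative stand for \<open>frechet_derivative\<close>, so that the
  closure rules below follow from the rules of differentiation by induction on the order.\<close>

lemma Ck_on_SucI:
  assumes S: "open S" and f: "\<And>x. x \<in> S \<Longrightarrow> (f has_derivative f' x) (at x)"
    and f': "\<And>v. Ck_on k (\<lambda>x. f' x v) S"
  shows "Ck_on (Suc k) f S"
proof -
  have "f differentiable_on S"
    using f S by (auto simp: differentiable_on_eq_differentiable_at differentiable_def)
  moreover have "Ck_on k (\<lambda>x. frechet_derivative f (at x) v) S" for v
    by (rule Ck_on_cong[OF S _ f'[of v]]) (metis f frechet_derivative_at)
  ultimately show ?thesis by simp
qed

lemma Ck_on_SucD: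
  assumes "Ck_on (Suc k) f S"
  shows "open S \<Longrightarrow> x \<in> S \<Longrightarrow> (f has_derivative frechet_derivative f (at x)) (at x)"
    and "Ck_on k (\<lambda>x. frechet_derivative f (at x) v) S"
proof -
  show "(f has_derivative frechet_derivative f (at x)) (at x)" if "open S" "x \<in> S"
  proof -
    have "f differentiable (at x)" using assms that by (simp add: differentiable_on_eq_differentiable_at)
    then show ?thesis by (simp only: frechet_derivative_works)
  qed
  show "Ck_on k (\<lambda>x. frechet_derivative f (at x) v) S" using assms by simp
qed

lemma Ck_on_Suc_imp: "Ck_on (Suc k) f S \<Longrightarrow> Ck_on k f S"
  by (induction k arbitrary: f) (auto intro: differentiable_imp_continuous_on)

lemma Ck_on_subset: "Ck_on k f S \<Longrightarrow> T \<subseteq> S \<Longrightarrow> Ck_on k f T"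
  by (induction k arbitrary: f) (auto intro: continuous_on_subset differentiable_on_subset)

lemma Ck_on_const: "Ck_on k (\<lambda>x. c) S"
  by (induction k arbitrary: c) (auto simp: differentiable_on_const)

lemma Ck_on_bounded_linear:
  assumes "bounded_linear f"
  shows "Ck_on k f S"
proof -
  have "Ck_on (Suc k) f UNIV"
    by (rule Ck_on_SucI[where f' = "\<lambda>x. f"])
      (auto intro: bounded_linear_imp_has_derivative assms Ck_on_const)
  then show ?thesis using Ck_on_Suc_imp Ck_on_subset by blast
qed

lemma Ck_on_add:
  assumes "open S"
  shows "Ck_on k f S \<Longrightarrow> Ck_on k g S \<Longrightarrow> Ck_on k (\<lambda>x. f x + g x) S"
proof (induction k arbitrary: f g)
  case 0
  then show ?case by (simp add: continuous_on_add)
next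
  case (Suc k)
  show ?case
    by (rule Ck_on_SucI[OF assms has_derivative_add[OF Ck_on_SucD(1) Ck_on_SucD(1)]])
      (use Suc.prems assms in \<open>auto intro: Suc.IH Ck_on_SucD(2) simp del: Ck_on.simps\<close>)
qed

lemma Ck_on_linear_image:
  assumes "open S" and L: "bounded_linear L"
  shows "Ck_on k f S \<Longrightarrow> Ck_on k (\<lambda>x. L (f x)) S"
proof (induction k arbitrary: f)
  case 0
  then show ?case using bounded_linear.continuous_on[OF L] by simp
next
  case (Suc k)
  show ?case
    by (rule Ck_on_SucI[OF assms(1) bounded_linear.has_derivative[OF L Ck_on_SucD(1)[OF Suc.prems assms(1)]]])
      (auto intro: Suc.IH Ck_on_SucD(2)[OF Suc.prems] simp del: Ck_on.simps)
qed

lemma Ck_on_mult: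
  fixes f g :: "'a::euclidean_space \<Rightarrow> real"
  assumes "open S"
  shows "Ck_on k f S \<Longrightarrow> Ck_on k g S \<Longrightarrow> Ck_on k (\<lambda>x. f x * g x) S"
proof (induction k arbitrary: f g)
  case 0
  then show ?case by (simp add: continuous_on_mult)
next
  case (Suc k)
  note fg = Suc.prems
  show ?case
  proof (rule Ck_on_SucI[OF assms has_derivative_mult[OF Ck_on_SucD(1)[OF fg(1) assms] Ck_on_SucD(1)[OF fg(2) assms]]])
    show "Ck_on k (\<lambda>x. f x * frechet_derivative g (at x) v + frechet_derivative f (at x) v * g x) S" for v
      by (intro Ck_on_add assms Suc.IH Ck_on_SucD(2)[OF fg(1)] Ck_on_SucD(2)[OF fg(2)]
          Ck_on_Suc_imp[OF fg(1)] Ck_on_Suc_imp[OF fg(2)])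
  qed
qed

lemma Ck_on_inverse:
  fixes f :: "'a::euclidean_space \<Rightarrow> real"
  assumes "open S" and ne: "\<And>x. x \<in> S \<Longrightarrow> f x \<noteq> 0"
  shows "Ck_on k f S \<Longrightarrow> Ck_on k (\<lambda>x. inverse (f x)) S"
proof (induction k)
  case 0
  then show ?case using ne by (simp add: continuous_on_inverse)
next
  case (Suc k)
  show ?case
  proof (rule Ck_on_SucI[OF assms(1) Deriv.has_derivative_inverse[OF ne Ck_on_SucD(1)[OF Suc.prems assms(1)]]])
    have i: "Ck_on k (\<lambda>x. inverse (f x)) S" by (rule Suc.IH[OF Ck_on_Suc_imp[OF Suc.prems]])
    show "Ck_on k (\<lambda>x. - (inverse (f x) * frechet_derivative f (at x) v * inverse (f x))) S" for v
      by (intro Ck_on_linear_image[OF assms(1) bounded_linear_minus[OF bounded_linear_ident]]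
          Ck_on_mult[OF assms(1)] i Ck_on_SucD(2)[OF Suc.prems])
  qed
qed

lemma Ck_on_real_SucI:
  fixes h :: "real \<Rightarrow> real"
  assumes T: "open T" and h: "\<And>x. x \<in> T \<Longrightarrow> (h has_real_derivative h' x) (at x)" and h': "Ck_on k h' T"
  shows "Ck_on (Suc k) h T"
proof (rule Ck_on_SucI[OF T])
  show "(h has_derivative (\<lambda>v. h' x * v)) (at x)" if "x \<in> T" for x
    using h[OF that] by (simp add: has_field_derivative_def)
  show "Ck_on k (\<lambda>x. h' x * v) T" for v
    by (rule Ck_on_mult[OF T h' Ck_on_const])
qed

lemma Ck_on_compose_real:
  fixes f :: "'a::euclidean_space \<Rightarrow> real" and h :: "real \<Rightarrow> real"
  assumes S: "open S" and T: "open T" and sub: "f ` S \<subseteq> T"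
  shows "Ck_on k h T \<Longrightarrow> Ck_on k f S \<Longrightarrow> Ck_on k (\<lambda>x. h (f x)) S"
proof (induction k arbitrary: h)
  case 0
  then show ?case using sub by (auto intro: continuous_on_compose2)
next
  case (Suc k)
  note hf = Suc.prems
  have h: "(h has_derivative frechet_derivative h (at (f x))) (at (f x))" if "x \<in> S" for x
    using Ck_on_SucD(1)[OF hf(1) T, of "f x"] that sub by auto
  have lin: "frechet_derivative h (at (f x)) v = frechet_derivative h (at (f x)) 1 * v" if "x \<in> S" for x v
    using linear_scale[OF has_derivative_linear[OF h[OF that]], of v 1] by simp
  have d: "((\<lambda>x. h (f x)) has_derivative
      (\<lambda>v. frechet_derivative h (at (f x)) 1 * frechet_derivative f (at x) v)) (at x)" if x: "x \<in> S" for x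
  proof -
    have "(\<lambda>v. frechet_derivative h (at (f x)) (frechet_derivative f (at x) v))
        = (\<lambda>v. frechet_derivative h (at (f x)) 1 * frechet_derivative f (at x) v)"
      by (rule ext) (rule lin[OF x])
    then show ?thesis using has_derivative_compose[OF Ck_on_SucD(1)[OF hf(2) S x] h[OF x]] by metis
  qed
  show ?case
  proof (rule Ck_on_SucI[OF S d])
    show "Ck_on k (\<lambda>x. frechet_derivative h (at (f x)) 1 * frechet_derivative f (at x) v) S" for v
      by (intro Ck_on_mult S Suc.IH[of "\<lambda>y. frechet_derivative h (at y) 1"]
          Ck_on_SucD(2)[OF hf(1)] Ck_on_SucD(2)[OF hf(2)] Ck_on_Suc_imp[OF hf(2)])
  qed
qed

lemma smooth_on_const: "smooth_on (\<lambda>x. c) S"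
  and smooth_on_subset: "smooth_on f S \<Longrightarrow> T \<subseteq> S \<Longrightarrow> smooth_on f T"
  and smooth_on_bounded_linear: "bounded_linear f \<Longrightarrow> smooth_on f S"
  and smooth_on_add: "open S \<Longrightarrow> smooth_on f S \<Longrightarrow> smooth_on g S \<Longrightarrow> smooth_on (\<lambda>x. f x + g x) S"
  and smooth_on_linear_image: "open S \<Longrightarrow> bounded_linear L \<Longrightarrow> smooth_on f S \<Longrightarrow> smooth_on (\<lambda>x. L (f x)) S"
  by (auto simp: smooth_on_def Ck_on_const Ck_on_bounded_linear Ck_on_add Ck_on_linear_image
      intro: Ck_on_subset simp del: Ck_on.simps)

lemma smooth_on_mult:
  fixes f g :: "'a::euclidean_space \<Rightarrow> real"
  assumes "open S" "smooth_on f S" "smooth_on g S"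
  shows "smooth_on (\<lambda>x. f x * g x) S"
  unfolding smooth_on_def
proof
  show "Ck_on k (\<lambda>x. f x * g x) S" for k
    by (rule Ck_on_mult) (use assms in \<open>auto simp: smooth_on_def\<close>)
qed

lemma smooth_on_compose_real:
  fixes f :: "'a::euclidean_space \<Rightarrow> real" and h :: "real \<Rightarrow> real"
  assumes "open S" "open T" "f ` S \<subseteq> T" "smooth_on h T" "smooth_on f S"
  shows "smooth_on (\<lambda>x. h (f x)) S"
  unfolding smooth_on_def
proof
  show "Ck_on k (\<lambda>x. h (f x)) S" for k
    by (rule Ck_on_compose_real[OF assms(1-3)]) (use assms in \<open>auto simp: smooth_on_def\<close>)
qed

lemma smooth_on_Pair:
  assumes "open S" "smooth_on f S" "smooth_on g S"
  shows "smooth_on (\<lambda>x. (f x, g x)) S"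
proof -
  have L: "bounded_linear (\<lambda>x. (x, 0))" "bounded_linear (\<lambda>x. (0, x))"
    by (intro bounded_linear_Pair bounded_linear_ident bounded_linear_zero)+
  have "smooth_on (\<lambda>x. (f x, 0) + (0, g x)) S"
    by (intro smooth_on_add assms smooth_on_linear_image[OF assms(1) L(1)]
        smooth_on_linear_image[OF assms(1) L(2)])
  then show ?thesis by simp
qed

lemma Ck_on_sin_cos: "Ck_on k sin (UNIV :: real set) \<and> Ck_on k cos (UNIV :: real set)"
proof (induction k)
  case 0
  then show ?case by (simp add: continuous_on_sin continuous_on_cos)
next
  case (Suc k)
  have "Ck_on k (\<lambda>x::real. - sin x) UNIV"
    by (rule Ck_on_linear_image[OF open_UNIV bounded_linear_minus[OF bounded_linear_ident]]) (use Suc in blast)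
  then show ?case
    using Suc Ck_on_real_SucI[OF open_UNIV DERIV_sin] Ck_on_real_SucI[OF open_UNIV DERIV_cos] by blast
qed

lemma Ck_on_sinh_cosh: "Ck_on k sinh (UNIV :: real set) \<and> Ck_on k cosh (UNIV :: real set)"
proof (induction k)
  case 0
  then show ?case by (simp add: continuous_on_sinh continuous_on_cosh)
next
  case (Suc k)
  have "(sinh has_real_derivative cosh x) (at x)" "(cosh has_real_derivative sinh x) (at x)" for x :: real
    by (auto intro!: derivative_eq_intros)
  then show ?case
    using Suc Ck_on_real_SucI[OF open_UNIV, of sinh cosh k] Ck_on_real_SucI[OF open_UNIV, of cosh sinh k] by blast
qed

lemma smooth_on_elementary:
  "smooth_on sin (UNIV :: real set)" "smooth_on cos (UNIV :: real set)"
  "smooth_on sinh (UNIV :: real set)" "smooth_on cosh (UNIV :: real set)"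
  unfolding smooth_on_def using Ck_on_sin_cos Ck_on_sinh_cosh by blast+

text \<open>The inverse function theorem gives a differentiable \<open>r\<close> with derivative
  \<open>inverse (q' (r y))\<close>. This formula bootstraps: if \<open>r\<close> is of class k, so
  is its derivative.\<close>

lemma smooth_local_inverse:
  fixes q q' :: "real \<Rightarrow> real"
  assumes q: "\<And>x. (q has_real_derivative q' x) (at x)" and q': "smooth_on q' UNIV" and a: "q' a \<noteq> 0"
  obtains J V r where "open J" "a \<in> J" "open V" "homeomorphism J V q r" "smooth_on r V"
proof -
  have cq': "continuous_on UNIV q'" by (rule smooth_on_imp_continuous_on[OF q'])
  define N where "N = {x. q' x \<noteq> 0}"
  have N: "open N" unfolding N_def by (rule open_Collect_neq[OF cq' continuous_on_const])
  define D where "D x = q' x *\<^sub>R (id_blinfun :: real \<Rightarrow>\<^sub>L real)" for x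
  have D: "blinfun_apply (D x) = (\<lambda>v. q' x * v)" for x by (simp add: D_def fun_eq_iff scaleR_blinfun.rep_eq)
  have 1: "(q has_derivative blinfun_apply (D x)) (at x)" for x
    using q[of x] by (simp add: D has_field_derivative_def)
  have 2: "continuous_on N D" unfolding D_def
    by (intro continuous_on_scaleR continuous_on_const continuous_on_subset[OF cq']) simp
  have 3: "a \<in> N" using a by (simp add: N_def)
  have 4: "((1 / q' a) *\<^sub>R id_blinfun) o\<^sub>L D a = id_blinfun"
    by (rule blinfun_eqI) (use a in \<open>simp add: D scaleR_blinfun.rep_eq\<close>)
  obtain J V r r' where J: "open J" "J \<subseteq> N" "a \<in> J" "open V" "q a \<in> V" "homeomorphism J V q r"
    and r: "\<And>y. y \<in> V \<Longrightarrow> (r has_derivative r' y) (at y)"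
    and r': "\<And>y. y \<in> V \<Longrightarrow> r' y = inv (blinfun_apply (D (r y)))"
    and "\<And>y. y \<in> V \<Longrightarrow> bij (blinfun_apply (D (r y)))"
    by (rule inverse_function_theorem[OF N 1 2 3 4]) (rule that; assumption)
  have rN: "q' (r y) \<noteq> 0" if "y \<in> V" for y
    using J(2,6) that unfolding homeomorphism_def N_def by blast
  have dr: "(r has_real_derivative inverse (q' (r y))) (at y)" if y: "y \<in> V" for y
  proof -
    have "inv (\<lambda>v. q' (r y) * v) = (\<lambda>v. inverse (q' (r y)) * v)"
      by (rule inv_equality) (use rN[OF y] in simp_all)
    then show ?thesis using r[OF y] r'[OF y] by (simp add: has_field_derivative_def D)
  qed
  have "Ck_on k r V" for k
  proof (induction k)
    case 0
    then show ?case using J(6) by (simp add: homeomorphism_def)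
  next
    case (Suc k)
    have "Ck_on k (\<lambda>y. q' (r y)) V"
      by (rule Ck_on_compose_real[OF J(4) open_UNIV]) (use q' Suc in \<open>auto simp: smooth_on_def\<close>)
    then have *: "Ck_on k (\<lambda>y. inverse (q' (r y))) V" using rN by (intro Ck_on_inverse[OF J(4)])
    show ?case by (rule Ck_on_real_SucI[OF J(4) _ *]) (rule dr)
  qed
  then show thesis using that[OF J(1,3,4,6)] by (simp add: smooth_on_def)
qed

text \<open>Since \<open>F\<close> separates, solving for \<open>c0\<close> takes only a
  one-variable inverse: the level set is locally the graph of \<open>r (- Q u)\<close>.
  \<open>\<Psi>\<close> rebuilds a point from its coordinates, and the left inverse \<open>c\<close>
  of \<open>\<phi>\<close> gives both the injective derivative and the homeomorphism.\<close>

lemma graph_parametrization: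
  fixes F :: "'a::euclidean_space \<Rightarrow> real" and c0 :: "'a \<Rightarrow> real" and c :: "'a \<Rightarrow> real^'n"
    and \<Psi> :: "real \<Rightarrow> real^'n \<Rightarrow> 'a" and Q :: "real^'n \<Rightarrow> real"
  assumes W: "open W" and z: "z \<in> W" "F z = 0"
    and c0: "\<And>w. c0 differentiable (at w)" and c: "\<And>w. c differentiable (at w)"
    and inv: "\<And>a u. c0 (\<Psi> a u) = a" "\<And>a u. c (\<Psi> a u) = u" "\<And>w. \<Psi> (c0 w) (c w) = w"
    and \<Psi>: "\<And>g S. open S \<Longrightarrow> smooth_on g S \<Longrightarrow> smooth_on (\<lambda>u. \<Psi> (g u) u) S"
    and F: "\<And>w. F w = q (c0 w) + Q (c w)" and Q: "smooth_on Q UNIV"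
    and q: "\<And>x. (q has_real_derivative q' x) (at x)" and q': "smooth_on q' UNIV" "q' (c0 z) \<noteq> 0"
  shows "\<exists>(U :: (real^'n) set) \<phi>. local_parametrization ({w. F w = 0} \<inter> W) U \<phi> \<and> z \<in> \<phi> ` U"
proof -
  obtain J V r where J: "open J" "c0 z \<in> J" and V: "open V" and hom: "homeomorphism J V q r"
    and r: "smooth_on r V" by (rule smooth_local_inverse[OF q q'])
  have rq: "r (q x) = x" "q x \<in> V" if "x \<in> J" for x using hom that by (auto simp: homeomorphism_def)
  have qr: "q (r y) = y" "r y \<in> J" if "y \<in> V" for y using hom that by (auto simp: homeomorphism_def)
  have mQ: "smooth_on (\<lambda>u. - Q u) UNIV"
    by (rule smooth_on_linear_image[OF open_UNIV bounded_linear_minus[OF bounded_linear_ident] Q])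
  define U1 where "U1 = {u. - Q u \<in> V}"
  have U1: "open U1"
    using continuous_open_preimage[OF smooth_on_imp_continuous_on[OF mQ] open_UNIV V]
    by (simp add: U1_def vimage_def)
  define \<phi> where "\<phi> u = \<Psi> (r (- Q u)) u" for u
  have \<phi>1: "smooth_on \<phi> U1"
    unfolding \<phi>_def[abs_def]
  proof (rule \<Psi>[OF U1])
    show "smooth_on (\<lambda>u. r (- Q u)) U1"
      by (rule smooth_on_compose_real[OF U1 V _ r smooth_on_subset[OF mQ]]) (auto simp: U1_def)
  qed
  define U where "U = U1 \<inter> \<phi> -` W"
  have U: "open U"
    unfolding U_def by (rule continuous_open_preimage[OF smooth_on_imp_continuous_on[OF \<phi>1] U1 W])
  have \<phi>: "smooth_on \<phi> U" by (rule smooth_on_subset[OF \<phi>1]) (simp add: U_def)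
  have c\<phi>: "c (\<phi> u) = u" for u by (simp add: \<phi>_def inv)
  have c0c: "continuous_on UNIV c0" "continuous_on UNIV c"
    using c0 c by (auto intro!: differentiable_imp_continuous_on simp: differentiable_on_def differentiable_at_withinI)
  have W': "open (c0 -` J)" using continuous_open_preimage[OF c0c(1) open_UNIV J(1)] by simp
  have image: "\<phi> ` U = ({w. F w = 0} \<inter> W) \<inter> c0 -` J"
  proof (intro equalityI subsetI)
    fix w assume "w \<in> \<phi> ` U"
    then obtain u where u: "u \<in> U" "w = \<phi> u" by blast
    then have V: "- Q u \<in> V" by (simp add: U_def U1_def)
    have "c0 w = r (- Q u)" "c w = u" using u by (simp_all add: \<phi>_def inv)
    then show "w \<in> ({w. F w = 0} \<inter> W) \<inter> c0 -` J" using u qr[OF V] by (simp add: F U_def)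
  next
    fix w assume w: "w \<in> ({w. F w = 0} \<inter> W) \<inter> c0 -` J"
    then have "q (c0 w) = - Q (c w)" by (simp add: F)
    then have V: "- Q (c w) \<in> V" "r (- Q (c w)) = c0 w" using rq[of "c0 w"] w by simp_all
    then have "\<phi> (c w) = w" by (simp add: \<phi>_def inv)
    then show "w \<in> \<phi> ` U" using V w by (intro image_eqI[of _ _ "c w"]) (auto simp: U_def U1_def)
  qed
  have inj: "inj (frechet_derivative \<phi> (at u))" if u: "u \<in> U" for u
  proof -
    have "((\<lambda>u. c (\<phi> u)) has_derivative
        (\<lambda>h. frechet_derivative c (at (\<phi> u)) (frechet_derivative \<phi> (at u) h))) (at u)"
      using smooth_on_differentiable[OF \<phi> U u] c unfolding frechet_derivative_works
      by (rule has_derivative_compose)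
    moreover have "((\<lambda>u. c (\<phi> u)) has_derivative (\<lambda>h. h)) (at u)" by (simp add: c\<phi>)
    ultimately have "(\<lambda>h. frechet_derivative c (at (\<phi> u)) (frechet_derivative \<phi> (at u) h)) = (\<lambda>h. h)"
      by (rule has_derivative_unique)
    then show ?thesis by (metis injI)
  qed
  have "homeomorphism U (\<phi> ` U) \<phi> c"
    by (rule homeomorphismI)
      (use smooth_on_imp_continuous_on[OF \<phi>] continuous_on_subset[OF c0c(2)] in \<open>auto simp: c\<phi>\<close>)
  then have "local_parametrization ({w. F w = 0} \<inter> W) U \<phi>"
    unfolding local_parametrization_def using U \<phi> inj image W' by blast
  moreover have "z \<in> \<phi> ` U" unfolding image using z J(2) by simp
  ultimately show ?thesis by blast
qed

section \<open>The regularized Hamiltonian\<close>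

text \<open>With \<open>E = -2 e\<close> and the sheared momenta \<open>Y\<close> below, twice the Hamiltonian is
  \<open>Y1^2 + Y2^2 + radial e x1 - angular e x2\<close>.\<close>

definition radial :: "real \<Rightarrow> real \<Rightarrow> real" where
  "radial e x = e * (cosh x)\<^sup>2 - cosh x - (cosh x)\<^sup>2 * ((cosh x)\<^sup>2 - 1) / 16"

definition radial1 :: "real \<Rightarrow> real \<Rightarrow> real" where
  "radial1 e x = sinh x * (2 * e * cosh x - 1 - (2 * cosh x ^ 3 - cosh x) / 8)"

definition radial2 :: "real \<Rightarrow> real \<Rightarrow> real" where
  "radial2 e x = 5 * (cosh x)\<^sup>2 - cosh x ^ 4 - cosh x - 17/8 + (e - 1) * (4 * (cosh x)\<^sup>2 - 2)"

definition angular :: "real \<Rightarrow> real \<Rightarrow> real" where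
  "angular e x = e * (cos x)\<^sup>2 + (cos x)\<^sup>2 * (1 - (cos x)\<^sup>2) / 16"

text \<open>Written with \<open>2 * (cos x)\<^sup>2 - 1\<close> for \<open>cos (2 * x)\<close> to
  match the variable \<open>K\<close> of \<open>tangential_form_pos\<close>.\<close>

definition angular1 :: "real \<Rightarrow> real \<Rightarrow> real" where
  "angular1 e x = - (sin (2 * x) * (e - (2 * (cos x)\<^sup>2 - 1) / 16))"

definition angular2 :: "real \<Rightarrow> real \<Rightarrow> real" where
  "angular2 e x = - 2 * e * (2 * (cos x)\<^sup>2 - 1) + (2 * (2 * (cos x)\<^sup>2 - 1)\<^sup>2 - 1) / 8"

definition Y1 :: "phase_space \<Rightarrow> real" where
  "Y1 z = fst (fst z) + sin (2 * snd (snd z)) / 8"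

definition Y2 :: "phase_space \<Rightarrow> real" where
  "Y2 z = snd (fst z) + sinh (2 * fst (snd z)) / 8"

definition unshear :: "real \<Rightarrow> real \<Rightarrow> real \<Rightarrow> real \<Rightarrow> phase_space" where
  "unshear a b x t = ((a - sin (2 * t) / 8, b - sinh (2 * x) / 8), (x, t))"

lemma unshear_simps [simp]:
  "Y1 (unshear a b x t) = a" "Y2 (unshear a b x t) = b"
  "fst (snd (unshear a b x t)) = x" "snd (snd (unshear a b x t)) = t"
  "unshear (Y1 z) (Y2 z) (fst (snd z)) (snd (snd z)) = z"
  by (simp_all add: Y1_def Y2_def unshear_def)

lemma V_eq: "V (- 2 * e) (x1, x2) = (radial e x1 - angular e x2) / 2"
proof -
  have 1: "(sinh (2 * x1))\<^sup>2 = 4 * ((cosh x1)\<^sup>2 * ((cosh x1)\<^sup>2 - 1))"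
    by (simp add: sinh_double power_mult_distrib sinh_square_eq)
  have 2: "(sin (2 * x2))\<^sup>2 = 4 * ((cos x2)\<^sup>2 * (1 - (cos x2)\<^sup>2))"
    by (simp add: sin_double power_mult_distrib sin_squared_eq)
  show ?thesis unfolding V_def split 1 2 radial_def angular_def by (simp add: field_simps)
qed

lemma regularized_H_sheared:
  "regularized_H (- 2 * e) z
    = ((Y1 z)\<^sup>2 + (Y2 z)\<^sup>2 + radial e (fst (snd z)) - angular e (snd (snd z))) / 2"
proof -
  obtain y1 y2 x1 x2 where z: "z = ((y1, y2), (x1, x2))" by (metis prod.collapse)
  show ?thesis unfolding z regularized_H_def split V_eq by (simp add: Y1_def Y2_def field_simps)
qed

lemma has_real_derivative_radial: "(radial e has_real_derivative radial1 e x) (at x)"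
  unfolding radial_def[abs_def] radial1_def
  by (auto intro!: derivative_eq_intros) (simp add: eval_nat_numeral field_simps)

lemma has_real_derivative_radial1: "(radial1 e has_real_derivative radial2 e x) (at x)"
proof -
  have "(radial1 e has_real_derivative cosh x * (2 * e * cosh x - 1 - (2 * cosh x ^ 3 - cosh x) / 8)
      + (sinh x)\<^sup>2 * (2 * e - (6 * (cosh x)\<^sup>2 - 1) / 8)) (at x)"
    unfolding radial1_def[abs_def]
    by (auto intro!: derivative_eq_intros) (simp add: eval_nat_numeral field_simps)
  moreover have "cosh x * (2 * e * cosh x - 1 - (2 * cosh x ^ 3 - cosh x) / 8)
      + (sinh x)\<^sup>2 * (2 * e - (6 * (cosh x)\<^sup>2 - 1) / 8) = radial2 e x"
    unfolding radial2_def sinh_square_eq by (simp add: eval_nat_numeral field_simps)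
  ultimately show ?thesis by simp
qed

lemma has_real_derivative_angular: "(angular e has_real_derivative angular1 e x) (at x)"
proof -
  have "(angular e has_real_derivative - 2 * cos x * sin x * (e + (1 - (cos x)\<^sup>2) / 16 - (cos x)\<^sup>2 / 16)) (at x)"
    unfolding angular_def[abs_def]
    by (auto intro!: derivative_eq_intros) (simp add: eval_nat_numeral field_simps)
  moreover have "- 2 * cos x * sin x * (e + (1 - (cos x)\<^sup>2) / 16 - (cos x)\<^sup>2 / 16) = angular1 e x"
    unfolding angular1_def sin_double by (simp add: eval_nat_numeral field_simps)
  ultimately show ?thesis by simp
qed

lemma has_real_derivative_angular1: "(angular1 e has_real_derivative angular2 e x) (at x)"
proof -
  have k: "2 * (cos x)\<^sup>2 - 1 = cos (2 * x)" by (simp add: cos_double_cos)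
  have s: "(sin (2 * x))\<^sup>2 = 1 - (cos (2 * x))\<^sup>2" by (simp add: sin_squared_eq)
  have f: "angular1 e = (\<lambda>x. - (sin (2 * x) * (e - cos (2 * x) / 16)))"
    by (simp add: angular1_def cos_double_cos fun_eq_iff)
  have "(angular1 e has_real_derivative
      - (2 * cos (2 * x) * (e - cos (2 * x) / 16) + (sin (2 * x))\<^sup>2 / 8)) (at x)"
    unfolding f by (auto intro!: derivative_eq_intros) (simp add: power2_eq_square field_simps)
  moreover have "- (2 * cos (2 * x) * (e - cos (2 * x) / 16) + (sin (2 * x))\<^sup>2 / 8) = angular2 e x"
    unfolding s angular2_def k by (simp add: power2_eq_square field_simps)
  ultimately show ?thesis by simp
qed

definition gradient :: "real \<Rightarrow> phase_space \<Rightarrow> phase_space" where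
  "gradient e z = ((Y1 z, Y2 z),
     (Y2 z * cosh (2 * fst (snd z)) / 4 + radial1 e (fst (snd z)) / 2,
      Y1 z * cos (2 * snd (snd z)) / 4 - angular1 e (snd (snd z)) / 2))"

definition DY1 :: "phase_space \<Rightarrow> phase_space \<Rightarrow> real" where
  "DY1 z h = fst (fst h) + snd (snd h) * cos (2 * snd (snd z)) / 4"

definition DY2 :: "phase_space \<Rightarrow> phase_space \<Rightarrow> real" where
  "DY2 z h = snd (fst h) + fst (snd h) * cosh (2 * fst (snd z)) / 4"

text \<open>The terms in \<open>Y1 z\<close> and \<open>Y2 z\<close> come from the second
  derivatives of the shear; they are the terms of indefinite sign.\<close>

definition hessian :: "real \<Rightarrow> phase_space \<Rightarrow> phase_space \<Rightarrow> phase_space" where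
  "hessian e z h = ((DY1 z h, DY2 z h),
     (DY2 z h * cosh (2 * fst (snd z)) / 4 + Y2 z * (fst (snd h) * sinh (2 * fst (snd z))) / 2
        + fst (snd h) * radial2 e (fst (snd z)) / 2,
      DY1 z h * cos (2 * snd (snd z)) / 4 - Y1 z * (snd (snd h) * sin (2 * snd (snd z))) / 2
        - snd (snd h) * angular2 e (snd (snd z)) / 2))"

lemma has_derivative_coordinates:
  "((\<lambda>z::phase_space. fst (fst z)) has_derivative (\<lambda>h. fst (fst h))) (at z)"
  "((\<lambda>z::phase_space. snd (fst z)) has_derivative (\<lambda>h. snd (fst h))) (at z)"
  "((\<lambda>z::phase_space. fst (snd z)) has_derivative (\<lambda>h. fst (snd h))) (at z)"
  "((\<lambda>z::phase_space. snd (snd z)) has_derivative (\<lambda>h. snd (snd h))) (at z)"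
  by (auto intro!: derivative_eq_intros)

lemmas has_derivative_radial_coordinate = DERIV_compose_FDERIV[OF _ has_derivative_coordinates(3)]
  and has_derivative_angular_coordinate = DERIV_compose_FDERIV[OF _ has_derivative_coordinates(4)]

lemma has_real_derivative_double:
  "((\<lambda>x. sin (2 * x)) has_real_derivative 2 * cos (2 * x)) (at x)"
  "((\<lambda>x. cos (2 * x)) has_real_derivative - (2 * sin (2 * x))) (at x)"
  "((\<lambda>x. sinh (2 * x)) has_real_derivative 2 * cosh (2 * x)) (at x)"
  "((\<lambda>x. cosh (2 * x)) has_real_derivative 2 * sinh (2 * x)) (at x)"
  by (auto intro!: derivative_eq_intros)

lemma has_derivative_Y: "(Y1 has_derivative DY1 z) (at z)" "(Y2 has_derivative DY2 z) (at z)"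
proof -
  note s = has_derivative_angular_coordinate[OF has_real_derivative_double(1), of z]
  note h = has_derivative_radial_coordinate[OF has_real_derivative_double(3), of z]
  have "((\<lambda>z. fst (fst z) + 1/8 * sin (2 * snd (snd z))) has_derivative
      (\<lambda>h. fst (fst h) + 1/8 * (snd (snd h) * (2 * cos (2 * snd (snd z)))))) (at z)"
    by (intro has_derivative_add has_derivative_coordinates has_derivative_mult_right s)
  then show "(Y1 has_derivative DY1 z) (at z)" by (simp add: Y1_def[abs_def] DY1_def[abs_def])
  have "((\<lambda>z. snd (fst z) + 1/8 * sinh (2 * fst (snd z))) has_derivative
      (\<lambda>h. snd (fst h) + 1/8 * (fst (snd h) * (2 * cosh (2 * fst (snd z)))))) (at z)"
    by (intro has_derivative_add has_derivative_coordinates has_derivative_mult_right h)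
  then show "(Y2 has_derivative DY2 z) (at z)" by (simp add: Y2_def[abs_def] DY2_def[abs_def])
qed

lemma has_derivative_regularized_H:
  "(regularized_H (- 2 * e) has_derivative (\<lambda>h. gradient e z \<bullet> h)) (at z)"
proof -
  note Y = has_derivative_Y[of z]
  have f: "regularized_H (- 2 * e)
      = (\<lambda>z. 1/2 * (Y1 z * Y1 z + Y2 z * Y2 z + radial e (fst (snd z)) - angular e (snd (snd z))))"
    unfolding regularized_H_sheared[abs_def] by (simp add: power2_eq_square)
  have g: "(\<lambda>h. gradient e z \<bullet> h)
      = (\<lambda>h. 1/2 * (Y1 z * DY1 z h + DY1 z h * Y1 z + (Y2 z * DY2 z h + DY2 z h * Y2 z)
          + fst (snd h) * radial1 e (fst (snd z)) - snd (snd h) * angular1 e (snd (snd z))))"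
    by (rule ext) (simp add: gradient_def DY1_def DY2_def inner_prod_def field_simps)
  show ?thesis
    unfolding f g
    by (intro has_derivative_mult_right has_derivative_diff has_derivative_add has_derivative_mult Y
        has_derivative_radial_coordinate has_derivative_angular_coordinate
        has_real_derivative_radial has_real_derivative_angular)
qed

lemma has_derivative_gradient: "(gradient e has_derivative hessian e z) (at z)"
proof -
  note Y = has_derivative_Y[of z]
  have f: "gradient e = (\<lambda>z. ((Y1 z, Y2 z),
      (1/4 * (Y2 z * cosh (2 * fst (snd z))) + 1/2 * radial1 e (fst (snd z)),
       1/4 * (Y1 z * cos (2 * snd (snd z))) - 1/2 * angular1 e (snd (snd z)))))"
    by (simp add: gradient_def[abs_def])
  have g: "hessian e z = (\<lambda>h. ((DY1 z h, DY2 z h),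
      (1/4 * (Y2 z * (fst (snd h) * (2 * sinh (2 * fst (snd z)))) + DY2 z h * cosh (2 * fst (snd z)))
        + 1/2 * (fst (snd h) * radial2 e (fst (snd z))),
       1/4 * (Y1 z * (snd (snd h) * - (2 * sin (2 * snd (snd z)))) + DY1 z h * cos (2 * snd (snd z)))
        - 1/2 * (snd (snd h) * angular2 e (snd (snd z))))))"
    by (rule ext) (simp add: hessian_def field_simps)
  show ?thesis
    unfolding f g
    by (intro has_derivative_Pair has_derivative_mult_right has_derivative_diff has_derivative_add
        has_derivative_mult Y has_derivative_radial_coordinate[OF has_real_derivative_double(4)]
        has_derivative_angular_coordinate[OF has_real_derivative_double(2)]
        has_derivative_radial_coordinate[OF has_real_derivative_radial1]
        has_derivative_angular_coordinate[OF has_real_derivative_angular1])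
qed

text \<open>Passing from \<open>h\<close> to \<open>DY1 z h\<close>, \<open>DY2 z h\<close> and the
  two position components is an invertible linear change, so a nonzero tangent vector gives nonzero
  data for \<open>tangential_form_pos\<close>. There \<open>b\<close> is the \<open>x1\<close>
  component and \<open>a\<close> the \<open>x2\<close> component.\<close>

lemma hessian_tangential_pos:
  assumes e: "e \<ge> 1" and c: "cos (snd (snd z)) \<noteq> 0" and u: "cosh (fst (snd z)) \<le> 2"
    and F: "regularized_H (- 2 * e) z = 0" and h: "h \<noteq> 0" and t: "gradient e z \<bullet> h = 0"
  shows "hessian e z h \<bullet> h > 0"
proof -
  obtain v1 v2 b a where hh: "h = ((v1, v2), (b, a))" by (metis prod.collapse)
  let ?x = "fst (snd z)" and ?t = "snd (snd z)"
  let ?K = "(cos ?t)\<^sup>2" and ?u = "cosh ?x"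
  have K: "0 < ?K" "?K \<le> 1" using c by (auto simp: abs_square_le_1)
  have \<sigma>: "(sin (2 * ?t))\<^sup>2 = 4 * ?K * (1 - ?K)"
    by (simp add: sin_double power_mult_distrib sin_squared_eq)
  have s: "(sinh ?x)\<^sup>2 = ?u\<^sup>2 - 1" by (rule sinh_square_eq)
  have F': "(e * ?u\<^sup>2 - ?u - ?u\<^sup>2 * (?u\<^sup>2 - 1) / 16) + (Y2 z)\<^sup>2
      = (e * ?K + ?K * (1 - ?K) / 16) - (Y1 z)\<^sup>2"
    using F unfolding regularized_H_sheared radial_def angular_def by simp
  have t': "Y1 z * DY1 z h - - (sin (2 * ?t) * (e - (2 * ?K - 1) / 16)) * a / 2 + Y2 z * DY2 z h
      + sinh ?x * (2 * e * ?u - 1 - (2 * ?u ^ 3 - ?u) / 8) * b / 2 = 0"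
    using t unfolding gradient_def angular1_def[symmetric] radial1_def[symmetric]
    by (simp add: hh inner_prod_def DY1_def DY2_def algebra_simps)
  have nz: "DY1 z h \<noteq> 0 \<or> DY2 z h \<noteq> 0 \<or> a \<noteq> 0 \<or> b \<noteq> 0"
    using h by (auto simp: hh DY1_def DY2_def zero_prod_def)
  have "hessian e z h \<bullet> h = (DY1 z h)\<^sup>2 - (angular2 e ?t + Y1 z * sin (2 * ?t)) * a\<^sup>2 / 2
      + (DY2 z h)\<^sup>2 + (radial2 e ?x + 2 * Y2 z * sinh ?x * ?u) * b\<^sup>2 / 2"
    unfolding hessian_def
    by (simp add: hh inner_prod_def DY1_def DY2_def sinh_double power2_eq_square field_simps)
  also have "\<dots> > 0"
    unfolding angular2_def radial2_def
    by (rule tangential_form_pos[OF e K \<sigma> cosh_real_ge_1 u s F' t' nz])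
  finally show ?thesis .
qed

section \<open>Monotonicity of the potentials\<close>

lemma angular_le: "e \<ge> 1 \<Longrightarrow> angular e x \<le> e"
proof -
  assume e: "e \<ge> 1"
  have "(cos x)\<^sup>2 \<le> 1" by (simp add: abs_square_le_1)
  then have "(1 - (cos x)\<^sup>2) * ((cos x)\<^sup>2 / 16) \<le> (1 - (cos x)\<^sup>2) * e"
    using e by (intro mult_left_mono) auto
  then show ?thesis by (simp add: angular_def algebra_simps)
qed

lemma radial_0: "radial e 0 = e - 1" by (simp add: radial_def)

text \<open>The divided difference in \<open>cosh\<close> is at least
  \<open>9/16 * (u + v) - 1\<close>, where \<open>u + v > 2\<close>.\<close>

lemma radial_less_of_cosh_less:
  assumes e: "e \<ge> 1" and xy: "cosh x < cosh y" "cosh y \<le> 2"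
  shows "radial e x < radial e y"
proof -
  define u v where "u = cosh x" and "v = cosh y"
  have uv: "1 \<le> u" "u < v" "v \<le> 2" using xy by (auto simp: u_def v_def cosh_real_ge_1)
  have sq: "u * u \<le> 4" "v * v \<le> 4" using uv mult_mono[of u 2 u 2] mult_mono[of v 2 v 2] by auto
  have "radial e y - radial e x = (v - u) * (e * (u + v) - 1 - (u + v) * (u * u + v * v - 1) / 16)"
    unfolding radial_def u_def[symmetric] v_def[symmetric] by (simp add: power2_eq_square field_simps)
  moreover have "e * (u + v) - 1 - (u + v) * (u * u + v * v - 1) / 16 > 0"
  proof -
    have "(u + v) * (u * u + v * v - 1) \<le> (u + v) * 7" using sq uv by (intro mult_left_mono) auto
    moreover have "1 * (u + v) \<le> e * (u + v)" using e uv by (intro mult_right_mono) auto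
    ultimately show ?thesis using uv by argo
  qed
  ultimately show ?thesis using uv by (metis diff_gt_0_iff_gt mult_pos_pos)
qed

lemma cosh_less_iff_abs: "cosh (x::real) < cosh y \<longleftrightarrow> \<bar>x\<bar> < \<bar>y\<bar>"
  using cosh_real_nonneg_less_iff[of "\<bar>x\<bar>" "\<bar>y\<bar>"] by simp

lemma angular_less:
  assumes "e \<ge> 1" and "\<bar>s\<bar> < \<bar>t\<bar>" "\<bar>t\<bar> \<le> pi / 2"
  shows "angular e t < angular e s"
proof -
  define k l where "k = (cos t)\<^sup>2" and "l = (cos s)\<^sup>2"
  have "cos \<bar>t\<bar> < cos \<bar>s\<bar>" using assms by (intro cos_monotone_0_pi) auto
  moreover have "cos \<bar>t\<bar> \<ge> 0" using assms by (intro cos_ge_zero) auto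
  ultimately have "(cos \<bar>t\<bar>)\<^sup>2 < (cos \<bar>s\<bar>)\<^sup>2" by (intro power_strict_mono) auto
  then have kl: "k < l" by (simp add: k_def l_def)
  have b: "k \<ge> 0" "l \<le> 1" by (auto simp: k_def l_def abs_square_le_1)
  have "angular e s - angular e t = (l - k) * (e + (1 - k - l) / 16)"
    unfolding angular_def k_def[symmetric] l_def[symmetric] by (simp add: field_simps)
  moreover have "e + (1 - k - l) / 16 > 0" using assms(1) b kl by argo
  ultimately show ?thesis using kl by (metis diff_gt_0_iff_gt mult_pos_pos)
qed

text \<open>Each summand is monotone along rays from the origin, hence sublevel sets are star-shaped
  in the sheared coordinates.\<close>

lemma sheared_energy_scaled:
  assumes e: "e \<ge> 1" and x: "cosh x \<le> 2" and t: "\<bar>t\<bar> \<le> pi / 2" and r: "0 \<le> r" "r < 1"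
    and nz: "a \<noteq> 0 \<or> b \<noteq> 0 \<or> x \<noteq> 0 \<or> t \<noteq> 0"
  shows "(r * a)\<^sup>2 + (r * b)\<^sup>2 + radial e (r * x) - angular e (r * t)
    < a\<^sup>2 + b\<^sup>2 + radial e x - angular e t"
proof -
  have r2: "r\<^sup>2 < 1" using r by (simp add: abs_square_less_1)
  have sq: "(r * a)\<^sup>2 \<le> a\<^sup>2" "a \<noteq> 0 \<Longrightarrow> (r * a)\<^sup>2 < a\<^sup>2" for a
    using r2 by (auto simp: power_mult_distrib mult_left_le_one_le)
  have ab: "\<bar>r * s\<bar> < \<bar>s\<bar>" if "s \<noteq> 0" for s using r that by (simp add: abs_mult)
  have rx: "radial e (r * x) < radial e x" if "x \<noteq> 0"
    by (rule radial_less_of_cosh_less[OF e _ x]) (simp add: cosh_less_iff_abs ab[OF that])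
  have at: "angular e t < angular e (r * t)" if "t \<noteq> 0"
    by (rule angular_less[OF e ab[OF that] t])
  have "radial e (r * x) \<le> radial e x" using rx by (cases "x = 0") auto
  moreover have "angular e t \<le> angular e (r * t)" using at by (cases "t = 0") auto
  ultimately show ?thesis using nz rx at sq(1)[of a] sq(1)[of b] sq(2)[of a] sq(2)[of b] by argo
qed

section \<open>Convexity\<close>

text \<open>Along a segment on which \<open>F\<close> is nonpositive, \<open>F\<close> cannot vanish at an interior point: it would
  have a maximum there, and a strict minimum by the sign of the tangential Hessian.\<close>

lemma segment_in_negative_sublevel:
  fixes F :: "'a::euclidean_space \<Rightarrow> real"
  assumes W: "convex W" "p \<in> W" "q \<in> W"
    and grad: "\<And>z. (F has_derivative (\<lambda>h. \<nu> z \<bullet> h)) (at z)"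
    and hess: "\<And>z. (\<nu> has_derivative D z) (at z)"
    and pos: "\<And>z h. z \<in> W \<Longrightarrow> F z = 0 \<Longrightarrow> h \<noteq> 0 \<Longrightarrow> \<nu> z \<bullet> h = 0 \<Longrightarrow> D z h \<bullet> h > 0"
    and ends: "F p < 0" "F q < 0"
    and le: "\<And>t. 0 \<le> t \<Longrightarrow> t \<le> 1 \<Longrightarrow> F (p + t *\<^sub>R (q - p)) \<le> 0"
    and t: "0 \<le> t" "t \<le> 1"
  shows "F (p + t *\<^sub>R (q - p)) < 0"
proof (rule ccontr)
  define \<gamma> where "\<gamma> t = p + t *\<^sub>R (q - p)" for t
  assume "\<not> F (p + t *\<^sub>R (q - p)) < 0"
  then have F0: "F (\<gamma> t) = 0" using le[OF t] by (simp add: \<gamma>_def)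
  have "\<gamma> 0 = p" "\<gamma> 1 = q" by (simp_all add: \<gamma>_def)
  then have "t \<noteq> 0" "t \<noteq> 1" using F0 ends by auto
  then have t': "0 < t" "t < 1" using t by auto
  have qp: "q - p \<noteq> 0" using F0 ends by (auto simp: \<gamma>_def)
  have "\<gamma> t = (1 - t) *\<^sub>R p + t *\<^sub>R q" by (simp add: \<gamma>_def algebra_simps)
  then have \<gamma>W: "\<gamma> t \<in> W" using W t by (simp add: convexD)
  have d1: "((\<lambda>s. F (\<gamma> s)) has_real_derivative \<nu> (\<gamma> s) \<bullet> (q - p)) (at s)" for s
    unfolding \<gamma>_def has_field_derivative_def
    using has_derivative_along_line[OF grad, where p = p and s = s and v = "q - p" and X = UNIV] by (simp add: mult_commute_abs)
  have d2: "((\<lambda>s. \<nu> (\<gamma> s) \<bullet> (q - p)) has_real_derivative D (\<gamma> t) (q - p) \<bullet> (q - p)) (at t)"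
  proof -
    have "((\<lambda>s. \<nu> (\<gamma> s)) has_derivative (\<lambda>r. D (\<gamma> t) (r *\<^sub>R (q - p)))) (at t)"
      unfolding \<gamma>_def by (rule has_derivative_along_line[OF hess])
    then have "((\<lambda>s. \<nu> (\<gamma> s) \<bullet> (q - p)) has_derivative (\<lambda>r. D (\<gamma> t) (r *\<^sub>R (q - p)) \<bullet> (q - p))) (at t)"
      by (rule has_derivative_inner_left)
    moreover have "D (\<gamma> t) (r *\<^sub>R (q - p)) = r *\<^sub>R D (\<gamma> t) (q - p)" for r
      by (rule linear_scale[OF has_derivative_linear[OF hess]])
    ultimately show ?thesis by (simp add: has_field_derivative_def mult_commute_abs)
  qed
  define d where "d = min t (1 - t)"
  have d: "d > 0" using t' by (simp add: d_def)
  have max: "F (\<gamma> s) \<le> F (\<gamma> t)" if "\<bar>t - s\<bar> < d" for s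
    using le[of s] that F0 by (auto simp: \<gamma>_def d_def)
  have crit: "\<nu> (\<gamma> t) \<bullet> (q - p) = 0"
    by (rule DERIV_local_max[OF d1 d]) (use max in blast)
  have "D (\<gamma> t) (q - p) \<bullet> (q - p) > 0" by (rule pos[OF \<gamma>W F0 qp crit])
  then obtain d' where d': "d' > 0" "\<And>h. 0 < h \<Longrightarrow> h < d' \<Longrightarrow> 0 < \<nu> (\<gamma> (t + h)) \<bullet> (q - p)"
    using DERIV_pos_inc_right[OF d2] unfolding crit by blast
  define h where "h = min d d' / 2"
  have h: "0 < h" "h < d" "h < d'" using d d' by (auto simp: h_def)
  have "F (\<gamma> t) < F (\<gamma> (t + h))"
  proof (rule DERIV_pos_imp_increasing_open[where f = "\<lambda>s. F (\<gamma> s)"])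
    show "\<exists>y. ((\<lambda>s. F (\<gamma> s)) has_real_derivative y) (at x) \<and> 0 < y" if "t < x" "x < t + h" for x
      using d1[of x] d'(2)[of "x - t"] that h by auto
    show "continuous_on {t..t + h} (\<lambda>s. F (\<gamma> s))"
      by (rule DERIV_continuous_on[where D = "\<lambda>s. \<nu> (\<gamma> s) \<bullet> (q - p)"]) (use d1 in \<open>auto intro: has_field_derivative_at_within\<close>)
  qed (use h in simp)
  then show False using max[of "t + h"] h by simp
qed

lemma convex_negative_sublevel:
  fixes F :: "'a::euclidean_space \<Rightarrow> real"
  assumes W: "convex W" "open W"
    and grad: "\<And>z. (F has_derivative (\<lambda>h. \<nu> z \<bullet> h)) (at z)"
    and hess: "\<And>z. (\<nu> has_derivative D z) (at z)"
    and pos: "\<And>z h. z \<in> W \<Longrightarrow> F z = 0 \<Longrightarrow> h \<noteq> 0 \<Longrightarrow> \<nu> z \<bullet> h = 0 \<Longrightarrow> D z h \<bullet> h > 0"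
    and conn: "connected {z \<in> W. F z < 0}"
  shows "convex {z \<in> W. F z < 0}"
proof -
  let ?U = "{z \<in> W. F z < 0}"
  have cF: "continuous_on UNIV F"
    using grad by (auto intro!: continuous_at_imp_continuous_on has_derivative_continuous)
  have "?U = W \<inter> F -` {..<0}" by auto
  also have "open \<dots>" by (rule continuous_open_preimage[OF continuous_on_subset[OF cF] W(2)]) auto
  finally have oU: "open ?U" .
  have seg: "closed_segment p q = (\<lambda>t. p + t *\<^sub>R (q - p)) ` {0..1}" for p q :: 'a
    by (simp add: closed_segment_image_interval algebra_simps)
  have "closed_segment p q \<subseteq> ?U" if p: "p \<in> ?U" and q: "q \<in> ?U" for p q
  proof -
    define A where "A = {q \<in> ?U. closed_segment p q \<subseteq> ?U}"
    \<comment> \<open>With \<open>\<le>\<close> in place of \<open><\<close> the set is visibly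
      relatively closed; \<open>segment_in_negative_sublevel\<close> restores the strict
      inequality.\<close>
    have A_eq: "A = ?U \<inter> (\<Inter>t\<in>{0..1}. {q. F (p + t *\<^sub>R (q - p)) \<le> 0})"
    proof (intro equalityI subsetI)
      fix q assume "q \<in> A"
      then have "q \<in> ?U" and s: "(\<lambda>t. p + t *\<^sub>R (q - p)) ` {0..1} \<subseteq> ?U" unfolding A_def seg by auto
      then show "q \<in> ?U \<inter> (\<Inter>t\<in>{0..1}. {q. F (p + t *\<^sub>R (q - p)) \<le> 0})"
        by (fastforce intro: less_imp_le)
    next
      fix q assume q: "q \<in> ?U \<inter> (\<Inter>t\<in>{0..1}. {q. F (p + t *\<^sub>R (q - p)) \<le> 0})"
      have "F (p + t *\<^sub>R (q - p)) < 0" if "0 \<le> t" "t \<le> 1" for t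
        by (rule segment_in_negative_sublevel[OF W(1) _ _ grad hess pos _ _ _ that]) (use p q in auto)
      moreover have "p + t *\<^sub>R (q - p) \<in> W" if "0 \<le> t" "t \<le> 1" for t
        using convexD[OF W(1), of p q "1 - t" t] p q that by (simp add: algebra_simps)
      ultimately show "q \<in> A" using q unfolding A_def seg by auto
    qed
    have "closed {q. F (p + t *\<^sub>R (q - p)) \<le> 0}" for t
      by (intro closed_Collect_le continuous_on_compose2[OF cF] continuous_intros) auto
    then have cl: "closedin (top_of_set ?U) A"
      unfolding A_eq by (intro closedin_closed_Int closed_INT) auto
    have "open A"
      unfolding open_contains_ball
    proof
      fix q assume "q \<in> A"
      then have q: "closed_segment p q \<subseteq> ?U" by (simp add: A_def)
      \<comment> \<open>Compactness of the segment gives a tube of uniform radius; moving the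
        endpoint \<open>q\<close> by less than \<open>r\<close> moves every point of the segment by
        less than \<open>r\<close>.\<close>
      obtain r where r: "r > 0" "(\<Union>x\<in>closed_segment p q. ball x r) \<subseteq> ?U"
        using compact_subset_open_imp_ball_epsilon_subset[OF compact_segment oU q] by blast
      have "ball q r \<subseteq> A"
      proof
        fix q' assume q': "q' \<in> ball q r"
        have "p + t *\<^sub>R (q' - p) \<in> ?U" if t: "0 \<le> t" "t \<le> 1" for t
        proof -
          have "dist (p + t *\<^sub>R (q - p)) (p + t *\<^sub>R (q' - p)) = t * dist q q'"
            using t by (simp add: dist_norm scaleR_diff_right[symmetric])
          also have "\<dots> \<le> dist q q'" using t by (simp add: mult_left_le_one_le)
          also have "\<dots> < r" using q' by simp
          finally have "p + t *\<^sub>R (q' - p) \<in> ball (p + t *\<^sub>R (q - p)) r" by simp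
          moreover have "p + t *\<^sub>R (q - p) \<in> closed_segment p q" using t by (auto simp: seg)
          ultimately show ?thesis using r(2) by blast
        qed
        then have "closed_segment p q' \<subseteq> ?U" by (auto simp: seg)
        then show "q' \<in> A" unfolding A_def using ends_in_segment(2)[of q' p] by blast
      qed
      then show "\<exists>r>0. ball q r \<subseteq> A" using r(1) by blast
    qed
    moreover have "A \<subseteq> ?U" by (auto simp: A_def)
    ultimately have op: "openin (top_of_set ?U) A" using openin_open_eq[OF oU] by blast
    have "p \<in> A" using p by (simp add: A_def)
    then have "A = ?U" using conn cl op unfolding connected_clopen by blast
    then show ?thesis using q by (auto simp: A_def)
  qed
  then show ?thesis by (simp add: convex_contains_segment)
qed

lemma frontier_of_closure_convex_open:
  fixes U :: "'a::euclidean_space set"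
  assumes "convex U" "open U"
  shows "frontier (closure U) = closure U - U"
  unfolding frontier_def closure_closure convex_interior_closure[OF assms(1)] interior_open[OF assms(2)] ..

section \<open>Charts of the zero level\<close>

lemma smooth_on_potentials:
  "smooth_on (radial e) UNIV" "smooth_on (radial1 e) UNIV"
  "smooth_on (angular e) UNIV" "smooth_on (angular1 e) UNIV"
proof -
  note smooth = smooth_on_add[OF open_UNIV] smooth_on_mult[OF open_UNIV] smooth_on_const smooth_on_elementary
  have *: "radial e = (\<lambda>x. e * (cosh x * cosh x) + (- 1 * cosh x + (- 1/16) * ((cosh x * cosh x) * (cosh x * cosh x + - 1))))"
    by (simp add: radial_def fun_eq_iff power2_eq_square)
  show "smooth_on (radial e) UNIV" unfolding * by (intro smooth)
  have *: "radial1 e = (\<lambda>x. sinh x * ((2 * e) * cosh x + (- 1 + ((- 1/4) * (cosh x * (cosh x * cosh x)) + 1/8 * cosh x))))"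
    by (simp add: radial1_def fun_eq_iff eval_nat_numeral field_simps)
  show "smooth_on (radial1 e) UNIV" unfolding * by (intro smooth)
  have *: "angular e = (\<lambda>x. e * (cos x * cos x) + 1/16 * ((cos x * cos x) * (1 + - 1 * (cos x * cos x))))"
    by (simp add: angular_def fun_eq_iff power2_eq_square)
  show "smooth_on (angular e) UNIV" unfolding * by (intro smooth)
  have *: "angular1 e = (\<lambda>x. (- 2) * ((sin x * cos x) * (e + (- 1/16) * (2 * (cos x * cos x) + - 1))))"
    unfolding angular1_def[abs_def] sin_double by (simp add: fun_eq_iff power2_eq_square field_simps)
  show "smooth_on (angular1 e) UNIV" unfolding * by (intro smooth)
qed

lemma smooth_on_unshear:
  fixes a b x t :: "'a::euclidean_space \<Rightarrow> real"
  assumes S: "open S" and s: "smooth_on a S" "smooth_on b S" "smooth_on x S" "smooth_on t S"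
  shows "smooth_on (\<lambda>u. unshear (a u) (b u) (x u) (t u)) S"
proof -
  have 2: "smooth_on (\<lambda>u. 2 * f u) S" if "smooth_on f S" for f :: "'a \<Rightarrow> real"
    by (rule smooth_on_mult[OF S smooth_on_const that])
  have 1: "smooth_on (\<lambda>u. sin (2 * t u)) S" "smooth_on (\<lambda>u. sinh (2 * x u)) S"
    by (rule smooth_on_compose_real[OF S open_UNIV subset_UNIV smooth_on_elementary(1) 2[OF s(4)]],
        rule smooth_on_compose_real[OF S open_UNIV subset_UNIV smooth_on_elementary(3) 2[OF s(3)]])
  have "smooth_on (\<lambda>u. ((a u + (- 1/8) * sin (2 * t u), b u + (- 1/8) * sinh (2 * x u)), (x u, t u))) S"
    by (intro smooth_on_Pair[OF S] smooth_on_add[OF S] smooth_on_mult[OF S] smooth_on_const s 1)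
  then show ?thesis by (simp add: unshear_def)
qed

definition triple :: "real \<Rightarrow> real \<Rightarrow> real \<Rightarrow> real^3" where
  "triple a b c = a *\<^sub>R axis 1 1 + b *\<^sub>R axis 2 1 + c *\<^sub>R axis 3 1"

lemma triple_nth [simp]: "triple a b c $ 1 = a" "triple a b c $ 2 = b" "triple a b c $ 3 = c"
  by (simp_all add: triple_def axis_def)

lemma triple_eta [simp]: "triple (u $ 1) (u $ 2) (u $ 3) = u"
  by (simp add: vec_eq_iff forall_3)

lemma differentiable_triple:
  assumes "f differentiable (at w)" "g differentiable (at w)" "h differentiable (at w)"
  shows "(\<lambda>w. triple (f w) (g w) (h w)) differentiable (at w)"
proof -
  obtain f' g' h' where d: "(f has_derivative f') (at w)" "(g has_derivative g') (at w)" "(h has_derivative h') (at w)"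
    using assms unfolding differentiable_def by blast
  have "((\<lambda>w. triple (f w) (g w) (h w)) has_derivative (\<lambda>v. triple (f' v) (g' v) (h' v))) (at w)"
    unfolding triple_def by (intro has_derivative_add has_derivative_scaleR_left d)
  then show ?thesis by (rule differentiableI)
qed

lemma smooth_on_nth: "smooth_on (\<lambda>u::real^'n. u $ i) S"
  by (rule smooth_on_bounded_linear[OF bounded_linear_vec_nth])

text \<open>Twice the Hamiltonian is a sum of functions of single coordinates \<open>Y1\<close>,
  \<open>Y2\<close>, \<open>x1\<close>, \<open>x2\<close>, so the level set is a graph over three of
  them. If both sheared momenta vanish, the nonzero gradient leaves \<open>radial1\<close> or
  \<open>angular1\<close> nonzero.\<close>

lemma regularized_H_chart:
  assumes W: "open W" and z: "z \<in> W" "regularized_H (- 2 * e) z = 0" and ne: "gradient e z \<noteq> 0"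
  shows "\<exists>(U :: (real^3) set) \<phi>.
    local_parametrization ({w. regularized_H (- 2 * e) w = 0} \<inter> W) U \<phi> \<and> z \<in> \<phi> ` U"
proof -
  let ?X = "\<lambda>w::phase_space. fst (snd w)" and ?T = "\<lambda>w::phase_space. snd (snd w)"
  define F where "F w = (Y1 w)\<^sup>2 + (Y2 w)\<^sup>2 + radial e (?X w) - angular e (?T w)" for w
  have FH: "{w. regularized_H (- 2 * e) w = 0} = {w. F w = 0}"
    unfolding regularized_H_sheared F_def by auto
  have Fz: "F z = 0" using z(2) FH by blast
  have d: "Y1 differentiable (at w)" "Y2 differentiable (at w)" "?X differentiable (at w)" "?T differentiable (at w)" for w
    using has_derivative_Y[of w] has_derivative_coordinates[of w] unfolding differentiable_def by blast+
  have sq: "((\<lambda>x. x * x) has_real_derivative 2 * x) (at x)" for x :: real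
    by (auto intro!: derivative_eq_intros)
  have sq': "smooth_on (\<lambda>x::real. 2 * x) UNIV"
    by (intro smooth_on_mult[OF open_UNIV] smooth_on_const smooth_on_bounded_linear bounded_linear_ident)
  have neg: "((\<lambda>x. - angular e x) has_real_derivative - angular1 e x) (at x)" for x
    by (intro DERIV_minus has_real_derivative_angular)
  have neg': "smooth_on (\<lambda>x. - f x) UNIV" if "smooth_on f UNIV" for f :: "real \<Rightarrow> real"
    by (rule smooth_on_linear_image[OF open_UNIV bounded_linear_minus[OF bounded_linear_ident] that])
  have Q: "smooth_on (\<lambda>u::real^3. u $ i * u $ i) UNIV" "smooth_on (\<lambda>u::real^3. radial e (u $ i)) UNIV"
    "smooth_on (\<lambda>u::real^3. - angular e (u $ i)) UNIV" for i
    by (rule smooth_on_mult[OF open_UNIV smooth_on_nth smooth_on_nth],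
        rule smooth_on_compose_real[OF open_UNIV open_UNIV subset_UNIV smooth_on_potentials(1) smooth_on_nth],
        rule smooth_on_compose_real[OF open_UNIV open_UNIV subset_UNIV
          neg'[OF smooth_on_potentials(3)] smooth_on_nth])
  note q = sq sq' neg neg'[OF smooth_on_potentials(4)] has_real_derivative_radial smooth_on_potentials(2)
  consider "Y1 z \<noteq> 0" | "Y2 z \<noteq> 0" | "Y1 z = 0" "Y2 z = 0" "radial1 e (?X z) \<noteq> 0"
    | "Y1 z = 0" "Y2 z = 0" "angular1 e (?T z) \<noteq> 0"
    using ne by (cases "Y1 z = 0"; cases "Y2 z = 0"; cases "radial1 e (?X z) = 0")
      (auto simp: gradient_def zero_prod_def)
  then show ?thesis
    unfolding FH
  proof cases
    case 1
    show "\<exists>(U :: (real^3) set) \<phi>. local_parametrization ({w. F w = 0} \<inter> W) U \<phi> \<and> z \<in> \<phi> ` U"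
      by (rule graph_parametrization[where F = F and ?c0.0 = "Y1"
          and c = "\<lambda>w. triple (Y2 w) (?X w) (?T w)"
          and \<Psi> = "\<lambda>a u. unshear a (u $ 1) (u $ 2) (u $ 3)"
          and Q = "\<lambda>u. u $ 1 * u $ 1 + radial e (u $ 2) + - angular e (u $ 3)"
          and q = "\<lambda>x. x * x" and q' = "\<lambda>x. 2 * x"];
          (rule W z(1) Fz d q | (rule differentiable_triple; rule d) | (intro smooth_on_add[OF open_UNIV] Q)
            | (rule smooth_on_unshear; (assumption | rule smooth_on_nth)) | (simp add: F_def power2_eq_square 1)))
  next
    case 2
    show "\<exists>(U :: (real^3) set) \<phi>. local_parametrization ({w. F w = 0} \<inter> W) U \<phi> \<and> z \<in> \<phi> ` U"
      by (rule graph_parametrization[where F = F and ?c0.0 = "Y2"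
          and c = "\<lambda>w. triple (Y1 w) (?X w) (?T w)"
          and \<Psi> = "\<lambda>a u. unshear (u $ 1) a (u $ 2) (u $ 3)"
          and Q = "\<lambda>u. u $ 1 * u $ 1 + radial e (u $ 2) + - angular e (u $ 3)"
          and q = "\<lambda>x. x * x" and q' = "\<lambda>x. 2 * x"];
          (rule W z(1) Fz d q | (rule differentiable_triple; rule d) | (intro smooth_on_add[OF open_UNIV] Q)
            | (rule smooth_on_unshear; (assumption | rule smooth_on_nth)) | (simp add: F_def power2_eq_square 2)))
  next
    case 3
    show "\<exists>(U :: (real^3) set) \<phi>. local_parametrization ({w. F w = 0} \<inter> W) U \<phi> \<and> z \<in> \<phi> ` U"
      by (rule graph_parametrization[where F = F and ?c0.0 = "?X"
          and c = "\<lambda>w. triple (Y1 w) (Y2 w) (?T w)"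
          and \<Psi> = "\<lambda>a u. unshear (u $ 1) (u $ 2) a (u $ 3)"
          and Q = "\<lambda>u. u $ 1 * u $ 1 + u $ 2 * u $ 2 + - angular e (u $ 3)"
          and q = "radial e" and q' = "radial1 e"];
          (rule W z(1) Fz d q | (rule differentiable_triple; rule d) | (intro smooth_on_add[OF open_UNIV] Q)
            | (rule smooth_on_unshear; (assumption | rule smooth_on_nth)) | (simp add: F_def power2_eq_square 3)))
  next
    case 4
    show "\<exists>(U :: (real^3) set) \<phi>. local_parametrization ({w. F w = 0} \<inter> W) U \<phi> \<and> z \<in> \<phi> ` U"
      by (rule graph_parametrization[where F = F and ?c0.0 = "?T"
          and c = "\<lambda>w. triple (Y1 w) (Y2 w) (?X w)"
          and \<Psi> = "\<lambda>a u. unshear (u $ 1) (u $ 2) (u $ 3) a"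
          and Q = "\<lambda>u. u $ 1 * u $ 1 + u $ 2 * u $ 2 + radial e (u $ 3)"
          and q = "\<lambda>x. - angular e x" and q' = "\<lambda>x. - angular1 e x"];
          (rule W z(1) Fz d q | (rule differentiable_triple; rule d) | (intro smooth_on_add[OF open_UNIV] Q)
            | (rule smooth_on_unshear; (assumption | rule smooth_on_nth)) | (simp add: F_def power2_eq_square 4)))
  qed
qed

text \<open>A cutoff valid for every \<open>e \<ge> 1\<close>: at \<open>cosh x = 2\<close> the
  radial term is \<open>4 * e - 11/4\<close>, above the maximum \<open>e\<close> of the angular
  term, and up to there it increases with \<open>cosh x\<close>. It separates the bounded region
  from the rest of \<open>V \<le> 0\<close>.\<close>

definition xmax :: real where "xmax = arcosh 2"

lemma xmax: "xmax > 0" "cosh xmax = 2"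
proof -
  show c: "cosh xmax = 2" by (simp add: xmax_def)
  have "xmax \<noteq> 0" using c by auto
  moreover have "xmax \<ge> 0" by (simp add: xmax_def arcosh_nonneg_real)
  ultimately show "xmax > 0" by simp
qed

lemma cosh_less_2_iff: "cosh x < 2 \<longleftrightarrow> \<bar>x\<bar> < xmax" and cosh_le_2_iff: "cosh x \<le> 2 \<longleftrightarrow> \<bar>x\<bar> \<le> xmax"
  using cosh_less_iff_abs[of x xmax] cosh_less_iff_abs[of xmax x] xmax by (auto simp: not_less[symmetric])

section \<open>The components\<close>

definition strip :: "real \<Rightarrow> phase_space set" where
  "strip c = {z. \<bar>fst (snd z)\<bar> < xmax \<and> \<bar>snd (snd z) - c\<bar> < pi / 2}"

definition closed_strip :: "real \<Rightarrow> phase_space set" where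
  "closed_strip c = {z. \<bar>fst (snd z)\<bar> \<le> xmax \<and> \<bar>snd (snd z) - c\<bar> \<le> pi / 2}"

lemma open_strip: "open (strip c)" and closed_closed_strip: "closed (closed_strip c)"
  unfolding strip_def closed_strip_def
  by (intro open_Collect_conj open_Collect_less closed_Collect_conj closed_Collect_le continuous_intros)+

lemma convex_strip: "convex (strip c)"
proof -
  have "strip c = UNIV \<times> ({- xmax<..<xmax} \<times> {c - pi / 2<..<c + pi / 2})"
    unfolding strip_def abs_less_iff by auto
  also have "convex \<dots>" by (intro convex_Times convex_UNIV convex_real_interval)
  finally show ?thesis .
qed

locale component =
  fixes c e :: real
  assumes c: "c = 0 \<or> c = pi" and e: "e \<ge> 1"
begin

definition E :: real where "E = - 2 * e"

abbreviation "H \<equiv> regularized_H E"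

lemmas H_eq = regularized_H_sheared[of e, folded E_def]
  and V_E_eq = V_eq[of e, folded E_def]
  and has_derivative_H = has_derivative_regularized_H[of e, folded E_def]
  and hessian_pos_H = hessian_tangential_pos[of e, folded E_def]
  and H_chart_exists = regularized_H_chart[of _ _ e, folded E_def]

definition energy :: "real \<Rightarrow> real \<Rightarrow> real \<Rightarrow> real \<Rightarrow> real" where
  "energy a b x t = a\<^sup>2 + b\<^sup>2 + radial e x - angular e t"

text \<open>Sheared coordinates centred at the primary \<open>x = (0, c)\<close>, so that scaling
  toward the origin contracts to it.\<close>

definition chart :: "phase_space \<Rightarrow> phase_space" where
  "chart w = unshear (fst (fst w)) (snd (fst w)) (fst (snd w)) (c + snd (snd w))"

lemma cos_shift: "(cos (c + t))\<^sup>2 = (cos t)\<^sup>2"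
  using c by auto

lemma angular_shift: "angular e (c + t) = angular e t"
  by (simp add: angular_def cos_shift)

lemma H_eq_energy: "H z = energy (Y1 z) (Y2 z) (fst (snd z)) (snd (snd z) - c) / 2"
  unfolding H_eq energy_def using angular_shift[of "snd (snd z) - c"] by simp

lemma H_chart: "H (chart w) = energy (fst (fst w)) (snd (fst w)) (fst (snd w)) (snd (snd w)) / 2"
  by (simp add: H_eq_energy chart_def)

lemma chart_inverse: "chart ((Y1 z, Y2 z), (fst (snd z), snd (snd z) - c)) = z"
  by (simp add: chart_def)

lemma chart_strip_iff:
  "chart w \<in> strip c \<longleftrightarrow> \<bar>fst (snd w)\<bar> < xmax \<and> \<bar>snd (snd w)\<bar> < pi / 2"
  "chart w \<in> closed_strip c \<longleftrightarrow> \<bar>fst (snd w)\<bar> \<le> xmax \<and> \<bar>snd (snd w)\<bar> \<le> pi / 2"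
  by (simp_all add: strip_def closed_strip_def chart_def)

lemma continuous_chart: "continuous_on S chart"
  unfolding chart_def unshear_def
  by (intro continuous_on_Pair continuous_intros continuous_on_sinh) auto

lemma continuous_H: "continuous_on S H"
  by (rule continuous_at_imp_continuous_on) (blast intro: has_derivative_continuous has_derivative_H)

lemma energy_0: "energy 0 0 0 0 = - 1"
  by (simp add: energy_def radial_0 angular_def)

lemma radial_ge: "cosh x \<le> 2 \<Longrightarrow> radial e x \<ge> e - 1"
  and radial_gt: "cosh x \<le> 2 \<Longrightarrow> x \<noteq> 0 \<Longrightarrow> radial e x > e - 1"
proof -
  have gt: "radial e x > e - 1" if "cosh x \<le> 2" "x \<noteq> 0" for x
    using radial_less_of_cosh_less[OF e _ that(1), of 0] that(2) radial_0[of e]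
    by (simp add: cosh_less_iff_abs[of 0 x, simplified])
  then show "cosh x \<le> 2 \<Longrightarrow> x \<noteq> 0 \<Longrightarrow> radial e x > e - 1" by blast
  show "cosh x \<le> 2 \<Longrightarrow> radial e x \<ge> e - 1"
    using gt[of x] radial_0[of e] by (cases "x = 0") auto
qed

lemma energy_pos_of_cosh_eq_2:
  assumes "cosh x = 2"
  shows "radial e x > angular e t"
proof -
  have "radial e x = 4 * e - 11/4" by (simp add: radial_def assms)
  then show ?thesis using angular_le[OF e, of t] e by simp
qed

lemma angular_at_pi_half: "\<bar>t\<bar> = pi / 2 \<Longrightarrow> angular e t = 0"
proof -
  assume "\<bar>t\<bar> = pi / 2"
  then have "t = pi / 2 \<or> t = - (pi / 2)" by linarith
  then have "cos t = 0" by (metis cos_pi_half cos_minus)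
  then show ?thesis by (simp add: angular_def)
qed

text \<open>On the edges in \<open>x1\<close> the radial term exceeds the angular one. On the edges
  in \<open>x2\<close> the angular term vanishes and twice \<open>H\<close> is at least
  \<open>e - 1\<close>, which leaves only the Lagrange lifts at \<open>e = 1\<close>.\<close>

lemma boundary_of_strip:
  assumes z: "z \<in> closed_strip c" "z \<notin> strip c"
  shows "H z \<ge> 0"
    and "H z = 0 \<Longrightarrow> e = 1 \<and> Y1 z = 0 \<and> Y2 z = 0 \<and> fst (snd z) = 0 \<and> \<bar>snd (snd z) - c\<bar> = pi / 2"
proof -
  let ?x = "fst (snd z)" and ?t = "snd (snd z) - c"
  have x: "cosh ?x \<le> 2" using z(1) by (simp add: closed_strip_def cosh_le_2_iff)
  have Y: "0 \<le> (Y1 z)\<^sup>2" "0 \<le> (Y2 z)\<^sup>2" by simp_all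
  show "H z \<ge> 0" "H z = 0 \<Longrightarrow> e = 1 \<and> Y1 z = 0 \<and> Y2 z = 0 \<and> ?x = 0 \<and> \<bar>?t\<bar> = pi / 2"
  proof -
    consider "cosh ?x = 2" | "\<bar>?t\<bar> = pi / 2"
      using z x cosh_less_2_iff[of ?x] by (fastforce simp: strip_def closed_strip_def)
    then have "H z \<ge> 0 \<and> (H z = 0 \<longrightarrow> e = 1 \<and> Y1 z = 0 \<and> Y2 z = 0 \<and> ?x = 0 \<and> \<bar>?t\<bar> = pi / 2)"
    proof cases
      case 1
      have "(Y1 z)\<^sup>2 + (Y2 z)\<^sup>2 + radial e ?x - angular e ?t > 0"
        using energy_pos_of_cosh_eq_2[OF 1, of ?t] Y by linarith
      then have "H z > 0" by (simp add: H_eq_energy energy_def)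
      then show ?thesis by simp
    next
      case 2
      have H: "H z = ((Y1 z)\<^sup>2 + (Y2 z)\<^sup>2 + radial e ?x) / 2"
        by (simp add: H_eq_energy energy_def angular_at_pi_half[OF 2])
      have r: "radial e ?x \<ge> e - 1" "?x \<noteq> 0 \<Longrightarrow> radial e ?x > e - 1"
        using radial_ge[OF x] radial_gt[OF x] by auto
      have "H z \<ge> 0" using H r(1) e Y by argo
      moreover have "e = 1 \<and> Y1 z = 0 \<and> Y2 z = 0 \<and> ?x = 0" if "H z = 0"
      proof -
        have 0: "(Y1 z)\<^sup>2 + (Y2 z)\<^sup>2 + radial e ?x = 0" using that H by simp
        then have "(Y1 z)\<^sup>2 = 0" "(Y2 z)\<^sup>2 = 0" "e = 1" "radial e ?x = e - 1" using r(1) e Y by linarith+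
        then show ?thesis using r(2) by auto
      qed
      ultimately show ?thesis using 2 by simp
    qed
    then show "H z \<ge> 0" "H z = 0 \<Longrightarrow> e = 1 \<and> Y1 z = 0 \<and> Y2 z = 0 \<and> ?x = 0 \<and> \<bar>?t\<bar> = pi / 2" by auto
  qed
qed

lemma cos_nonzero: "z \<in> strip c \<Longrightarrow> cos (snd (snd z)) \<noteq> 0"
proof -
  assume "z \<in> strip c"
  then have "\<bar>snd (snd z) - c\<bar> < pi / 2" by (simp add: strip_def)
  then have "cos (snd (snd z) - c) > 0" unfolding abs_less_iff by (intro cos_gt_zero_pi) linarith+
  then show ?thesis using cos_shift[of "snd (snd z) - c"] by force
qed

lemma hessian_pos:
  assumes "z \<in> strip c" "H z = 0" "h \<noteq> 0" "gradient e z \<bullet> h = 0"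
  shows "hessian e z h \<bullet> h > 0"
proof (rule hessian_pos_H[OF e cos_nonzero[OF assms(1)] _ assms(2-4)])
  show "cosh (fst (snd z)) \<le> 2" using assms(1) by (simp add: cosh_le_2_iff strip_def)
qed

text \<open>In the strip the gradient vanishes only at sheared momenta 0 over the primary, where
  \<open>H\<close> is \<open>- 1/2\<close>, off the zero level.\<close>

lemma gradient_nonzero:
  assumes z: "z \<in> strip c" "H z = 0"
  shows "gradient e z \<noteq> 0"
proof
  let ?x = "fst (snd z)" and ?t = "snd (snd z)"
  assume "gradient e z = 0"
  then have Y: "Y1 z = 0" "Y2 z = 0" and d: "radial1 e ?x = 0" "angular1 e ?t = 0"
    by (auto simp: gradient_def zero_prod_def)
  have "?x = 0"
  proof (rule ccontr)
    define u where "u = cosh ?x"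
    assume "?x \<noteq> 0"
    then have "2 * e * u - 1 - (2 * u ^ 3 - u) / 8 = 0" using d(1) by (simp add: radial1_def u_def)
    moreover have u: "1 \<le> u" "u \<le> 2"
      using z(1) by (auto simp: u_def strip_def cosh_real_ge_1 cosh_le_2_iff)
    have "u\<^sup>2 \<le> 4" using power_mono[OF u(2), of 2] u by simp
    then have "u * u\<^sup>2 \<le> u * 4" using u by (intro mult_left_mono) auto
    then have "u ^ 3 \<le> 4 * u" by (simp add: eval_nat_numeral)
    moreover have "1 * u \<le> e * u" using e u by (intro mult_right_mono) auto
    ultimately show False using u by argo
  qed
  moreover have "(cos ?t)\<^sup>2 = 1"
  proof -
    have "e - (2 * (cos ?t)\<^sup>2 - 1) / 16 > 0"
      using e abs_square_le_1[of "cos ?t"] by simp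
    then have "sin ?t * cos ?t = 0" using d(2) by (simp add: angular1_def sin_double)
    then have "sin ?t = 0" using cos_nonzero[OF z(1)] by simp
    then show ?thesis using sin_cos_squared_add[of ?t] by simp
  qed
  ultimately have "H z = - 1/2" unfolding H_eq by (simp add: Y radial_0 angular_def)
  then show False using z(2) by simp
qed

lemma energy_scaled_less:
  assumes "\<bar>x\<bar> \<le> xmax" "\<bar>t\<bar> \<le> pi / 2" "0 \<le> r" "r < 1" "a \<noteq> 0 \<or> b \<noteq> 0 \<or> x \<noteq> 0 \<or> t \<noteq> 0"
  shows "energy (r * a) (r * b) (r * x) (r * t) < energy a b x t"
  unfolding energy_def
  by (rule sheared_energy_scaled[OF e cosh_le_2_iff[THEN iffD2, OF assms(1)] assms(2-5)])

definition interior_part :: "phase_space set" where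
  "interior_part = {z \<in> strip c. H z < 0}"

definition body :: "phase_space set" where
  "body = {z \<in> closed_strip c. H z \<le> 0}"

text \<open>Shrinking takes even the boundary, including the singular points, into the open part.
  This gives both its connectedness and the density of \<open>interior_part\<close> in
  \<open>body\<close>.\<close>

lemma scaled_in_interior_part:
  assumes "chart w \<in> body" "0 \<le> r" "r < 1"
  shows "chart (r *\<^sub>R w) \<in> interior_part"
proof -
  obtain a b x t where w: "w = ((a, b), (x, t))" by (metis prod.collapse)
  have b: "\<bar>x\<bar> \<le> xmax" "\<bar>t\<bar> \<le> pi / 2" "energy a b x t \<le> 0"
    using assms(1) by (simp_all add: body_def chart_strip_iff H_chart w)
  have "energy (r * a) (r * b) (r * x) (r * t) < 0"
  proof (cases "a \<noteq> 0 \<or> b \<noteq> 0 \<or> x \<noteq> 0 \<or> t \<noteq> 0")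
    case True
    then show ?thesis using energy_scaled_less[OF b(1,2) assms(2,3) True] b(3) by simp
  next
    case False
    then show ?thesis by (simp add: energy_0)
  qed
  moreover have "\<bar>r * x\<bar> < xmax" "\<bar>r * t\<bar> < pi / 2"
  proof -
    have *: "\<bar>r * s\<bar> < m" if "\<bar>s\<bar> \<le> m" "m > 0" for s m
    proof (cases "s = 0")
      case False
      then have "r * \<bar>s\<bar> < 1 * \<bar>s\<bar>" using assms by (intro mult_strict_right_mono) auto
      then show ?thesis using that assms(2) by (simp add: abs_mult)
    qed (use that in simp)
    show "\<bar>r * x\<bar> < xmax" "\<bar>r * t\<bar> < pi / 2" by (rule *; use b xmax in simp)+
  qed
  ultimately show ?thesis by (simp add: interior_part_def chart_strip_iff H_chart w)
qed

lemma interior_part_subset: "interior_part \<subseteq> body"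
  by (auto simp: interior_part_def body_def strip_def closed_strip_def)

lemma zero_in_interior_part: "chart 0 \<in> interior_part"
  using xmax by (simp add: interior_part_def chart_strip_iff H_chart energy_0)

lemma connected_interior_part: "connected interior_part"
proof -
  define S where "S = chart -` interior_part"
  have seg: "closed_segment 0 w \<subseteq> S" if "w \<in> S" for w
  proof
    fix p assume "p \<in> closed_segment 0 w"
    then obtain r where r: "0 \<le> r" "r \<le> 1" "p = r *\<^sub>R w" by (auto simp: in_segment)
    show "p \<in> S"
    proof (cases "r = 1")
      case False
      then have "r < 1" using r by simp
      then show ?thesis
        using scaled_in_interior_part[of w r] that interior_part_subset r by (auto simp: S_def)
    qed (use that r in simp)
  qed
  have "0 \<in> S" using zero_in_interior_part by (simp add: S_def)
  then have "starlike S" unfolding starlike_def using seg by blast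
  then have "connected (chart ` S)"
    by (intro connected_continuous_image[OF continuous_chart] starlike_imp_connected)
  moreover have "chart ` S = interior_part"
    unfolding S_def using chart_inverse by (metis surj_def surj_image_vimage_eq)
  ultimately show ?thesis by simp
qed

lemma convex_interior_part: "convex interior_part"
  unfolding interior_part_def
  by (rule convex_negative_sublevel[OF convex_strip open_strip has_derivative_H
        has_derivative_gradient hessian_pos connected_interior_part[unfolded interior_part_def]])

lemma open_interior_part: "open interior_part"
proof -
  have "interior_part = strip c \<inter> H -` {..<0}" by (auto simp: interior_part_def)
  then show ?thesis using continuous_open_preimage[OF continuous_H open_strip, of "{..<0}"] by simp
qed

lemma closed_body: "closed body"
proof -
  have "body = closed_strip c \<inter> H -` {..0}" by (auto simp: body_def)
  then show ?thesis using continuous_closed_preimage[OF continuous_H closed_closed_strip, of "{..0}"] by simp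
qed

lemma closure_interior_part: "closure interior_part = body"
proof
  show "closure interior_part \<subseteq> body" by (rule closure_minimal[OF interior_part_subset closed_body])
  show "body \<subseteq> closure interior_part"
  proof
    fix z assume z: "z \<in> body"
    define w where "w = ((Y1 z, Y2 z), (fst (snd z), snd (snd z) - c))"
    have zw: "chart w = z" by (simp add: w_def chart_inverse)
    define r where "r n = real n / real (Suc n)" for n
    have r: "0 \<le> r n" "r n < 1" for n by (auto simp: r_def)
    have "(\<lambda>n. r n *\<^sub>R w) \<longlonglongrightarrow> 1 *\<^sub>R w"
      unfolding r_def by (intro tendsto_scaleR LIMSEQ_n_over_Suc_n tendsto_const)
    moreover have "isCont chart w" using continuous_chart[of UNIV] unfolding continuous_on_eq_continuous_at[OF open_UNIV] by blast
    ultimately have "(\<lambda>n. chart (r n *\<^sub>R w)) \<longlonglongrightarrow> z"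
      using isCont_tendsto_compose[of w chart "\<lambda>n. r n *\<^sub>R w"] zw by simp
    moreover have "chart (r n *\<^sub>R w) \<in> interior_part" for n
      by (rule scaled_in_interior_part) (use z zw r in auto)
    ultimately show "z \<in> closure interior_part"
      unfolding closure_sequential by (intro exI[of _ "\<lambda>n. chart (r n *\<^sub>R w)"]) simp
  qed
qed

lemma bounded_body: "bounded body"
proof -
  define K where "K = ({- e..e} \<times> {- e..e}) \<times> ({- xmax..xmax} \<times> {- (pi / 2)..pi / 2})"
  have "compact K" unfolding K_def by (intro compact_Times compact_Icc)
  then have "compact (chart ` K)" by (rule compact_continuous_image[OF continuous_chart])
  moreover have "body \<subseteq> chart ` K"
  proof
    fix z assume z: "z \<in> body"
    let ?x = "fst (snd z)" and ?t = "snd (snd z) - c"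
    have b: "\<bar>?x\<bar> \<le> xmax" "\<bar>?t\<bar> \<le> pi / 2" using z by (auto simp: body_def closed_strip_def)
    have "(Y1 z)\<^sup>2 + (Y2 z)\<^sup>2 + radial e ?x - angular e ?t \<le> 0"
      using z by (simp add: body_def H_eq_energy energy_def)
    moreover have "radial e ?x \<ge> 0" using radial_ge[of ?x] b(1) e by (simp add: cosh_le_2_iff)
    moreover have "angular e ?t \<le> e" by (rule angular_le[OF e])
    \<comment> \<open>The energy bounds the squared momenta by \<open>e\<close>; this weakens the
      bound to \<open>e\<^sup>2\<close>, whose root is \<open>e\<close>.\<close>
    moreover have "e * 1 \<le> e * e" using e by (intro mult_left_mono) auto
    moreover have "0 \<le> (Y1 z)\<^sup>2" "0 \<le> (Y2 z)\<^sup>2" by simp_all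
    ultimately have "(Y1 z)\<^sup>2 \<le> e\<^sup>2" "(Y2 z)\<^sup>2 \<le> e\<^sup>2" unfolding power2_eq_square[of e] by linarith+
    then have "\<bar>Y1 z\<bar> \<le> e" "\<bar>Y2 z\<bar> \<le> e" using e abs_le_square_iff[of "Y1 z" e] abs_le_square_iff[of "Y2 z" e] by auto
    then have "((Y1 z, Y2 z), (?x, ?t)) \<in> K" using b unfolding K_def abs_le_iff by auto
    then show "z \<in> chart ` K" using chart_inverse[of z] by (metis image_eqI)
  qed
  ultimately show ?thesis using compact_imp_bounded bounded_subset by blast
qed

text \<open>An open convex set is the interior of its closure, so the frontier is what
  \<open>interior_part\<close> misses. Outside the open strip \<open>boundary_of_strip\<close> gives
  \<open>H z \<ge> 0\<close>, hence equality on \<open>body\<close>.\<close>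

lemma frontier_body: "frontier body = {z \<in> closed_strip c. H z = 0}"
proof -
  have "frontier body = body - interior_part"
    using frontier_of_closure_convex_open[OF convex_interior_part open_interior_part]
    by (simp add: closure_interior_part)
  also have "\<dots> = {z \<in> closed_strip c. H z = 0}"
    using boundary_of_strip(1) by (force simp: body_def interior_part_def)
  finally show ?thesis .
qed

text \<open>Trades the connected component for the explicit cutoff at \<open>xmax\<close>: the
  region \<open>R\<close> is star-shaped about the primary, hence connected, and no point with
  \<open>V E x \<le> 0\<close> lies on the cutoff lines.\<close>

lemma component_cover_eq: "component_cover c E = {z \<in> closed_strip c. H z = 0}"
proof -
  define T where "T = {x. V E x \<le> 0 \<and> c - pi / 2 \<le> snd x \<and> snd x \<le> c + pi / 2}"
  define R where "R = {x \<in> T. \<bar>fst x\<bar> \<le> xmax}"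
  have VG: "V E (x, c + t) = energy 0 0 x t / 2" for x t
    by (simp only: V_E_eq energy_def angular_shift) simp
  have star: "closed_segment (0, c) p \<subseteq> R" if p: "p \<in> R" for p
  proof
    obtain x t where pxt: "p = (x, c + t)" by (metis add_diff_cancel_left' diff_add_cancel prod.collapse add.commute)
    have b: "\<bar>x\<bar> \<le> xmax" "\<bar>t\<bar> \<le> pi / 2" "energy 0 0 x t \<le> 0"
      using p unfolding R_def T_def by (auto simp: pxt VG abs_le_iff)
    fix q assume "q \<in> closed_segment (0, c) p"
    then obtain r where r: "0 \<le> r" "r \<le> 1" "q = (1 - r) *\<^sub>R (0, c) + r *\<^sub>R p" by (auto simp: in_segment)
    have q: "q = (r * x, c + r * t)" unfolding r(3) pxt by (simp add: algebra_simps)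
    have "energy 0 0 (r * x) (r * t) \<le> 0"
    proof (cases "r = 1 \<or> (x = 0 \<and> t = 0)")
      case True
      then show ?thesis using b(3) by (auto simp: energy_0)
    next
      case False
      then show ?thesis using energy_scaled_less[of x t r 0 0] b r by simp
    qed
    moreover have "\<bar>r * x\<bar> \<le> xmax" "\<bar>r * t\<bar> \<le> pi / 2"
      using b mult_left_le_one_le[of "\<bar>x\<bar>" r] mult_left_le_one_le[of "\<bar>t\<bar>" r] r by (auto simp: abs_mult)
    ultimately show "q \<in> R" unfolding R_def T_def by (auto simp: q VG abs_le_iff)
  qed
  have 0: "(0, c) \<in> R"
    using VG[of 0 0] xmax by (simp add: R_def T_def energy_0)
  have "connected R" using star 0 unfolding starlike_def by (intro starlike_imp_connected[unfolded starlike_def]) blast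
  then have sub1: "R \<subseteq> connected_component_set T (0, c)"
    by (rule connected_component_maximal[OF 0]) (auto simp: R_def)
  have "connected_component_set T (0, c) \<subseteq> R"
  proof -
    let ?C = "connected_component_set T (0, c)"
    have sub: "?C \<subseteq> T" by (rule connected_component_subset)
    have o: "open {x::real \<times> real. \<bar>fst x\<bar> < xmax}" "open {x::real \<times> real. xmax < \<bar>fst x\<bar>}"
      by (intro open_Collect_less continuous_intros)+
    \<comment> \<open>The component cannot cross the lines where the radial term dominates, so it
      stays on the side of the primary.\<close>
    have "\<bar>fst p\<bar> \<noteq> xmax" if "p \<in> T" for p
    proof
      assume "\<bar>fst p\<bar> = xmax"
      then have "cosh (fst p) = 2" using xmax by (metis cosh_real_abs)
      then have "radial e (fst p) > angular e (snd p)" by (rule energy_pos_of_cosh_eq_2)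
      then have "V E (fst p, snd p) > 0" unfolding V_E_eq by simp
      then show False using that by (simp add: T_def)
    qed
    then have "?C \<subseteq> {x. \<bar>fst x\<bar> < xmax} \<union> {x. xmax < \<bar>fst x\<bar>}" using sub by fastforce
    then have "{x. \<bar>fst x\<bar> < xmax} \<inter> ?C = {} \<or> {x. xmax < \<bar>fst x\<bar>} \<inter> ?C = {}"
      by (intro connectedD[OF connected_connected_component o]) auto
    moreover have "(0, c) \<in> {x. \<bar>fst x\<bar> < xmax} \<inter> ?C" using 0 sub1 xmax by auto
    ultimately have "{x. xmax < \<bar>fst x\<bar>} \<inter> ?C = {}" by blast
    then show ?thesis using sub by (force simp: R_def)
  qed
  with sub1 have CR: "connected_component_set T (0, c) = R" by blast
  have "V E (snd z) \<le> 0" if "H z = 0" for z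
  proof -
    have "H z = ((Y1 z)\<^sup>2 + (Y2 z)\<^sup>2) / 2 + V E (fst (snd z), snd (snd z))"
      unfolding H_eq V_E_eq by (simp add: field_simps)
    moreover have "0 \<le> ((Y1 z)\<^sup>2 + (Y2 z)\<^sup>2) / 2" by simp
    ultimately have "V E (fst (snd z), snd (snd z)) \<le> 0" using that by linarith
    then show ?thesis by simp
  qed
  then show ?thesis
    unfolding component_cover_def T_def[symmetric] CR
    unfolding R_def T_def closed_strip_def abs_le_iff by auto
qed

lemma bounds_convex_set_component_cover: "bounds_convex_set (component_cover c E)"
  unfolding bounds_convex_set_def
proof (intro exI[of _ body] conjI)
  show "compact body" using closed_body bounded_body by (simp add: compact_eq_bounded_closed)
  show "convex body" using convex_closure[OF convex_interior_part] by (simp add: closure_interior_part)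
  show "interior body \<noteq> {}"
    using interior_maximal[OF interior_part_subset open_interior_part] zero_in_interior_part by blast
  show "frontier body = component_cover c E" by (simp only: frontier_body component_cover_eq)
qed

text \<open>By \<open>boundary_of_strip\<close> the zero level leaves the open strip only at the
  lifts of the Lagrange point, and only at the critical energy. What remains is relatively open in
  the level set, as the charts require.\<close>

lemma smooth_part_eq:
  "component_cover c E - singular_points c E = {z. H z = 0} \<inter> strip c"
proof -
  \<comment> \<open>The shear vanishes at these lifts, so zero sheared momenta mean
    \<open>y = 0\<close> there.\<close>
  have sc: "sin (2 * (c - pi / 2)) = 0" "sin (2 * (c + pi / 2)) = 0"
    using c by (auto simp: sin_double)
  have sub: "strip c \<subseteq> closed_strip c" by (auto simp: strip_def closed_strip_def)
  have "z \<in> singular_points c E" if z: "z \<in> closed_strip c" "z \<notin> strip c" "H z = 0" for z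
  proof -
    have f: "e = 1" "Y1 z = 0" "Y2 z = 0" "fst (snd z) = 0" "\<bar>snd (snd z) - c\<bar> = pi / 2"
      using boundary_of_strip(2)[OF z] by auto
    then have t: "snd (snd z) = c - pi / 2 \<or> snd (snd z) = c + pi / 2" by (auto simp: abs_if split: if_splits)
    then have "sin (2 * snd (snd z)) = 0" using sc by auto
    then have "fst (fst z) = 0" "snd (fst z) = 0" using f by (simp_all add: Y1_def Y2_def)
    then have "z = ((0, 0), (0, snd (snd z)))" using f(4) by (metis prod.collapse)
    moreover have "E = L1"
    proof -
      have "- 2 * e = L1" using f(1) by (simp add: L1_eq)
      then show ?thesis by (simp only: E_def)
    qed
    ultimately show ?thesis using t by (auto simp: singular_points_def)
  qed
  moreover have "z \<notin> strip c" if "z \<in> singular_points c E" for z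
    using that by (auto simp: singular_points_def strip_def split: if_splits)
  ultimately show ?thesis unfolding component_cover_eq using sub by blast
qed

lemma positive_sectional_curvatures_smooth_part:
  "positive_sectional_curvatures (component_cover c E - singular_points c E)"
  unfolding smooth_part_eq positive_sectional_curvatures_def
proof (intro conjI allI impI ballI)
  fix z assume z: "z \<in> {z. H z = 0} \<inter> strip c"
  then show "\<exists>(U :: (real^3) set) \<phi>. local_parametrization ({z. H z = 0} \<inter> strip c) U \<phi> \<and> z \<in> \<phi> ` U"
    by (intro H_chart_exists[OF open_strip] gradient_nonzero) auto
next
  fix U :: "(real^3) set" and \<phi> u and v w :: "real^3"
  assume p: "local_parametrization ({z. H z = 0} \<inter> strip c) U \<phi>" and u: "u \<in> U"
    and vw: "v \<noteq> w \<and> independent {v, w}"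
  have patch: "immersed_patch \<phi> U" using p by (simp add: immersed_patch_def local_parametrization_def)
  have on: "\<phi> x \<in> strip c" "H (\<phi> x) = 0" if "x \<in> U" for x
    using p that unfolding local_parametrization_def by blast+
  show "sectional_curvature (induced_metric \<phi>) u v w > 0"
    by (rule level_set_sectional_curvature_pos[OF patch u _ on(2) has_derivative_H
          has_derivative_gradient gradient_nonzero[OF on[OF u]] hessian_pos[OF on[OF u]]])
      (use vw in auto)
qed

lemma strictly_convex_component: "strictly_convex c (- 2 * e)"
  unfolding E_def[symmetric] strictly_convex_def
  using bounds_convex_set_component_cover positive_sectional_curvatures_smooth_part by blast

end

theorem theorem1p12:
  fixes E :: real
  assumes "E \<le> L1"
  shows "earth_component_strictly_convex E \<and> moon_component_strictly_convex E"
proof -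
  define e where "e = - E / 2"
  have E: "E = - 2 * e" by (simp add: e_def)
  have e: "e \<ge> 1" using assms by (simp add: e_def L1_eq)
  have "component pi e" "component 0 e" using e by (simp_all add: component_def)
  then show ?thesis
    unfolding earth_component_strictly_convex_def moon_component_strictly_convex_def E
    using component.strictly_convex_component by blast
qed

end
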